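(* For $n\ge 6$, the $n$-vertex extremal graphs for the triangular prism $C_3^{\square}$ are, up to isomorphism, exactly the following. (1) $n=6$: $G_1$ and $H_6^3$. (2) $n=7$: $G_2$, $F_7^{4,1}$, $F_7^{4,4}$ and $H_7^3$. (3) $n=8$: $G_3$, $F_8^{4,1}$, $F_8^{4,4}$, $F_8^{5,2}$ and $F_8^{5,5}$. (4) $n\ge 9$: - if $n\equiv 0\pmod 6$: $H_n^{n/2}$; - if $n\equiv 1\pmod 6$: $F_n^{\lceil n/2\rceil,j}$ and $H_n^{\lfloor n/2\rfloor}$; - if $n\equiv 2\pmod 6$: $F_n^{n/2,j}$ and $F_n^{n/2+1,j}$; - if $n\equiv 3\pmod 6$: $F_n^{\lceil n/2\rceil,j}$ and $H_n^{\lceil n/2\rceil+1}$; - if $n\equiv 4\pmod 6$: $H_n^{n/2+1}$; - if $n\equiv 5\pmod 6$: $H_n^{\lceil n/2\rceil}$; where in each graph $F_n^{i,j}$ the integer $j$ ranges over all integers with $1\le j\le i$ and $3\mid (i-j)$.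
   Context: All graphs are finite, simple and undirected. An $n$-vertex extremal graph for $H$ is an $n$-vertex graph with the maximum number of edges among all $n$-vertex graphs containing no subgraph (not necessarily induced) isomorphic to $H$. The triangular prism $C_3^{\square}=C_3\square K_2$ consists of two vertex-disjoint triangles $u_1u_2u_3$, $w_1w_2w_3$ together with the edges $u_1w_1,u_2w_2,u_3w_3$. Let $K_{i,n-i}$ be the complete bipartite graph with parts $X,Y$, $|X|=i$, $|Y|=n-i$. - If $3\mid i$, $H_n^i$ is the $n$-vertex graph obtained from $K_{i,n-i}$ by embedding $i/3$ vertex-disjoint triangles in $X$ (leaving $Y$ independent). - If $3\nmid i$ and $1\le j\le i$ with $3\mid(i-j)$, $F_n^{i,j}$ is obtained from $K_{i,n-i}$ by embedding in $X$ a star on $j$ vertices (i.e. $K_{1,j-1}$; a single vertex if $j=1$) and $(i-j)/3$ vertex-disjoint triangles, the star being vertex-disjoint from all the triangles (leaving $Y$ independent). The exceptional graphs: - $G_1$ has vertices $v_1,\dots,v_6$; $\{v_2,v_3,v_4,v_5,v_6\}$ induces $K_5$, and $v_1$ is adjacent to exactly $v_2,v_3$ (12 edges). - $G_2$ has vertices $v,v_1,\dots,v_6$ and is the union of a $K_5$ on $\{v,v_1,v_2,v_3,v_4\}$ and a $K_4$ on $\{v_3,v_4,v_5,v_6\}$, sharing the edge $v_3v_4$ (15 edges). - $G_3$ has vertices $x,y,v_1,\dots,v_6$ and is the union of a $K_5$ on $\{x,v_1,v_2,v_3,v_4\}$ and a $K_5$ on $\{y,v_3,v_4,v_5,v_6\}$,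 sharing the edge $v_3v_4$ (19 edges). *)

theory Defs
  imports Main
begin

type_synonym 'a ugraph = "'a set \<times> 'a set set"

abbreviation verts :: "'a ugraph \<Rightarrow> 'a set" where "verts \<equiv> fst"
abbreviation edges :: "'a ugraph \<Rightarrow> 'a set set" where "edges \<equiv> snd"

definition simple_graph :: "'a ugraph \<Rightarrow> bool" where
  "simple_graph G \<longleftrightarrow> finite (verts G) \<and> (\<forall>e\<in>edges G. e \<subseteq> verts G \<and> card e = 2)"

(* Intended for graphs satisfying simple_graph: only the two-element edges are compared. *)
definition graph_iso :: "'a ugraph \<Rightarrow> 'b ugraph \<Rightarrow> bool" (infix "\<simeq>" 50) where
  "G \<simeq> H \<longleftrightarrow> (\<exists>f. bij_betw f (verts G) (verts H) \<and>
     (\<forall>u\<in>verts G. \<forall>v\<in>verts G. {u, v} \<in> edges G \<longleftrightarrow> {f u, f v} \<in> edges H))"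

definition subgraph :: "'a ugraph \<Rightarrow> 'a ugraph \<Rightarrow> bool" where
  "subgraph K G \<longleftrightarrow> simple_graph K \<and> verts K \<subseteq> verts G \<and> edges K \<subseteq> edges G"

definition contains_copy :: "'a ugraph \<Rightarrow> 'b ugraph \<Rightarrow> bool" where
  "contains_copy G H \<longleftrightarrow> (\<exists>K. subgraph K G \<and> K \<simeq> H)"

definition free_graph :: "nat \<Rightarrow> 'b ugraph \<Rightarrow> 'a ugraph \<Rightarrow> bool" where
  "free_graph n H G \<longleftrightarrow> simple_graph G \<and> card (verts G) = n \<and> \<not> contains_copy G H"

(* The competitors G' range over graphs with vertices in the same type as G.  Nothing is lost:
   G has n vertices, so every n-vertex graph has an isomorphic copy on the vertex set of G. *)
definition extremal_graph :: "nat \<Rightarrow> 'b ugraph \<Rightarrow> 'a ugraph \<Rightarrow> bool" where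
  "extremal_graph n H G \<longleftrightarrow> free_graph n H G \<and>
     (\<forall>G' :: 'a ugraph. free_graph n H G' \<longrightarrow> card (edges G') \<le> card (edges G))"

definition clique_edges :: "'a set \<Rightarrow> 'a set set" where
  "clique_edges S = {{x, y} | x y. x \<in> S \<and> y \<in> S \<and> x \<noteq> y}"

definition bipartite_edges :: "'a set \<Rightarrow> 'a set \<Rightarrow> 'a set set" where
  "bipartite_edges X Y = {{x, y} | x y. x \<in> X \<and> y \<in> Y}"

definition star_edges :: "'a \<Rightarrow> 'a set \<Rightarrow> 'a set set" where
  "star_edges c S = {{c, x} | x. x \<in> S \<and> x \<noteq> c}"

(* m consecutive vertex-disjoint triangles on the vertices a, ..., a + 3 * m - 1 *)
definition triangle_edges :: "nat \<Rightarrow> nat \<Rightarrow> nat set set" where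
  "triangle_edges a m = (\<Union>k<m. clique_edges {a + 3 * k, a + 3 * k + 1, a + 3 * k + 2})"

(* u1, u2, u3 are 1, 2, 3 and w1, w2, w3 are 4, 5, 6. *)
definition prism :: "nat ugraph" where
  "prism = ({1..6}, clique_edges {1, 2, 3} \<union> clique_edges {4, 5, 6} \<union> {{1, 4}, {2, 5}, {3, 6}})"

(* In graph_H and graph_F the parts are X = {0..<i} and Y = {i..<n}.  graph_H is meant for
   3 dvd i; graph_F for not 3 dvd i, 1 \<le> j \<le> i and 3 dvd i - j, with the star (centre 0)
   on {0..<j} and the triangles covering {j..<i}. *)
definition graph_H :: "nat \<Rightarrow> nat \<Rightarrow> nat ugraph" where
  "graph_H n i = ({0..<n}, bipartite_edges {0..<i} {i..<n} \<union> triangle_edges 0 (i div 3))"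

definition graph_F :: "nat \<Rightarrow> nat \<Rightarrow> nat \<Rightarrow> nat ugraph" where
  "graph_F n i j = ({0..<n}, bipartite_edges {0..<i} {i..<n} \<union>
     star_edges 0 {0..<j} \<union> triangle_edges j ((i - j) div 3))"

definition G1 :: "nat ugraph" where
  "G1 = ({1..6}, clique_edges {2, 3, 4, 5, 6} \<union> {{1, 2}, {1, 3}})"

(* v is 0 and each v_k is k. *)
definition G2 :: "nat ugraph" where
  "G2 = ({0..6}, clique_edges {0, 1, 2, 3, 4} \<union> clique_edges {3, 4, 5, 6})"

(* x is 7, y is 8 and each v_k is k. *)
definition G3 :: "nat ugraph" where
  "G3 = ({1..8}, clique_edges {7, 1, 2, 3, 4} \<union> clique_edges {8, 3, 4, 5, 6})"

(* G is some F_n^{i,j} up to isomorphism, j ranging over all admissible values. *)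
definition iso_some_F :: "nat \<Rightarrow> nat \<Rightarrow> 'a ugraph \<Rightarrow> bool" where
  "iso_some_F n i G \<longleftrightarrow> (\<exists>j. 1 \<le> j \<and> j \<le> i \<and> 3 dvd (i - j) \<and> G \<simeq> graph_F n i j)"

end

theory Submission
  imports Defs
begin

text \<open>
  Let \<open>f n\<close> be the claimed maximum (\<open>exn n\<close> below).  The upper bound goes by induction on the number of vertices,
  always deleting a small dense subgraph to which the remaining vertices send few edges.
  A \<open>K\<^sub>5\<close> receives at most two edges from each outside vertex.  If \<open>H\<close> is a triangle with three
  common neighbours, an outside vertex sends at most three edges to \<open>H\<close>, and three only if it is joined to
  precisely the triangle or precisely the other three vertices; as \<open>f (n + 6) = f n + 3 n + 12\<close>, equality
  makes this dichotomy extend to a partition of all vertices into an independent set and a set inducing no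
  path on four vertices.  If neither occurs, a \<open>K\<^sub>4\<close> leads to strictly fewer than \<open>f n\<close> edges.
  A graph without \<open>K\<^sub>4\<close> has an edge whose end vertices have degree sum at most \<open>n + 1\<close> (look at the
  neighbourhood of a vertex of maximum degree); deleting such edges one by one shows that there are at most
  \<open>(n + 1)\<^sup>2 div 4 - 1\<close> edges, with equality only for a vertex joined to a balanced complete bipartite graph.

  Conversely, a set of \<open>i\<close> vertices inducing no path on four vertices spans at most \<open>i\<close> edges, and at least
  \<open>i - 1\<close> only if it is a disjoint union of triangles and at most one star.
\<close>

section \<open>Edge counts and degrees\<close>

text \<open>A prism minus two non-adjacent vertices, one from each triangle, is a path on four
  vertices; hence joining an independent set to a set without such a path is safe. A part of size
  \<open>i\<close> reaches \<open>i\<close> inner edges only if 3 divides \<open>i\<close>, so the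
  maximum depends on \<open>n\<close> modulo 6. Deleting a few vertices therefore does not in
  general lead from one extremal graph to another; deleting a triangle with three common neighbours
  does, and this configuration carries most of the equality analysis. Graphs without K4 cannot be
  dismissed by a strict bound: for \<open>n\<close> equal to 1, 2 or 3 modulo 6 the value
  \<open>(n + 1)^2 div 4 - 1\<close> is the full maximum, attained by the graphs
  \<open>graph_F n i i\<close> whose part is a single star. Next to a K5, equality is numerically
  possible with up to five further vertices. These would form a clique together with two vertices of
  the K5, and K6 contains a prism, so at most three of them remain: this is why the exceptional
  graphs stop at eight vertices. The arguments use a bare predicate \<open>adj\<close>, so that a
  set of vertices stands for the subgraph it induces and the inductions run over sets.\<close>

locale sgraph =
  fixes adj :: "'a \<Rightarrow> 'a \<Rightarrow> bool"
  assumes sym: "adj x y \<Longrightarrow> adj y x"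
    and irr: "\<not> adj x x"
begin

definition dg :: "'a \<Rightarrow> 'a set \<Rightarrow> nat" where
  "dg v S = card {y \<in> S. adj v y}"

definition ne :: "'a set \<Rightarrow> nat" where
  "ne S = card {{x, y} | x y. x \<in> S \<and> y \<in> S \<and> adj x y}"

definition clique :: "'a set \<Rightarrow> bool" where
  "clique S \<longleftrightarrow> (\<forall>x\<in>S. \<forall>y\<in>S. x \<noteq> y \<longrightarrow> adj x y)"

definition indep :: "'a set \<Rightarrow> bool" where
  "indep S \<longleftrightarrow> (\<forall>x\<in>S. \<forall>y\<in>S. \<not> adj x y)"

lemma adj_neq: "adj x y \<Longrightarrow> x \<noteq> y"
  using irr by blast

lemma adj_commute: "adj x y \<longleftrightarrow> adj y x"
  using sym by blast

lemma dg_le: "finite S \<Longrightarrow> dg v S \<le> card S"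
  unfolding dg_def by (rule card_mono) auto

lemma dg_Un:
  assumes "finite S" "finite T" "S \<inter> T = {}"
  shows "dg v (S \<union> T) = dg v S + dg v T"
proof -
  have "{y \<in> S \<union> T. adj v y} = {y \<in> S. adj v y} \<union> {y \<in> T. adj v y}" by auto
  then show ?thesis unfolding dg_def using assms by (subst card_Un_disjoint[symmetric]) auto
qed

lemma dg_empty [simp]: "dg v {} = 0"
  by (simp add: dg_def)

lemma dg_insert:
  assumes "finite S" "x \<notin> S"
  shows "dg v (insert x S) = (if adj v x then 1 else 0) + dg v S"
proof -
  have "dg v {x} = (if adj v x then 1 else 0)"
  proof (cases "adj v x")
    case True
    then have "{y \<in> {x}. adj v y} = {x}" by auto
    then show ?thesis using True by (simp add: dg_def)
  next
    case False
    then have "{y \<in> {x}. adj v y} = {}" by auto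
    then show ?thesis using False by (simp add: dg_def)
  qed
  then show ?thesis using dg_Un[of "{x}" S v] assms by simp
qed

lemma dg_full:
  assumes "finite S" "dg v S \<ge> card S" "x \<in> S"
  shows "adj v x"
proof -
  have "{y \<in> S. adj v y} = S"
    by (rule card_seteq) (use assms in \<open>auto simp: dg_def\<close>)
  then show ?thesis using assms by auto
qed

lemma dg_ge_1:
  assumes "dg v S \<ge> 1"
  obtains a where "a \<in> S" "adj v a"
proof -
  have "{y \<in> S. adj v y} \<noteq> {}"
  proof
    assume "{y \<in> S. adj v y} = {}"
    then have "dg v S = 0" unfolding dg_def by (simp only: card.empty)
    then show False using assms by simp
  qed
  then show ?thesis using that by blast
qed

lemma dg_ge_2:
  assumes "dg v S \<ge> 2"
  obtains a b where "a \<in> S" "b \<in> S" "a \<noteq> b" "adj v a" "adj v b"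
proof -
  obtain T where T: "T \<subseteq> {y \<in> S. adj v y}" "card T = 2"
    using assms unfolding dg_def by (rule obtain_subset_with_card_n)
  then obtain a b where "T = {a, b}" "a \<noteq> b" by (meson card_2_iff)
  then show ?thesis using that[of a b] T(1) by simp
qed

lemma dg_ge_3:
  assumes "dg v S \<ge> 3"
  obtains a b c where "a \<in> S" "b \<in> S" "c \<in> S" "a \<noteq> b" "a \<noteq> c" "b \<noteq> c"
    "adj v a" "adj v b" "adj v c"
proof -
  obtain T where T: "T \<subseteq> {y \<in> S. adj v y}" "card T = 3"
    using assms unfolding dg_def by (rule obtain_subset_with_card_n)
  then obtain a b c where "T = {a, b, c}" "a \<noteq> b" "a \<noteq> c" "b \<noteq> c"
    by (metis card_3_iff)
  then show ?thesis using that[of a b c] T(1) by simp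
qed

lemma ne_finite: "finite S \<Longrightarrow> finite {{x, y} | x y. x \<in> S \<and> y \<in> S \<and> adj x y}"
  by (rule finite_subset[of _ "Pow S"]) auto

lemma ne_empty [simp]: "ne {} = 0"
  by (simp add: ne_def)

lemma ne_insert:
  assumes "finite S" "v \<notin> S"
  shows "ne (insert v S) = ne S + dg v S"
proof -
  let ?N = "{y \<in> S. adj v y}"
  have eq: "{{x, y} | x y. x \<in> insert v S \<and> y \<in> insert v S \<and> adj x y} =
    {{x, y} | x y. x \<in> S \<and> y \<in> S \<and> adj x y} \<union> (\<lambda>y. {v, y}) ` ?N" (is "?A = ?B \<union> ?C")
  proof
    show "?A \<subseteq> ?B \<union> ?C"
    proof
      fix e assume "e \<in> ?A"
      then obtain x y where e: "e = {x, y}" "x \<in> insert v S" "y \<in> insert v S" "adj x y" by blast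
      show "e \<in> ?B \<union> ?C"
      proof (cases "x = v \<or> y = v")
        case True
        then have "e \<in> ?C"
          using e irr sym by (auto simp: insert_commute)
        then show ?thesis by blast
      next
        case False
        then show ?thesis using e by blast
      qed
    qed
    show "?B \<union> ?C \<subseteq> ?A" by blast
  qed
  have disj: "?B \<inter> ?C = {}" using assms by (auto simp: doubleton_eq_iff)
  have inj: "inj_on (\<lambda>y. {v, y}) ?N" by (auto simp: inj_on_def doubleton_eq_iff)
  show ?thesis
    unfolding ne_def eq using card_Un_disjoint[OF ne_finite[OF assms(1)] _ disj] assms(1)
    by (simp add: card_image[OF inj] dg_def)
qed

lemma ne_Un:
  assumes "finite S" "finite T" "S \<inter> T = {}"
  shows "ne (S \<union> T) = ne S + ne T + (\<Sum>t\<in>T. dg t S)"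
  using assms(2,3)
proof (induction T rule: finite_induct)
  case empty
  then show ?case by simp
next
  case (insert t T)
  have "ne (S \<union> insert t T) = ne (S \<union> T) + dg t (S \<union> T)"
    using ne_insert[of "S \<union> T" t] insert assms(1) by auto
  moreover have "dg t (S \<union> T) = dg t S + dg t T" using dg_Un insert assms(1) by auto
  ultimately show ?case using insert ne_insert[of T t] by auto
qed

lemma ne_split:
  assumes "finite V" "S \<subseteq> V"
  shows "ne V = ne S + ne (V - S) + (\<Sum>t\<in>V - S. dg t S)"
  using ne_Un[of S "V - S"] assms by (simp add: finite_subset Un_absorb1)

lemma sum_dg_swap:
  assumes "finite S" "finite T"
  shows "(\<Sum>t\<in>T. dg t S) = (\<Sum>s\<in>S. dg s T)"
proof -
  have *: "dg t U = (\<Sum>s\<in>U. if adj t s then 1 else 0)" if "finite U" for t U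
    using that by (induction U rule: finite_induct) (simp_all add: dg_insert)
  have "(\<Sum>t\<in>T. dg t S) = (\<Sum>t\<in>T. \<Sum>s\<in>S. if adj t s then 1 else 0)"
    using * assms by simp
  also have "\<dots> = (\<Sum>s\<in>S. \<Sum>t\<in>T. if adj s t then 1 else 0)"
    by (subst sum.swap) (simp only: adj_commute)
  finally show ?thesis using * assms by simp
qed

lemma ne_le: "finite S \<Longrightarrow> 2 * ne S \<le> card S * (card S - 1)"
proof (induction S rule: finite_induct)
  case empty
  then show ?case by simp
next
  case (insert x S)
  then show ?case using ne_insert[of S x] dg_le[of S x]
    by (cases "card S") (auto simp: algebra_simps)
qed

lemma ne_full:
  assumes "finite S" "2 * ne S \<ge> card S * (card S - 1)"
  shows "clique S"
  using assms
proof (induction S rule: finite_induct)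
  case empty
  then show ?case by (simp add: clique_def)
next
  case (insert x S)
  have 1: "ne (insert x S) = ne S + dg x S" using insert ne_insert by auto
  have 2: "dg x S \<le> card S" "2 * ne S \<le> card S * (card S - 1)" using insert dg_le ne_le by auto
  have 3: "Suc (card S) * card S = card S * (card S - 1) + 2 * card S"
    by (cases "card S") auto
  have 4: "2 * ne S + 2 * dg x S \<ge> Suc (card S) * card S" using insert 1 by auto
  have "2 * ne S \<ge> card S * (card S - 1)" "dg x S \<ge> card S" using 2 3 4 by linarith+
  then have "clique S" "\<forall>y\<in>S. adj x y" using insert dg_full by auto
  then show ?case using sym by (auto simp: clique_def)
qed

lemma ne_clique: "finite S \<Longrightarrow> clique S \<Longrightarrow> 2 * ne S = card S * (card S - 1)"
proof (induction S rule: finite_induct)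
  case empty
  then show ?case by simp
next
  case (insert x S)
  have "{y \<in> S. adj x y} = S" using insert by (auto simp: clique_def)
  then have "dg x S = card S" by (simp add: dg_def)
  moreover have "clique S" using insert by (auto simp: clique_def)
  ultimately show ?case using ne_insert[of S x] insert
    by (cases "card S") (auto simp: algebra_simps)
qed

lemma ne_indep: "indep S \<Longrightarrow> ne S = 0"
  unfolding ne_def indep_def by (auto simp: card_eq_0_iff)

lemma cliqueD: "clique K \<Longrightarrow> a \<in> K \<Longrightarrow> b \<in> K \<Longrightarrow> a \<noteq> b \<Longrightarrow> adj a b"
  by (auto simp: clique_def)

lemma clique_subset: "clique K \<Longrightarrow> L \<subseteq> K \<Longrightarrow> clique L"
  by (auto simp: clique_def)

lemma third_element:
  assumes "card A \<ge> 3"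
  obtains c where "c \<in> A" "c \<noteq> a" "c \<noteq> b"
proof -
  have "card {a, b} \<le> 2" by (simp add: card_insert_if)
  then have "\<not> A \<subseteq> {a, b}" using assms card_mono[of "{a, b}" A] by auto
  then show ?thesis using that by blast
qed

lemma dg_eq_0I:
  assumes "\<And>x. x \<in> S \<Longrightarrow> \<not> adj v x"
  shows "dg v S = 0"
proof -
  have "{y \<in> S. adj v y} = {}" using assms by blast
  then show ?thesis unfolding dg_def by (simp only: card.empty)
qed

lemma max_dg:
  assumes "finite X" "X \<noteq> {}"
  shows "\<exists>c\<in>X. \<forall>x\<in>X. dg x S \<le> dg c S"
proof -
  have "Max ((\<lambda>x. dg x S) ` X) \<in> (\<lambda>x. dg x S) ` X" using assms by (intro Max_in) auto
  then obtain c where "c \<in> X" "dg c S = Max ((\<lambda>x. dg x S) ` X)" by auto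
  then show ?thesis using assms by (auto intro!: bexI[of _ c] Max_ge)
qed

lemma sum_dg_le:
  assumes "finite T" "\<And>t. t \<in> T \<Longrightarrow> dg t S \<le> k"
  shows "(\<Sum>t\<in>T. dg t S) \<le> k * card T"
  using sum_bounded_above[of T "\<lambda>t. dg t S" k] assms by (simp add: mult.commute)

section \<open>Sets without a path on four vertices, and triangle-free sets\<close>

text \<open>The path is forbidden as a subgraph, induced or not. Consecutive vertices differ by
  irreflexivity, so only the three remaining coincidences have to be listed.\<close>

definition noP4 :: "'a set \<Rightarrow> bool" where
  "noP4 X \<longleftrightarrow> (\<forall>a\<in>X. \<forall>b\<in>X. \<forall>c\<in>X. \<forall>d\<in>X. adj a b \<longrightarrow> adj b c \<longrightarrow> adj c d \<longrightarrow> a = c \<or> a = d \<or> b = d)"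

lemma noP4D: "noP4 X \<Longrightarrow> a \<in> X \<Longrightarrow> b \<in> X \<Longrightarrow> c \<in> X \<Longrightarrow> d \<in> X \<Longrightarrow>
    adj a b \<Longrightarrow> adj b c \<Longrightarrow> adj c d \<Longrightarrow> a = c \<or> a = d \<or> b = d"
  unfolding noP4_def by blast

lemma noP4_subset: "noP4 X \<Longrightarrow> Y \<subseteq> X \<Longrightarrow> noP4 Y"
  unfolding noP4_def by blast

lemma noP4_Un:
  assumes "noP4 X" "noP4 Y" "\<And>x y. x \<in> X \<Longrightarrow> y \<in> Y \<Longrightarrow> \<not> adj x y"
  shows "noP4 (X \<union> Y)"
  unfolding noP4_def
proof (intro ballI impI)
  fix a b c d assume *: "a \<in> X \<union> Y" "b \<in> X \<union> Y" "c \<in> X \<union> Y" "d \<in> X \<union> Y"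
    and e: "adj a b" "adj b c" "adj c d"
  have step: "(x \<in> X \<longrightarrow> y \<in> X) \<and> (x \<in> Y \<longrightarrow> y \<in> Y)" if "adj x y" "x \<in> X \<union> Y" "y \<in> X \<union> Y" for x y
    using assms(3) that sym by blast
  show "a = c \<or> a = d \<or> b = d"
  proof (cases "a \<in> X")
    case True
    then have "b \<in> X" "c \<in> X" "d \<in> X" using * e step by blast+
    then show ?thesis using noP4D[OF assms(1)] True e by blast
  next
    case False
    then have "a \<in> Y" "b \<in> Y" "c \<in> Y" "d \<in> Y" using * e step by blast+
    then show ?thesis using noP4D[OF assms(2)] e by blast
  qed
qed

lemma noP4_card_le_3:
  assumes "finite X" "card X \<le> 3"
  shows "noP4 X"
  unfolding noP4_def
proof (intro ballI impI, rule ccontr)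
  fix a b c d assume *: "a \<in> X" "b \<in> X" "c \<in> X" "d \<in> X"
    and e: "adj a b" "adj b c" "adj c d" and n: "\<not> (a = c \<or> a = d \<or> b = d)"
  have "card {a, b, c, d} = 4" using n adj_neq[OF e(1)] adj_neq[OF e(2)] adj_neq[OF e(3)] by simp
  moreover have "card {a, b, c, d} \<le> card X" using * assms by (intro card_mono) auto
  ultimately show False using assms by simp
qed

definition triangle_free :: "'a set \<Rightarrow> bool" where
  "triangle_free X \<longleftrightarrow> (\<forall>a\<in>X. \<forall>b\<in>X. \<forall>c\<in>X. adj a b \<longrightarrow> adj b c \<longrightarrow> \<not> adj a c)"

lemma triangle_freeD:
  "triangle_free X \<Longrightarrow> a \<in> X \<Longrightarrow> b \<in> X \<Longrightarrow> c \<in> X \<Longrightarrow> adj a b \<Longrightarrow> adj b c \<Longrightarrow> adj a c \<Longrightarrow> False"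
  unfolding triangle_free_def by blast

lemma triangle_free_subset: "triangle_free X \<Longrightarrow> Y \<subseteq> X \<Longrightarrow> triangle_free Y"
  unfolding triangle_free_def by blast

text \<open>A component with neither a triangle nor such a path is a star, so the number of edges is
  the number of vertices minus the number of stars. A vertex \<open>c\<close> of maximum degree and
  its neighbours are split off as one component.\<close>

lemma triangle_free_noP4_star:
  assumes "finite X" "noP4 X" "X \<noteq> {}" "triangle_free X"
  shows "ne X + 1 \<le> card X \<and>
    (ne X + 1 = card X \<longrightarrow> (\<exists>c\<in>X. \<forall>x\<in>X. \<forall>y\<in>X. adj x y \<longleftrightarrow> x \<noteq> y \<and> (x = c \<or> y = c)))"
  using assms
proof (induction "card X" arbitrary: X rule: less_induct)
  case less
  note fin = less.prems(1) and P4 = less.prems(2) and tri = triangle_freeD[OF less.prems(4)]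
  obtain c where c: "c \<in> X" and cmax: "\<And>x. x \<in> X \<Longrightarrow> dg x X \<le> dg c X"
    using max_dg[OF fin less.prems(3)] by blast
  define S where "S = {y \<in> X. adj c y}"
  define W where "W = X - insert c S"
  have finS: "finite S" and finW: "finite W" using fin S_def W_def by auto
  have cS: "c \<notin> S" using irr S_def by auto
  \<comment> \<open>If \<open>c\<close> has a second neighbour \<open>y\<close>, the path
    \<open>z x c y\<close> forces \<open>z = y\<close> and a triangle arises; otherwise
    \<open>x\<close> has larger degree than \<open>c\<close>.\<close>
  have S_only: False if x: "x \<in> S" and z: "z \<in> X" "z \<noteq> c" "adj x z" for x z
  proof (cases "\<exists>y\<in>S. y \<noteq> x")
    case True
    then obtain y where y: "y \<in> S" "y \<noteq> x" by blast
    then have "z = c \<or> z = y \<or> x = y"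
      using noP4D[OF P4, of z x c y] x z c sym S_def by blast
    then have "z = y" using z y by blast
    then have "adj x y" using z(3) by simp
    moreover have "adj c x" "adj c y" "x \<in> X" "y \<in> X" using x y(1) by (simp_all add: S_def)
    ultimately show False by (intro tri[of c x y] c)
  next
    case False
    then have "S = {x}" using x by blast
    then have "dg c X = 1" unfolding dg_def S_def by simp
    moreover have "{c, z} \<subseteq> {y \<in> X. adj x y}" using x z c sym unfolding S_def by blast
    then have "card {c, z} \<le> dg x X" unfolding dg_def using fin by (intro card_mono) auto
    moreover have "dg x X \<le> dg c X" using cmax x S_def by simp
    ultimately show False using z(2) by simp
  qed
  have "indep S" using S_only cS S_def by (auto simp: indep_def)
  moreover have "{y \<in> S. adj c y} = S" using S_def by auto
  ultimately have neT: "ne (insert c S) = card S"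
    using ne_insert[OF finS cS] ne_indep by (simp add: dg_def)
  have "dg t (insert c S) = 0" if "t \<in> W" for t
  proof (rule dg_eq_0I)
    fix x assume "x \<in> insert c S"
    then show "\<not> adj t x" using that S_only sym unfolding W_def S_def by blast
  qed
  then have neX: "ne X = card S + ne W"
    using ne_split[OF fin, of "insert c S"] c neT S_def W_def by auto
  have cX: "card X = card S + 1 + card W"
  proof -
    have "X = insert c S \<union> W" using c S_def W_def by auto
    moreover have "insert c S \<inter> W = {}" using W_def by auto
    ultimately show ?thesis using card_Un_disjoint[of "insert c S" W] finS finW cS by simp
  qed
  show ?case
  proof (cases "W = {}")
    case True
    then have X: "X = insert c S" using W_def c S_def by auto
    have "adj x y \<longleftrightarrow> x \<noteq> y \<and> (x = c \<or> y = c)" if "x \<in> X" "y \<in> X" for x y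
      using that S_only[of x y] S_def sym irr unfolding X by blast
    then show ?thesis using neX cX True c by auto
  next
    case False
    have WX: "W \<subseteq> X" using W_def by auto
    have "card W < card X" using cX by simp
    then have "ne W + 1 \<le> card W"
      using less.hyps[OF _ finW noP4_subset[OF P4 WX] False triangle_free_subset[OF less.prems(4) WX]] by blast
    then show ?thesis using neX cX by simp
  qed
qed

end

section \<open>Prisms forced by small cliques\<close>

text \<open>Nine of the fifteen pairs of prism vertices are adjacent and hence distinct; the six
  inequalities cover the other pairs.\<close>

locale prism_free = sgraph +
  assumes free: "\<lbrakk>adj u1 u2; adj u1 u3; adj u2 u3; adj w1 w2; adj w1 w3; adj w2 w3;
    adj u1 w1; adj u2 w2; adj u3 w3; u1 \<noteq> w2; u1 \<noteq> w3; u2 \<noteq> w1; u2 \<noteq> w3; u3 \<noteq> w1; u3 \<noteq> w2\<rbrakk> \<Longrightarrow> False"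
begin

text \<open>The prism has the triangles \<open>y p q\<close> and \<open>z r s\<close>; the clique
  edges \<open>p r\<close> and \<open>q s\<close> complete the matching. In the next two lemmas the
  triangles are \<open>y z p\<close> and \<open>q r s\<close>, respectively \<open>y p r\<close> and
  \<open>q z s\<close>.\<close>

lemma K4_disjoint_pairs:
  assumes "clique K" "p \<in> K" "q \<in> K" "r \<in> K" "s \<in> K" "p \<noteq> q" "p \<noteq> r" "p \<noteq> s" "q \<noteq> r" "q \<noteq> s" "r \<noteq> s"
    and "y \<notin> K" "z \<notin> K" "adj y z" "adj y p" "adj y q" "adj z r" "adj z s"
  shows False
  by (rule free[of y p q z r s]) (use assms in \<open>auto simp: cliqueD[OF assms(1)] adj_commute\<close>)

lemma K4_meeting_pairs:
  assumes "clique K" "p \<in> K" "q \<in> K" "r \<in> K" "s \<in> K" "p \<noteq> q" "p \<noteq> r" "p \<noteq> s" "q \<noteq> r" "q \<noteq> s" "r \<noteq> s"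
    and "y \<notin> K" "z \<notin> K" "adj y z" "adj y p" "adj z p" "adj y q" "adj z r"
  shows False
  by (rule free[of y z p q r s]) (use assms in \<open>auto simp: cliqueD[OF assms(1)] adj_commute\<close>)

lemma K4_two_triples:
  assumes "clique K" "p \<in> K" "q \<in> K" "r \<in> K" "s \<in> K" "p \<noteq> q" "p \<noteq> r" "p \<noteq> s" "q \<noteq> r" "q \<noteq> s" "r \<noteq> s"
    and "y \<notin> K" "z \<notin> K" "y \<noteq> z" "adj y p" "adj y q" "adj y r" "adj z p" "adj z q" "adj z s"
  shows False
  by (rule free[of y p r q z s]) (use assms in \<open>auto simp: cliqueD[OF assms(1)] adj_commute\<close>)

text \<open>Different pairs are disjoint or share one vertex, and either pattern gives a prism. In
  the second pattern the fourth vertex comes from \<open>card K \<ge> 4\<close>.\<close>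

lemma K4_adjacent_pairs_eq:
  assumes K: "clique K" "card K \<ge> 4" and yz: "y \<notin> K" "z \<notin> K" "adj y z"
    and "adj y a" "adj y b" "adj z c" "adj z d" "a \<in> K" "b \<in> K" "c \<in> K" "d \<in> K" "a \<noteq> b" "c \<noteq> d"
  shows "{a, b} = {c, d}"
proof (rule ccontr)
  assume neq: "{a, b} \<noteq> {c, d}"
  have fin: "finite K" using K(2) by (metis card.infinite not_numeral_le_zero)
  have meet: False if "adj y p" "adj z p" "adj y q" "adj z r" "p \<in> K" "q \<in> K" "r \<in> K"
    "p \<noteq> q" "p \<noteq> r" "q \<noteq> r" for p q r
  proof -
    have "card {p, q, r} \<le> 3" by (simp add: card_insert_if)
    then have "\<not> K \<subseteq> {p, q, r}" using K(2) card_mono[of "{p, q, r}" K] by auto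
    then obtain s where "s \<in> K" "s \<notin> {p, q, r}" by auto
    then show False using K4_meeting_pairs[of K p q r s y z] that K yz by auto
  qed
  show False
  proof (cases "{a, b} \<inter> {c, d} = {}")
    case True
    then show False using K4_disjoint_pairs[of K a b c d y z] assms by auto
  next
    case False
    then show False using meet[of a b c] meet[of a b d] meet[of b a c] meet[of b a d] neq assms by auto
  qed
qed

text \<open>Two different pairs among three neighbours of \<open>y\<close> would have to equal the
  same pair of neighbours of \<open>z\<close>.\<close>

lemma K4_triple_pair_nonadjacent:
  assumes K: "clique K" "card K \<ge> 4" and yz: "y \<notin> K" "z \<notin> K"
    and y: "dg y K \<ge> 3" and z: "dg z K \<ge> 2"
  shows "\<not> adj y z"
proof
  assume adj: "adj y z"
  obtain a b c where abc: "a \<in> K" "b \<in> K" "c \<in> K" "a \<noteq> b" "a \<noteq> c" "b \<noteq> c"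
    "adj y a" "adj y b" "adj y c" using dg_ge_3[OF y] by blast
  obtain d e where de: "d \<in> K" "e \<in> K" "d \<noteq> e" "adj z d" "adj z e" using dg_ge_2[OF z] by blast
  have "{a, b} = {d, e}" "{a, c} = {d, e}"
    using K4_adjacent_pairs_eq[OF K yz adj] abc de by auto
  then show False using abc by (auto simp: doubleton_eq_iff)
qed

text \<open>The fifth vertex \<open>e\<close> of the clique serves as a second outside vertex:
  \<open>e\<close> and \<open>z\<close> attach to \<open>{a, b, c, d}\<close> by the different
  triples \<open>a b d\<close> and \<open>a b c\<close>.\<close>

lemma K5_dg_le_2:
  assumes Q: "clique Q" "card Q = 5" "z \<notin> Q"
  shows "dg z Q \<le> 2"
proof (rule ccontr)
  assume "\<not> dg z Q \<le> 2"
  then have "dg z Q \<ge> 3" by simp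
  then obtain a b c where abc: "a \<in> Q" "b \<in> Q" "c \<in> Q" "a \<noteq> b" "a \<noteq> c" "b \<noteq> c"
    "adj z a" "adj z b" "adj z c" by (rule dg_ge_3)
  have fin: "finite Q" using Q by (metis card.infinite zero_neq_numeral)
  have "card (Q - {a, b, c}) = 2" using abc Q fin by (simp add: card_Diff_subset)
  then obtain d e where de: "Q - {a, b, c} = {d, e}" "d \<noteq> e" by (meson card_2_iff)
  have de': "d \<in> Q" "e \<in> Q" "d \<notin> {a,b,c}" "e \<notin> {a,b,c}" using de by auto
  show False
    by (rule K4_two_triples[of "{a, b, c, d}" a b d c e z])
      (use abc de' de(2) Q in \<open>auto simp: clique_subset[OF Q(1)] cliqueD[OF Q(1)] adj_commute\<close>)
qed

lemma K5_adjacent_pairs_eq: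
  assumes "clique Q" "card Q = 5" "y \<notin> Q" "z \<notin> Q" "adj y z" "dg y Q = 2" "dg z Q = 2"
  shows "{x \<in> Q. adj y x} = {x \<in> Q. adj z x}"
proof -
  obtain a b where ab: "{x \<in> Q. adj y x} = {a, b}" "a \<noteq> b"
    using assms(6) by (auto simp: dg_def card_2_iff)
  obtain c d where cd: "{x \<in> Q. adj z x} = {c, d}" "c \<noteq> d"
    using assms(7) by (auto simp: dg_def card_2_iff)
  have "a \<in> {x \<in> Q. adj y x}" "b \<in> {x \<in> Q. adj y x}" "c \<in> {x \<in> Q. adj z x}" "d \<in> {x \<in> Q. adj z x}"
    using ab cd by auto
  then have "{a, b} = {c, d}"
    by (intro K4_adjacent_pairs_eq[of Q y z a b c d]) (use assms ab(2) cd(2) in simp_all)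
  then show ?thesis by (simp only: ab(1) cd(1))
qed

lemma no_K6:
  assumes "clique K" "card K \<ge> 6"
  shows False
proof -
  have "5 \<le> card K" using assms by simp
  then obtain Q where Q: "Q \<subseteq> K" "card Q = 5" "finite Q" by (rule obtain_subset_with_card_n)
  have "\<not> K \<subseteq> Q" using Q assms card_mono[of Q K] by auto
  then obtain z where z: "z \<in> K" "z \<notin> Q" by auto
  have "adj z y" if "y \<in> Q" for y using cliqueD[OF assms(1), of z y] that z Q by blast
  then have "{y \<in> Q. adj z y} = Q" by blast
  then have "dg z Q = 5" using Q by (simp add: dg_def)
  then show False using K5_dg_le_2[of Q z] z Q assms clique_subset by auto
qed

text \<open>Deleting the non-adjacent vertices \<open>u3\<close> and \<open>w1\<close> from the prism leaves the path
  \<open>u1 u2 w2 w3\<close>.\<close>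

lemma noP4_common_neighbours:
  assumes "p \<noteq> q" "\<And>x. x \<in> X \<Longrightarrow> adj p x \<and> adj q x"
  shows "noP4 X"
  unfolding noP4_def
proof (intro ballI impI, rule ccontr)
  fix a b c d assume X: "a \<in> X" "b \<in> X" "c \<in> X" "d \<in> X" and e: "adj a b" "adj b c" "adj c d"
    and n: "\<not> (a = c \<or> a = d \<or> b = d)"
  note A = assms(2)[OF X(1)] assms(2)[OF X(2)] assms(2)[OF X(3)] assms(2)[OF X(4)] e
  have "p \<notin> X" "q \<notin> X" using assms(2) irr by blast+
  then have N: "p \<noteq> a" "p \<noteq> b" "p \<noteq> c" "p \<noteq> d" "q \<noteq> a" "q \<noteq> b" "q \<noteq> c" "q \<noteq> d" using X by auto
  show False
    by (rule free[of a b p q c d]) (use A N n assms(1) in \<open>auto simp: adj_commute\<close>)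
qed

end

section \<open>The extremal number and five-cliques\<close>

lemma sum_eq_upper_bound:
  fixes f :: "'b \<Rightarrow> nat"
  assumes "finite T" "\<And>t. t \<in> T \<Longrightarrow> f t \<le> c" "(\<Sum>t\<in>T. f t) \<ge> c * card T" "t \<in> T"
  shows "f t = c"
proof (rule ccontr)
  assume "f t \<noteq> c"
  then have "(\<Sum>t\<in>T. f t) < (\<Sum>t\<in>T. c)"
    by (intro sum_strict_mono_ex1) (use assms \<open>f t \<noteq> c\<close> in \<open>auto simp: le_neq_implies_less intro!: bexI[of _ t]\<close>)
  then show False using assms(3) by (simp add: mult.commute)
qed

text \<open>
  The maximum of \<open>i (n - i) + i\<close> over all \<open>i\<close>, reduced by one if no maximiser is divisible by three.
\<close>

definition exn :: "nat \<Rightarrow> nat" where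
  "exn n = (n + 1)\<^sup>2 div 4 - (if n mod 6 \<in> {1, 2, 3} then 1 else 0)"

lemma exn_add_6: "exn (m + 6) = exn m + 3 * m + 12"
proof -
  have "(m + 7)\<^sup>2 = (m + 1)\<^sup>2 + 4 * (3 * m + 12)" by (simp add: power2_eq_square algebra_simps)
  then have 1: "(m + 7)\<^sup>2 div 4 = (m + 1)\<^sup>2 div 4 + (3 * m + 12)" by simp
  \<comment> \<open>The correction in \<open>exn\<close> is a subtraction of natural numbers; this
    shows that nothing is cut off.\<close>
  have "(m + 1)\<^sup>2 div 4 \<ge> 1" if "m mod 6 \<in> {1, 2, 3}"
  proof -
    have "m \<ge> 1" using that by (cases m) auto
    then have "(m + 1)\<^sup>2 \<ge> 2\<^sup>2" by (intro power_mono) auto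
    then show ?thesis by simp
  qed
  moreover define c :: nat where "c = (if m mod 6 \<in> {1, 2, 3} then 1 else 0)"
  ultimately have "c \<le> (m + 1)\<^sup>2 div 4" by simp
  moreover have "(m + 6) mod 6 = m mod 6" "m + 6 + 1 = m + 7" by simp_all
  then have "exn (m + 6) = (m + 7)\<^sup>2 div 4 - c" "exn m = (m + 1)\<^sup>2 div 4 - c"
    unfolding exn_def c_def by presburger+
  ultimately show ?thesis using 1 by linarith
qed

lemma exn_values:
  "exn 0 = 0" "exn (Suc 0) = 0" "exn 2 = 1" "exn 3 = 3" "exn 4 = 6" "exn 5 = 9"
  "exn 6 = 12" "exn 7 = 15" "exn 8 = 19" "exn 9 = 24" "exn 10 = 30" "exn 11 = 36"
  by (simp_all add: exn_def power2_eq_square)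

text \<open>\<open>exn\<close> is quadratic up to a correction of period 6, so inequalities about it
  are computed for six starting values and carried on by \<open>exn_add_6\<close>.\<close>

lemma nat_6_induct:
  assumes "P 0" "P 1" "P 2" "P 3" "P 4" "P 5" "\<And>m. P m \<Longrightarrow> P (m + 6)"
  shows "P (m :: nat)"
proof (induction m rule: less_induct)
  case (less m)
  have "m = 0 \<or> m = 1 \<or> m = 2 \<or> m = 3 \<or> m = 4 \<or> m = 5 \<or> m \<ge> 6" by linarith
  moreover have "P m" if "m \<ge> 6" using assms(7)[of "m - 6"] less[of "m - 6"] that by simp
  ultimately show ?case using assms by blast
qed

text \<open>At \<open>m = 3\<close> and \<open>m = 4\<close> the two sides agree; the range up to 5
  is treated exactly in \<open>K5_case\<close>.\<close>

lemma exn_add_5: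
  assumes "m \<ge> 6"
  shows "exn m + 2 * m + 10 < exn (m + 5)"
proof -
  have "exn (m + 6) + 2 * (m + 6) + 10 < exn (m + 6 + 5)" for m
  proof (induction m rule: nat_6_induct)
    case (7 m)
    then show ?case using exn_add_6[of "m + 6"] exn_add_6[of "m + 6 + 5"]
      by (simp add: algebra_simps)
  qed (simp_all add: exn_def power2_eq_square)
  from this[of "m - 6"] show ?thesis using assms by simp
qed

text \<open>Fitted to the deletion of a K4: its six edges and at most \<open>2 * m - 2\<close> edges
  leaving it stay one below this bound.\<close>

lemma exn_add_4: "exn m + 2 * m + 5 \<le> exn (m + 4)"
proof (induction m rule: nat_6_induct)
  case (7 m)
  then show ?case using exn_add_6[of "m"] exn_add_6[of "m + 4"]
    by (simp add: algebra_simps)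
qed (simp_all add: exn_values)

context prism_free
begin

text \<open>With one to five vertices outside \<open>Q\<close>, \<open>exn n\<close> is exactly the
  count for a complete remainder \<open>R\<close> whose vertices send two edges each to
  \<open>Q\<close>. Equality thus makes \<open>R\<close> complete; adjacent vertices of
  \<open>R\<close> share their two neighbours \<open>N\<close>, and the clique
  \<open>R \<union> N\<close> on \<open>m + 2\<close> vertices bounds \<open>m\<close> by 3.\<close>

lemma K5_case:
  assumes fin: "finite V" and n: "card V = n" "n \<ge> 6"
    and Q: "Q \<subseteq> V" "clique Q" "card Q = 5"
    and IH: "\<And>W. W \<subseteq> V \<Longrightarrow> card W < n \<Longrightarrow> card W \<ge> 6 \<Longrightarrow> ne W \<le> exn (card W)"
  shows "ne V \<le> exn n"
    and "ne V = exn n \<Longrightarrow> n \<le> 8 \<and> (\<exists>S T. V = S \<union> T \<and> card S = 5 \<and> card (S \<inter> T) = 2 \<and>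
      (\<forall>x\<in>V. \<forall>y\<in>V. adj x y \<longleftrightarrow> x \<noteq> y \<and> (x \<in> S \<and> y \<in> S \<or> x \<in> T \<and> y \<in> T)))"
proof -
  define R where "R = V - Q"
  define m where "m = card R"
  have finQ: "finite Q" and finR: "finite R" using fin Q finite_subset R_def by auto
  have m: "n = m + 5" "m \<ge> 1"
    using n Q fin finQ card_Diff_subset[of Q V] card_mono[of V Q] by (auto simp: R_def m_def)
  have eV: "ne V = 10 + ne R + (\<Sum>t\<in>R. dg t Q)"
    using ne_split[OF fin Q(1)] ne_clique[OF finQ Q(2)] Q(3) by (simp add: R_def)
  have dg: "dg t Q \<le> 2" if "t \<in> R" for t using K5_dg_le_2 Q that R_def by auto
  have cross: "(\<Sum>t\<in>R. dg t Q) \<le> 2 * m"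
    using sum_bounded_above[of R "\<lambda>t. dg t Q" 2] dg by (simp add: m_def)
  have R2: "2 * ne R \<le> m * (m - 1)" using ne_le[OF finR] m_def by simp
  \<comment> \<open>The second conjunct records that halving is exact, so that the bound on
    \<open>2 * ne R\<close> can be compared by linear arithmetic.\<close>
  have small: "exn n = 10 + 2 * m + m * (m - 1) div 2 \<and> m * (m - 1) = 2 * (m * (m - 1) div 2)" if "m \<le> 5"
  proof -
    from that m have "m = 1 \<or> m = 2 \<or> m = 3 \<or> m = 4 \<or> m = 5" by linarith
    then show ?thesis unfolding m(1) by (elim disjE) (simp_all add: exn_def)
  qed
  have large: "ne V < exn n" if "m \<ge> 6"
  proof -
    have "ne R \<le> exn m" using IH[of R] that m by (auto simp: R_def m_def)
    then show ?thesis using exn_add_5[OF that] eV cross m by simp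
  qed
  show "ne V \<le> exn n"
    using large small eV cross R2 by (cases "m \<le> 5") auto
  assume eq: "ne V = exn n"
  then have m5: "m \<le> 5" using large by force
  have "2 * ne R \<ge> m * (m - 1)" "(\<Sum>t\<in>R. dg t Q) \<ge> 2 * m"
    using small[OF m5] eV cross R2 eq by linarith+
  then have dg2: "dg t Q = 2" if "t \<in> R" for t
    using sum_eq_upper_bound[OF finR dg] that by (auto simp: m_def)
  have clR: "clique R" using \<open>2 * ne R \<ge> m * (m - 1)\<close> ne_full[OF finR] by (simp add: m_def)
  obtain t0 where t0: "t0 \<in> R" using m(2) m_def by fastforce
  define N where "N = {x \<in> Q. adj t0 x}"
  have N: "{x \<in> Q. adj t x} = N" if "t \<in> R" for t
  proof (cases "t = t0")
    case True
    then show ?thesis by (simp add: N_def)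
  next
    case False
    then have "adj t t0" using clR t0 that by (auto simp: clique_def)
    then show ?thesis
      unfolding N_def using K5_adjacent_pairs_eq[OF Q(2,3)] that t0 dg2 R_def by auto
  qed
  have NQ: "N \<subseteq> Q" "card N = 2" using dg2[OF t0] by (auto simp: N_def dg_def)
  have RN: "R \<inter> N = {}" using NQ R_def by auto
  have clRN: "clique (R \<union> N)"
    unfolding clique_def
  proof (intro ballI impI)
    fix x y assume xy: "x \<in> R \<union> N" "y \<in> R \<union> N" "x \<noteq> y"
    have 1: "adj u v" if "u \<in> R" "v \<in> N" for u v using N[OF that(1)] that(2) by auto
    show "adj x y"
      using xy 1 sym cliqueD[OF clR] cliqueD[OF Q(2)] NQ by (metis UnE subsetD)
  qed
  have "card (R \<union> N) = m + 2"
    using RN NQ finR finite_subset[OF NQ(1) finQ] by (simp add: card_Un_disjoint m_def)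
  then have "m \<le> 3" using no_K6[OF clRN] by fastforce
  then have n8: "n \<le> 8" using m by simp
  have "V = Q \<union> (R \<union> N)" "card (Q \<inter> (R \<union> N)) = 2"
  proof -
    show "V = Q \<union> (R \<union> N)" using Q NQ R_def by auto
    have "Q \<inter> (R \<union> N) = N" using NQ R_def by auto
    then show "card (Q \<inter> (R \<union> N)) = 2" using NQ by simp
  qed
  moreover have "adj x y \<longleftrightarrow> x \<noteq> y \<and> (x \<in> Q \<and> y \<in> Q \<or> x \<in> R \<union> N \<and> y \<in> R \<union> N)"
    if xy: "x \<in> V" "y \<in> V" for x y
  proof
    assume a: "adj x y"
    have "u \<in> N" if "v \<in> R" "u \<in> Q" "adj v u" for u v using N[OF that(1)] that by auto
    then have "y \<in> N" if "x \<in> R" "y \<in> Q" using that a by blast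
    moreover have "x \<in> N" if "y \<in> R" "x \<in> Q" 
      using \<open>\<And>v u. v \<in> R \<Longrightarrow> u \<in> Q \<Longrightarrow> adj v u \<Longrightarrow> u \<in> N\<close> that sym[OF a] by blast
    moreover have "x \<in> Q \<or> x \<in> R" "y \<in> Q \<or> y \<in> R" using xy R_def by auto
    ultimately show "x \<noteq> y \<and> (x \<in> Q \<and> y \<in> Q \<or> x \<in> R \<union> N \<and> y \<in> R \<union> N)"
      using adj_neq[OF a] by blast
  next
    assume "x \<noteq> y \<and> (x \<in> Q \<and> y \<in> Q \<or> x \<in> R \<union> N \<and> y \<in> R \<union> N)"
    then show "adj x y" using cliqueD[OF clRN] cliqueD[OF Q(2)] by blast
  qed
  ultimately show "n \<le> 8 \<and> (\<exists>S T. V = S \<union> T \<and> card S = 5 \<and> card (S \<inter> T) = 2 \<and>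
      (\<forall>x\<in>V. \<forall>y\<in>V. adj x y \<longleftrightarrow> x \<noteq> y \<and> (x \<in> S \<and> y \<in> S \<or> x \<in> T \<and> y \<in> T)))"
    using n8 Q(3) by blast
qed

end

section \<open>Triangles with three common neighbours\<close>

context prism_free
begin

text \<open>The induction hypothesis starts at six vertices. Below that, \<open>exn\<close> is the
  size of a complete graph, except at five vertices, where it is 9 and the K5 with its 10 edges has
  to be excluded.\<close>

lemma ne_le_exn:
  assumes fin: "finite R" and K5: "\<And>Q. Q \<subseteq> R \<Longrightarrow> clique Q \<Longrightarrow> card Q \<noteq> 5"
    and IH: "card R \<ge> 6 \<Longrightarrow> ne R \<le> exn (card R)"
  shows "ne R \<le> exn (card R)"
proof (cases "card R \<ge> 6")
  case False
  have le: "2 * ne R \<le> card R * (card R - 1)" by (rule ne_le[OF fin])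
  from False have "card R = 0 \<or> card R = 1 \<or> card R = 2 \<or> card R = 3 \<or> card R = 4 \<or> card R = 5"
    by linarith
  moreover have "ne R \<le> 9" if "card R = 5"
    using ne_full[OF fin] K5[of R] that by force
  ultimately show ?thesis using le by (auto simp: exn_values)
qed (use IH in simp)

lemma K3_join_dg:
  assumes A: "clique A" "card A = 3" and B: "card B = 3"
    and AB: "\<And>a b. a \<in> A \<Longrightarrow> b \<in> B \<Longrightarrow> adj a b" and z: "z \<notin> A" "z \<notin> B"
  shows "dg z A \<ge> 2 \<Longrightarrow> dg z B = 0" and "dg z B \<ge> 2 \<Longrightarrow> dg z A = 0"
proof -
  have D: "a \<noteq> b" if "a \<in> A" "b \<in> B" for a b using AB[OF that] adj_neq by blast
  show "dg z B = 0" if 2: "dg z A \<ge> 2"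
  proof (rule ccontr)
    assume "dg z B \<noteq> 0"
    then obtain b1 where b1: "b1 \<in> B" "adj z b1" using dg_ge_1[of z B] by (metis One_nat_def Suc_leI gr0I)
    obtain a1 a2 where a: "a1 \<in> A" "a2 \<in> A" "a1 \<noteq> a2" "adj z a1" "adj z a2" using dg_ge_2[OF 2] by blast
    obtain a3 where a3: "a3 \<in> A" "a3 \<noteq> a1" "a3 \<noteq> a2" using third_element[of A a1 a2] A(2) by auto
    obtain b2 where b2: "b2 \<in> B" "b2 \<noteq> b1" using third_element[of B b1 b1] B by auto
    show False
      by (rule free[of z a1 b1 a2 b2 a3])
        (use a a3 b1 b2 z D in \<open>auto simp: AB cliqueD[OF A(1)] adj_commute\<close>)
  qed
  show "dg z A = 0" if 2: "dg z B \<ge> 2"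
  proof (rule ccontr)
    assume "dg z A \<noteq> 0"
    then obtain a1 where a1: "a1 \<in> A" "adj z a1" using dg_ge_1[of z A] by (metis One_nat_def Suc_leI gr0I)
    obtain b1 b2 where b: "b1 \<in> B" "b2 \<in> B" "b1 \<noteq> b2" "adj z b1" "adj z b2" using dg_ge_2[OF 2] by blast
    obtain a2 where a2: "a2 \<in> A" "a2 \<noteq> a1" using third_element[of A a1 a1] A(2) by auto
    obtain a3 where a3: "a3 \<in> A" "a3 \<noteq> a1" "a3 \<noteq> a2" using third_element[of A a1 a2] A(2) by auto
    show False
      by (rule free[of z a1 b1 b2 a2 a3])
        (use a1 a2 a3 b z D in \<open>auto simp: AB cliqueD[OF A(1)] adj_commute\<close>)
  qed
qed

text \<open>Twelve inner edges and three edges per remaining vertex match the increment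
  \<open>3 * m + 12\<close> of \<open>exn\<close>, so equality leaves no slack. Vertices attached to
  \<open>B\<close> then go to the side of \<open>A\<close>, and those attached to \<open>A\<close>
  to the side of \<open>B\<close>.\<close>

lemma K3_join_case:
  assumes fin: "finite V"
    and A: "A \<subseteq> V" "clique A" "card A = 3" and B: "B \<subseteq> V" "card B = 3"
    and AB: "\<And>a b. a \<in> A \<Longrightarrow> b \<in> B \<Longrightarrow> adj a b"
    and K5: "\<And>Q. Q \<subseteq> V \<Longrightarrow> clique Q \<Longrightarrow> card Q \<noteq> 5"
    and IH: "\<And>W. W \<subseteq> V \<Longrightarrow> card W < card V \<Longrightarrow> card W \<ge> 6 \<Longrightarrow> ne W \<le> exn (card W)"
  shows "ne V \<le> exn (card V)"
    and "ne V = exn (card V) \<Longrightarrow> \<exists>X \<subseteq> V. noP4 X \<and> indep (V - X)"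
proof -
  define R where "R = V - (A \<union> B)"
  define m where "m = card R"
  have finA: "finite A" and finB: "finite B" and finR: "finite R"
    using fin A B finite_subset R_def by auto
  have D: "A \<inter> B = {}" using AB adj_neq by blast
  have cH: "card (A \<union> B) = 6" using A B D finA finB by (simp add: card_Un_disjoint)
  have Vm: "card V = m + 6"
    using A B fin finA finB cH card_Diff_subset[of "A \<union> B" V] card_mono[of V "A \<union> B"]
    by (auto simp: R_def m_def)
  \<comment> \<open>Two adjacent vertices of \<open>B\<close> and the triangle \<open>A\<close>
    would form a K5.\<close>
  have indB: "indep B"
    unfolding indep_def
  proof (intro ballI notI)
    fix b b' assume b: "b \<in> B" "b' \<in> B" "adj b b'"
    have "clique (A \<union> {b, b'})"
      using cliqueD[OF A(2)] AB b by (auto simp: clique_def adj_commute)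
    moreover have "card (A \<union> {b, b'}) = 5"
      using A(3) b D finA adj_neq[OF b(3)] by (subst card_Un_disjoint) auto
    ultimately show False using K5[of "A \<union> {b, b'}"] A B b by auto
  qed
  have "dg b A = 3" if "b \<in> B" for b
  proof -
    have "{y \<in> A. adj b y} = A" using AB that sym by blast
    then show ?thesis using A by (simp add: dg_def)
  qed
  then have neH: "ne (A \<union> B) = 12"
    using ne_Un[OF finA finB D] ne_clique[OF finA A(2)] ne_indep[OF indB] A B by simp
  have eV: "ne V = 12 + ne R + (\<Sum>t\<in>R. dg t (A \<union> B))"
    using ne_split[OF fin, of "A \<union> B"] A B neH by (simp add: R_def)
  have dgU: "dg t (A \<union> B) = dg t A + dg t B" for t by (rule dg_Un[OF finA finB D])
  have le3: "dg t A \<le> 3" "dg t B \<le> 3" for t using dg_le[OF finA] dg_le[OF finB] A B by force+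
  have types: "dg t A \<ge> 2 \<Longrightarrow> dg t B = 0" "dg t B \<ge> 2 \<Longrightarrow> dg t A = 0" if "t \<in> R" for t
    using K3_join_dg[OF A(2,3) B(2) AB, of t] that R_def by auto
  have dg3: "dg t (A \<union> B) \<le> 3" if "t \<in> R" for t
    using types[OF that] le3[of t] dgU[of t] by linarith
  have cross: "(\<Sum>t\<in>R. dg t (A \<union> B)) \<le> 3 * m"
    using sum_bounded_above[of R "\<lambda>t. dg t (A \<union> B)" 3] dg3 by (simp add: m_def)
  have RV: "R \<subseteq> V" using R_def by auto
  have neR: "ne R \<le> exn m"
    unfolding m_def
  proof (rule ne_le_exn[OF finR])
    show "card Q \<noteq> 5" if "Q \<subseteq> R" "clique Q" for Q using K5[of Q] that RV by blast
    show "ne R \<le> exn (card R)" if "card R \<ge> 6" using IH[of R] that RV Vm m_def by simp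
  qed
  show "ne V \<le> exn (card V)" using eV cross neR exn_add_6[of m] Vm by simp
  assume "ne V = exn (card V)"
  then have "(\<Sum>t\<in>R. dg t (A \<union> B)) \<ge> 3 * card R"
    using eV neR exn_add_6[of m] Vm by (simp add: m_def)
  then have dg_eq: "dg t (A \<union> B) = 3" if "t \<in> R" for t
    using sum_eq_upper_bound[OF finR, of "\<lambda>t. dg t (A \<union> B)" 3 t] dg3 that by blast
  have types': "dg t A = 3 \<and> dg t B = 0 \<or> dg t A = 0 \<and> dg t B = 3" if "t \<in> R" for t
    using types[OF that] le3[of t] dgU[of t] dg_eq[OF that] by linarith
  have full: "adj t x" if "dg t S = 3" "card S = 3" "x \<in> S" "finite S" for t x S
    using dg_full[of S t x] that by simp
  have empty: "\<not> adj t x" if "dg t S = 0" "x \<in> S" "finite S" for t x S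
    using that by (auto simp: dg_def)
  define T where "T = {t \<in> R. dg t B = 3}"
  define X where "X = A \<union> T"
  have VX: "V - X = B \<union> (R - T)" using A B D R_def X_def T_def by auto
  have TY: "dg t A = 3" "dg t B = 0" if "t \<in> R - T" for t using types'[of t] that T_def by auto
  have TX: "dg t A = 0" "dg t B = 3" if "t \<in> T" for t using types'[of t] that T_def by auto
  have TYA: "adj t a" if "t \<in> R - T" "a \<in> A" for t a using full TY that A finA by blast
  have TYB: "\<not> adj t b" if "t \<in> R - T" "b \<in> B" for t b using empty TY that finB by blast
  have TXB: "adj t b" if "t \<in> T" "b \<in> B" for t b using full TX that B finB by blast
  have TXA: "\<not> adj t a" if "t \<in> T" "a \<in> A" for t a using empty TX that finA by blast
  obtain a1 a2 a3 where a: "A = {a1, a2, a3}" "a1 \<noteq> a2" "a1 \<noteq> a3" "a2 \<noteq> a3"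
    using A(3) by (metis card_3_iff)
  obtain b1 b2 b3 where b: "B = {b1, b2, b3}" "b1 \<noteq> b2" using B(2) by (metis card_3_iff)
  \<comment> \<open>An edge \<open>z z'\<close> yields the triangles \<open>a1 a2 b1\<close> and
    \<open>z z' a3\<close>, matched by \<open>a1 z\<close>, \<open>a2 z'\<close> and
    \<open>b1 a3\<close>.\<close>
  have "\<not> adj z z'" if z: "z \<in> R - T" "z' \<in> R - T" for z z'
  proof
    assume zz: "adj z z'"
    have nAB: "z \<notin> A" "z' \<notin> A" "z \<notin> B" "z' \<notin> B" using z R_def by auto
    have e: "adj a1 a2" "adj a1 b1" "adj a2 b1" "adj a3 b1" "adj z a1" "adj z a3" "adj z' a2" "adj z' a3"
      using AB cliqueD[OF A(2)] TYA[OF z(1)] TYA[OF z(2)] a b by auto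
    show False
      by (rule free[of a1 a2 b1 z z' a3]) (use a b nAB zz e D in \<open>auto simp: adj_commute\<close>)
  qed
  then have "indep (B \<union> (R - T))"
    using indB TYB sym unfolding indep_def by blast
  \<comment> \<open>All of \<open>T\<close> has the common neighbours \<open>b1\<close> and
    \<open>b2\<close>. The set \<open>A\<close> is too small for a path, and no edge joins it to
    \<open>T\<close>.\<close>
  moreover have "noP4 T"
    by (rule noP4_common_neighbours[of b1 b2]) (use TXB b sym in auto)
  then have "noP4 X"
    unfolding X_def using noP4_Un[OF noP4_card_le_3[OF finA]] A(3) TXA sym by (metis order_refl)
  ultimately show "\<exists>X \<subseteq> V. noP4 X \<and> indep (V - X)"
    using VX A by (intro exI[of _ X]) (auto simp: X_def T_def R_def)
qed

end

section \<open>Four-cliques\<close>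

text \<open>The left-hand sides are the edge bounds left over in \<open>K4_case\<close>;
  \<open>d\<close> is there the number of vertices sending two edges to the K4, shifted to start at
  0.\<close>

lemma exn_linear_bounds:
  "3 * d + 11 < exn (d + 6)" "4 * d + 10 < exn (d + 6)" "5 * d + 13 < exn (d + 7)"
proof -
  show "3 * d + 11 < exn (d + 6)"
  proof (induction d rule: nat_6_induct)
    case (7 d)
    then show ?case using exn_add_6[of "d + 6"] by (simp add: algebra_simps)
  qed (simp_all add: exn_def)
  show "4 * d + 10 < exn (d + 6)"
  proof (induction d rule: nat_6_induct)
    case (7 d)
    then show ?case using exn_add_6[of "d + 6"] by (simp add: algebra_simps)
  qed (simp_all add: exn_def)
  show "5 * d + 13 < exn (d + 7)"
  proof (induction d rule: nat_6_induct)
    case (7 d)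
    then show ?case using exn_add_6[of "d + 7"] by (simp add: algebra_simps)
  qed (simp_all add: exn_def)
qed

context prism_free
begin

text \<open>Compared with two edges per outside vertex, a vertex of \<open>B\<close> gains one edge
  to \<open>K\<close> and a vertex of \<open>L\<close> loses at least one. As \<open>B\<close> has
  at most one element, either the loss suffices for deleting \<open>K\<close>, or \<open>L\<close>
  has at most two elements; then nearly all vertices lie in the sparse set \<open>D\<close>, and all
  edges are counted directly.\<close>

lemma K4_case:
  assumes fin: "finite V" and n: "card V \<ge> 6"
    and K: "K \<subseteq> V" "clique K" "card K = 4"
    and K5: "\<And>Q. Q \<subseteq> V \<Longrightarrow> clique Q \<Longrightarrow> card Q \<noteq> 5"
    and K3_join: "\<And>A B. A \<subseteq> V \<Longrightarrow> B \<subseteq> V \<Longrightarrow> clique A \<Longrightarrow> card A = 3 \<Longrightarrow> card B = 3 \<Longrightarrow>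
      (\<And>a b. a \<in> A \<Longrightarrow> b \<in> B \<Longrightarrow> adj a b) \<Longrightarrow> False"
    and IH: "\<And>W. W \<subseteq> V \<Longrightarrow> card W < card V \<Longrightarrow> card W \<ge> 6 \<Longrightarrow> ne W \<le> exn (card W)"
  shows "ne V < exn (card V)"
proof -
  define R where "R = V - K"
  define m where "m = card R"
  define N where "N = (\<lambda>t. {x \<in> K. adj t x})"
  define D where "D = {t \<in> R. dg t K = 2}"
  define L where "L = {t \<in> R. dg t K \<le> 1}"
  define B where "B = {t \<in> R. dg t K \<ge> 3}"
  have finK: "finite K" and finR: "finite R" using fin K finite_subset R_def by auto
  have finD: "finite D" and finL: "finite L" and finB: "finite B" using finR D_def L_def B_def by auto
  have RV: "R \<subseteq> V" "R \<inter> K = {}" using R_def by auto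
  have Vm: "card V = m + 4"
    using K fin finK card_Diff_subset[of K V] card_mono[of V K] by (auto simp: R_def m_def)
  have NK: "N t \<subseteq> K" "dg t K = card (N t)" "finite (N t)" for t using finK by (auto simp: N_def dg_def)
  have dgB: "dg t K = 3" if "t \<in> B" for t
  proof -
    have "dg t K \<noteq> 4"
    proof
      assume "dg t K = 4"
      then have "adj t x" if "x \<in> K" for x using dg_full[OF finK, of t x] K that by simp
      then have "clique (insert t K)" using cliqueD[OF K(2)] sym by (auto simp: clique_def)
      moreover have "t \<in> V" "t \<notin> K" using that RV B_def by auto
      ultimately show False using K5[of "insert t K"] K finK by auto
    qed
    then show ?thesis using dg_le[OF finK, of t] K that B_def by auto
  qed
  \<comment> \<open>Equal triples give a triangle joined to \<open>y\<close>, \<open>z\<close> and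
    the fourth vertex \<open>s\<close> of \<open>K\<close>; different triples share two vertices and
    give a prism.\<close>
  have B1: "card B \<le> 1"
  proof (rule ccontr)
    assume "\<not> card B \<le> 1"
    then obtain y z where yz: "y \<in> B" "z \<in> B" "y \<noteq> z"
      by (metis card_le_Suc0_iff_eq finB One_nat_def)
    have yzK: "y \<notin> K" "z \<notin> K" "y \<in> V" "z \<in> V" using yz RV B_def by auto
    have c3: "card (N y) = 3" "card (N z) = 3" using dgB yz NK by simp_all
    show False
    proof (cases "N y = N z")
      case True
      have "card (K - N y) = 1" using c3 NK K finK card_Diff_subset[of "N y" K] by simp
      then obtain s where s: "K - N y = {s}" by (meson card_1_singletonE)
      then have sK: "s \<in> K" "s \<notin> N y" by auto
      have "s \<noteq> y" "s \<noteq> z" using yzK sK by auto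
      then have "card {s, y, z} = 3" using yz(3) by simp
      moreover have "adj a b" if "a \<in> N y" "b \<in> {s, y, z}" for a b
        using that cliqueD[OF K(2), of a s] sK sym NK(1)[of y] True N_def by blast
      moreover have "clique (N y)" using clique_subset[OF K(2)] NK by auto
      ultimately show False using K3_join[of "N y" "{s, y, z}"] c3 NK(1)[of y] K(1) sK yzK by blast
    next
      case False
      then have "\<not> N z \<subseteq> N y" using c3 NK card_subset_eq[of "N y" "N z"] by auto
      then obtain s where s: "s \<in> N z" "s \<notin> N y" by auto
      have "card (K - N y) = 1" using c3 NK K finK card_Diff_subset[of "N y" K] by simp
      then obtain s' where s': "K - N y = {s'}" by (meson card_1_singletonE)
      have sub: "N z - {s} \<subseteq> N y"
      proof
        fix x assume x: "x \<in> N z - {s}"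
        show "x \<in> N y"
        proof (rule ccontr)
          assume "x \<notin> N y"
          then have "x \<in> K - N y" "s \<in> K - N y" using x s NK(1)[of z] by auto
          then show False using x s' by auto
        qed
      qed
      have "card (N z - {s}) = 2" using s c3 NK by simp
      then obtain p q where pq: "N z - {s} = {p, q}" "p \<noteq> q" by (meson card_2_iff)
      obtain r where r: "r \<in> N y" "r \<noteq> p" "r \<noteq> q" using third_element[of "N y" p q] c3 by auto
      have pq': "p \<in> N y" "q \<in> N y" "p \<in> N z" "q \<in> N z" using pq sub by auto
      show False
        using K4_two_triples[of K p q r s y z] K(2) pq' pq(2) r s yz(3) yzK unfolding N_def by blast
    qed
  qed
  have Dpair: "\<exists>p q. N x = {p, q} \<and> p \<noteq> q" if "x \<in> D" for x
  proof -
    have "card (N x) = 2" using that NK(2)[of x] by (simp add: D_def)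
    then show ?thesis by (simp only: card_2_iff)
  qed
  \<comment> \<open>The pair of neighbours in \<open>K\<close> is constant along edges of
    \<open>D\<close>. A connected piece thus has two common neighbours \<open>p\<close>,
    \<open>q\<close>: it contains no path on four vertices, and a triangle in it would extend to a
    K5.\<close>
  have DN: "N x = N y" if xy: "x \<in> D" "y \<in> D" "adj x y" for x y
  proof -
    obtain a b where ab: "N x = {a, b}" "a \<noteq> b"
      using Dpair[OF xy(1)] by blast
    obtain c d where cd: "N y = {c, d}" "c \<noteq> d"
      using Dpair[OF xy(2)] by blast
    have "a \<in> N x" "b \<in> N x" "c \<in> N y" "d \<in> N y" using ab cd by auto
    then have "{a, b} = {c, d}"
      using K4_adjacent_pairs_eq[of K x y a b c d] K xy RV ab cd by (auto simp: N_def D_def)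
    then show ?thesis using ab cd by simp
  qed
  have Nadj: "adj x p \<and> adj x q" if "N x = {p, q}" for x p q
  proof -
    have "p \<in> N x" "q \<in> N x" using that by simp_all
    then show ?thesis by (simp add: N_def)
  qed
  have P4D: "noP4 D"
    unfolding noP4_def
  proof (intro ballI impI)
    fix a b c d assume D: "a \<in> D" "b \<in> D" "c \<in> D" "d \<in> D" and e: "adj a b" "adj b c" "adj c d"
    obtain p q where pq: "N a = {p, q}" "p \<noteq> q" using Dpair[OF D(1)] by blast
    have "N b = {p, q}" "N c = {p, q}" "N d = {p, q}" using pq DN D e by auto
    then have "N x = {p, q}" if "x \<in> {a, b, c, d}" for x using that pq(1) by auto
    then have "adj p x \<and> adj q x" if "x \<in> {a, b, c, d}" for x
      using Nadj[of x p q] that adj_commute[of x] by metis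
    then have "noP4 {a, b, c, d}" by (rule noP4_common_neighbours[OF pq(2)])
    then show "a = c \<or> a = d \<or> b = d" using noP4D e by blast
  qed
  have triD: False if D: "a \<in> D" "b \<in> D" "c \<in> D" and e: "adj a b" "adj b c" "adj a c" for a b c
  proof -
    obtain p q where pq: "N a = {p, q}" "p \<noteq> q" using Dpair[OF D(1)] by blast
    have N: "N b = {p, q}" "N c = {p, q}" using pq DN D e by auto
    have "adj a p" "adj a q" "adj b p" "adj b q" "adj c p" "adj c q" using Nadj N pq(1) by blast+
    moreover have pqK: "p \<in> K" "q \<in> K" using pq NK by auto
    ultimately have cl: "clique {a, b, c, p, q}"
      using e cliqueD[OF K(2)] pq(2) by (auto simp: clique_def adj_commute)
    have abc: "a \<notin> K" "b \<notin> K" "c \<notin> K" "a \<in> V" "b \<in> V" "c \<in> V" using D RV D_def by auto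
    have "a \<noteq> p" "a \<noteq> q" "b \<noteq> p" "b \<noteq> q" "c \<noteq> p" "c \<noteq> q" using abc pqK by blast+
    then have "card {a, b, c, p, q} = 5"
      using pq(2) adj_neq[OF e(1)] adj_neq[OF e(2)] adj_neq[OF e(3)] by simp
    then show False using K5[OF _ cl] abc pqK K(1) by auto
  qed
  \<comment> \<open>A nonempty union of stars has fewer edges than vertices; truncated subtraction
    covers \<open>D = {}\<close>.\<close>
  have neD: "ne D \<le> card D - 1"
  proof (cases "D = {}")
    case False
    then have "ne D + 1 \<le> card D"
      using triangle_free_noP4_star[OF finD P4D False] triD unfolding triangle_free_def by blast
    then show ?thesis by simp
  qed simp
  have BD: "dg t D = 0" if "t \<in> B" for t
  proof -
    have "\<not> adj t x" if "x \<in> D" for x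
      using K4_triple_pair_nonadjacent[of K t x] K RV \<open>t \<in> B\<close> that by (auto simp: B_def D_def)
    then show ?thesis by (rule dg_eq_0I)
  qed
  have R: "R = D \<union> (L \<union> B)" "D \<inter> (L \<union> B) = {}" "L \<inter> B = {}"
    by (auto simp: D_def L_def B_def)
  have mm: "m = card D + card L + card B"
    using R finD finL finB by (simp add: m_def card_Un_disjoint)
  have "(\<Sum>t\<in>R. dg t K) = (\<Sum>t\<in>D. dg t K) + ((\<Sum>t\<in>L. dg t K) + (\<Sum>t\<in>B. dg t K))"
    using R finD finL finB by (simp add: sum.union_disjoint)
  moreover have "(\<Sum>t\<in>D. dg t K) = 2 * card D" "(\<Sum>t\<in>B. dg t K) = 3 * card B"
    using dgB by (simp_all add: D_def)
  moreover have "(\<Sum>t\<in>L. dg t K) \<le> card L"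
    using sum_bounded_above[of L "\<lambda>t. dg t K" 1] by (simp add: L_def)
  moreover have "ne V = 6 + ne R + (\<Sum>t\<in>R. dg t K)"
    using ne_split[OF fin K(1)] ne_clique[OF finK K(2)] K(3) by (simp add: R_def)
  ultimately have eV: "ne V \<le> 6 + ne R + 2 * card D + card L + 3 * card B" by linarith
  have "ne R = ne D + (ne L + ne B + (\<Sum>t\<in>B. dg t L)) + (\<Sum>t\<in>L \<union> B. dg t D)"
    using R finD finL finB by (simp add: ne_Un)
  moreover have "(\<Sum>t\<in>L \<union> B. dg t D) = (\<Sum>t\<in>L. dg t D)"
    using R BD finL finB by (simp add: sum.union_disjoint)
  moreover have "(\<Sum>t\<in>L. dg t D) \<le> card L * card D"
    using sum_bounded_above[of L "\<lambda>t. dg t D" "card D"] dg_le[OF finD] by simp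
  moreover have "(\<Sum>t\<in>B. dg t L) \<le> card B * card L"
    using sum_bounded_above[of B "\<lambda>t. dg t L" "card L"] dg_le[OF finL] by simp
  moreover have "ne B = 0" using ne_le[OF finB] B1 by (cases "card B") auto
  ultimately have eR: "ne R \<le> card D - 1 + ne L + card B * card L + card L * card D"
    using neD by linarith
  have eL: "2 * ne L \<le> card L * (card L - 1)" by (rule ne_le[OF finL])
  have eR2: "ne R \<le> exn m"
    unfolding m_def
  proof (rule ne_le_exn[OF finR])
    show "card Q \<noteq> 5" if "Q \<subseteq> R" "clique Q" for Q using K5[of Q] that RV by blast
    show "ne R \<le> exn (card R)" if "card R \<ge> 6" using IH[of R] that RV Vm m_def by simp
  qed
  \<comment> \<open>The edges leaving \<open>K\<close> number at most
    \<open>2 * m - card L + card B\<close>. If this is at most \<open>2 * m - 2\<close>,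
    \<open>exn_add_4\<close> gives strictness; otherwise five pairs of sizes of \<open>B\<close> and
    \<open>L\<close> remain.\<close>
  show ?thesis
  proof (cases "card L \<ge> 2 + card B")
    case True
    then show ?thesis unfolding Vm using eV eR2 exn_add_4[of m] mm by linarith
  next
    case False
    then consider "card B = 0" "card L = 0" | "card B = 0" "card L = 1" | "card B = 1" "card L = 0"
      | "card B = 1" "card L = 1" | "card B = 1" "card L = 2" using B1 by linarith
    then show ?thesis
    proof cases
      case 1
      define d where "d = card D - 2"
      have d: "card D = d + 2" "card V = d + 6" using 1 mm Vm n d_def by simp_all
      show ?thesis unfolding d using exn_linear_bounds(1)[of d] eV eR eL 1 d(1) by simp
    next
      case 2
      define d where "d = card D - 1"
      have d: "card D = d + 1" "card V = d + 6" using 2 mm Vm n d_def by simp_all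
      show ?thesis unfolding d using exn_linear_bounds(2)[of d] eV eR eL 2 d(1) by simp
    next
      case 3
      define d where "d = card D - 1"
      have d: "card D = d + 1" "card V = d + 6" using 3 mm Vm n d_def by simp_all
      show ?thesis unfolding d using exn_linear_bounds(1)[of d] eV eR eL 3 d(1) by simp
    next
      case 4
      then have V: "card V = card D + 6" using mm Vm by simp
      \<comment> \<open>For empty \<open>D\<close> the truncated \<open>card D - 1\<close> makes the
        edge bound one larger, so this value is compared numerically.\<close>
      show ?thesis unfolding V using exn_linear_bounds(2)[of "card D"] eV eR eL 4
        by (cases "card D") (simp_all add: exn_values)
    next
      case 5
      then have V: "card V = card D + 7" using mm Vm by simp
      show ?thesis unfolding V using exn_linear_bounds(3)[of "card D"] eV eR eL 5
        by (cases "card D") (simp_all add: exn_values)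
    qed
  qed
qed

end

section \<open>Graphs without four-cliques\<close>

context prism_free
begin

definition K4_free :: "'a set \<Rightarrow> bool" where
  "K4_free V \<longleftrightarrow> (\<forall>a\<in>V. \<forall>b\<in>V. \<forall>c\<in>V. \<forall>d\<in>V.
    adj a b \<longrightarrow> adj a c \<longrightarrow> adj a d \<longrightarrow> adj b c \<longrightarrow> adj b d \<longrightarrow> \<not> adj c d)"

lemma K4_freeD:
  "K4_free V \<Longrightarrow> a \<in> V \<Longrightarrow> b \<in> V \<Longrightarrow> c \<in> V \<Longrightarrow> d \<in> V \<Longrightarrow>
    adj a b \<Longrightarrow> adj a c \<Longrightarrow> adj a d \<Longrightarrow> adj b c \<Longrightarrow> adj b d \<Longrightarrow> adj c d \<Longrightarrow> False"
  unfolding K4_free_def by blast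

lemma K4_free_subset: "K4_free V \<Longrightarrow> W \<subseteq> V \<Longrightarrow> K4_free W"
  unfolding K4_free_def by blast

lemma triangle_free_neighbourhood:
  assumes "K4_free V" "v \<in> V"
  shows "triangle_free {x \<in> V. adj v x}"
  unfolding triangle_free_def using K4_freeD[OF assms] by blast

lemma dg_four:
  assumes "a \<noteq> b" "a \<noteq> c" "a \<noteq> d" "b \<noteq> c" "b \<noteq> d" "c \<noteq> d"
  shows "dg x {a, b, c, d} = of_bool (adj x a) + of_bool (adj x b) + of_bool (adj x c) + of_bool (adj x d)"
  using assms by (simp add: dg_insert)

text \<open>The triangles are \<open>x b a\<close> and \<open>c v d\<close>, matched by
  \<open>x c\<close>, \<open>b v\<close> and \<open>a d\<close>.\<close>

lemma path_in_neighbourhood: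
  assumes "adj v a" "adj v b" "adj v c" "adj v d" "adj c d" "adj d a" "adj a b"
    and "x \<noteq> v" "\<not> adj v x" "adj x a" "adj x b" "adj x c" "b \<noteq> c" "b \<noteq> d" "a \<noteq> c"
  shows False
  by (rule free[of x b a c v d]) (use assms adj_neq in \<open>auto simp: adj_commute\<close>)

text \<open>If every edge had degree sum at least \<open>n + 2\<close>, two disjoint edges would
  have total degree at least \<open>2 * n + 4\<close>. The neighbourhood \<open>N\<close> of a
  vertex \<open>v\<close> of maximum degree is triangle-free with inner degrees at least two, so it
  contains a path \<open>c d a b\<close>; counting the edges at its four vertices from the other
  side gives too few.\<close>

lemma light_edge:
  assumes fin: "finite V" and K4: "K4_free V" and edge: "x0 \<in> V" "y0 \<in> V" "adj x0 y0"
  shows "\<exists>u\<in>V. \<exists>w\<in>V. adj u w \<and> dg u V + dg w V \<le> card V + 1"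
proof (rule ccontr)
  assume neg: "\<not> ?thesis"
  define n where "n = card V"
  have heavy: "dg u V + dg w V \<ge> n + 2" if "u \<in> V" "w \<in> V" "adj u w" for u w
  proof (rule ccontr)
    assume "\<not> dg u V + dg w V \<ge> n + 2"
    then have "dg u V + dg w V \<le> card V + 1" using n_def by linarith
    then show False using neg that by blast
  qed
  obtain v where v: "v \<in> V" and vmax: "\<And>x. x \<in> V \<Longrightarrow> dg x V \<le> dg v V"
    using max_dg[OF fin] edge by blast
  define N where "N = {x \<in> V. adj v x}"
  define \<Delta> where "\<Delta> = dg v V"
  have cN: "card N = \<Delta>" by (simp add: N_def \<Delta>_def dg_def)
  have finN: "finite N" and NV: "N \<subseteq> V" and vN: "v \<notin> N" using fin irr by (auto simp: N_def)
  have big: "2 * \<Delta> \<ge> n + 2" using heavy[OF edge] vmax[OF edge(1)] vmax[OF edge(2)] \<Delta>_def by simp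
  have tri: False if "a \<in> N" "b \<in> N" "c \<in> N" "adj a b" "adj b c" "adj a c" for a b c
    using triangle_freeD[OF triangle_free_neighbourhood[OF K4 v]] that N_def by blast
  have vV: "adj v x" "x \<in> V" if "x \<in> N" for x using that N_def by auto
  \<comment> \<open>The edge to \<open>v\<close> forces degree at least
    \<open>n + 2 - \<Delta>\<close>, and only \<open>n - \<Delta>\<close> vertices lie outside
    \<open>N\<close>.\<close>
  have deg2: "dg x N \<ge> 2" if "x \<in> N" for x
  proof -
    have "V = N \<union> (V - N)" using NV by auto
    then have "dg x V = dg x N + dg x (V - N)"
      using dg_Un[of N "V - N" x] fin finN by auto
    moreover have "dg x (V - N) \<le> n - \<Delta>"
      using dg_le[of "V - N" x] fin card_Diff_subset[OF finN NV] cN n_def by simp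
    moreover have "dg v V + dg x V \<ge> n + 2" using heavy[OF v] vV[OF that] by blast
    moreover have "\<Delta> \<le> n" using card_mono[OF fin NV] cN n_def by simp
    ultimately show ?thesis using \<Delta>_def by linarith
  qed
  have sum4: "(\<Sum>x\<in>V. dg x {a, b, c, d}) \<ge> 2 * n + 4"
    if "a \<in> V" "b \<in> V" "c \<in> V" "d \<in> V" "adj a b" "adj c d"
      "a \<noteq> b" "a \<noteq> c" "a \<noteq> d" "b \<noteq> c" "b \<noteq> d" "c \<noteq> d" for a b c d
  proof -
    have "(\<Sum>x\<in>V. dg x {a, b, c, d}) = (\<Sum>s\<in>{a, b, c, d}. dg s V)"
      by (rule sum_dg_swap) (use fin in auto)
    also have "\<dots> = dg a V + dg b V + (dg c V + dg d V)" using that by simp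
    finally show ?thesis using heavy[of a b] heavy[of c d] that by simp
  qed
  have Vv: "(\<Sum>x\<in>V. f x) = f v + (\<Sum>x\<in>V - {v}. f x)" "card (V - {v}) = n - 1" "n \<ge> 1" for f :: "'a \<Rightarrow> nat"
  proof -
    show "(\<Sum>x\<in>V. f x) = f v + (\<Sum>x\<in>V - {v}. f x)" using fin v by (rule sum.remove)
    show "card (V - {v}) = n - 1" using v n_def by simp
    have "card V \<noteq> 0" using fin v by auto
    then show "n \<ge> 1" using n_def by simp
  qed
  \<comment> \<open>Apart from \<open>v\<close>, every vertex sees at most two vertices of a
    four-cycle in \<open>N\<close>, since three consecutive ones would give a triangle in
    \<open>N\<close> or a prism. The total is at most \<open>4 + 2 * (n - 1)\<close>, below
    \<open>2 * n + 4\<close>.\<close>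
  have no_C4: False
    if C: "a \<in> N" "b \<in> N" "c \<in> N" "d \<in> N" "adj a b" "adj b c" "adj c d" "adj d a" "a \<noteq> c" "b \<noteq> d" for a b c d
  proof -
    have three: False
      if "p \<in> N" "q \<in> N" "r \<in> N" "s \<in> N" "adj p q" "adj q r" "adj r s" "adj s p" "p \<noteq> r" "q \<noteq> s"
        "x \<in> V" "x \<noteq> v" "adj x p" "adj x q" "adj x r" for p q r s x
    proof (cases "adj v x")
      case True
      then show False using tri[of p q x] that sym N_def by blast
    next
      case False
      then show False
        using path_in_neighbourhood[of v p q r s x] that vV sym adj_neq by blast
    qed
    have ne: "a \<noteq> b" "b \<noteq> c" "c \<noteq> d" "a \<noteq> d" using C adj_neq by blast+
    have le2: "dg x {a, b, c, d} \<le> 2" if x: "x \<in> V - {v}" for x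
    proof -
      have "\<not> (adj x a \<and> adj x b \<and> adj x c)" using three[of a b c d x] C x by blast
      moreover have "\<not> (adj x b \<and> adj x c \<and> adj x d)" using three[of b c d a x] C x by blast
      moreover have "\<not> (adj x c \<and> adj x d \<and> adj x a)" using three[of c d a b x] C x by blast
      moreover have "\<not> (adj x d \<and> adj x a \<and> adj x b)" using three[of d a b c x] C x by blast
      ultimately show ?thesis using dg_four[of a b c d x] ne C by (auto simp: of_bool_def)
    qed
    have "dg v {a, b, c, d} \<le> 4" using dg_le[of "{a, b, c, d}" v] ne C by simp
    moreover have "(\<Sum>x\<in>V - {v}. dg x {a, b, c, d}) \<le> 2 * (n - 1)"
      using sum_dg_le[of "V - {v}" "{a, b, c, d}" 2] le2 fin Vv(2) by simp
    moreover have "(\<Sum>x\<in>V. dg x {a, b, c, d}) \<ge> 2 * n + 4"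
      by (rule sum4) (use C ne vV in auto)
    ultimately show False using Vv(1)[of "\<lambda>x. dg x {a, b, c, d}"] Vv(3) by linarith
  qed
  have "N \<noteq> {}" using big cN by auto
  then obtain d where d: "d \<in> N" by blast
  obtain a c where ac: "a \<in> N" "c \<in> N" "a \<noteq> c" "adj d a" "adj d c" using dg_ge_2[OF deg2[OF d]] by blast
  obtain b b' where bb: "b \<in> N" "b' \<in> N" "b \<noteq> b'" "adj a b" "adj a b'"
    using dg_ge_2[OF deg2[OF ac(1)]] by blast
  obtain b where b: "b \<in> N" "adj a b" "b \<noteq> d"
  proof (cases "b = d")
    case True
    then show ?thesis using that[of b'] bb by auto
  next
    case False
    then show ?thesis using that[of b] bb by auto
  qed
  have bc: "b \<noteq> c" using tri[of d a c] d ac b by auto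
  have ne: "c \<noteq> d" "c \<noteq> a" "d \<noteq> a" "d \<noteq> b" "a \<noteq> b" using ac b adj_neq by blast+
  define P where "P = {c, d, a, b}"
  \<comment> \<open>The vertices of \<open>N\<close> that may see two path vertices:
    \<open>d\<close>, \<open>a\<close>, and at most one common neighbour of \<open>c\<close> and
    \<open>b\<close>, as two would close a four-cycle.\<close>
  define F where "F = {d, a} \<union> {x \<in> N. adj x c \<and> adj x b}"
  have dgP: "dg x P = of_bool (adj x c) + of_bool (adj x d) + of_bool (adj x a) + of_bool (adj x b)" for x
    unfolding P_def by (rule dg_four) (use ne bc in auto)
  have FN: "F \<subseteq> N" using d ac F_def by auto
  have cF: "card F \<le> 3"
  proof -
    have "x = y" if "x \<in> {x \<in> N. adj x c \<and> adj x b}" "y \<in> {x \<in> N. adj x c \<and> adj x b}" for x y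
    proof (rule ccontr)
      assume "x \<noteq> y"
      then show False using no_C4[of c x b y] that ac b bc sym by blast
    qed
    then have "card {x \<in> N. adj x c \<and> adj x b} \<le> 1"
      using finN by (simp add: card_le_Suc0_iff_eq)
    moreover have "card {d, a} = 2" using ne by simp
    ultimately show ?thesis using card_Un_le[of "{d, a}" "{x \<in> N. adj x c \<and> adj x b}"] F_def by simp
  qed
  have tri': "\<not> (adj x p \<and> adj x q)" if "x \<in> N" "p \<in> N" "q \<in> N" "adj p q" for x p q
    using tri[of x p q] that by blast
  have tri3: "\<not> (adj x c \<and> adj x d)" "\<not> (adj x d \<and> adj x a)" "\<not> (adj x a \<and> adj x b)" if "x \<in> N" for x
    using tri'[OF that ac(2) d sym[OF ac(5)]] tri'[OF that d ac(1,4)] tri'[OF that ac(1) b(1,2)] by blast+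
  have N2: "dg x P \<le> 2" if "x \<in> N" for x
    unfolding dgP using tri3[OF that]
    by (auto simp: of_bool_def)
  have N1: "dg x P \<le> 1" if x: "x \<in> N - F" for x
  proof -
    have xN: "x \<in> N" "x \<noteq> d" "x \<noteq> a" "\<not> (adj x c \<and> adj x b)" using x F_def by auto
    have "\<not> (adj x c \<and> adj x a)" using no_C4[of c d a x] xN ac d ne sym by blast
    moreover have "\<not> (adj x d \<and> adj x b)" using no_C4[of d a b x] xN ac b d ne sym by blast
    ultimately show ?thesis
      unfolding dgP using xN(4) tri3[OF xN(1)]
      by (auto simp: of_bool_def)
  qed
  have Z3: "dg x P \<le> 3" if x: "x \<in> V - {v} - N" for x
  proof -
    have "\<not> (adj x a \<and> adj x b \<and> adj x c)"
      using path_in_neighbourhood[of v a b c d x] x vV d ac b ne bc sym N_def by blast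
    then show ?thesis unfolding dgP by (auto simp: of_bool_def)
  qed
  have finF: "finite F" using FN finN finite_subset by blast
  have "(\<Sum>x\<in>N. dg x P) = (\<Sum>x\<in>N - F. dg x P) + (\<Sum>x\<in>F. dg x P)"
    using sum.subset_diff[OF FN finN] by simp
  moreover have "(\<Sum>x\<in>N - F. dg x P) \<le> 1 * card (N - F)"
    by (rule sum_dg_le) (use N1 finN in auto)
  moreover have "(\<Sum>x\<in>F. dg x P) \<le> 2 * card F"
    by (rule sum_dg_le) (use N2 FN finF in auto)
  moreover have "card (N - F) = \<Delta> - card F" using card_Diff_subset[OF finF FN] cN by simp
  moreover have "card F \<le> \<Delta>" using card_mono[OF finN FN] cN by simp
  ultimately have sN: "(\<Sum>x\<in>N. dg x P) \<le> \<Delta> + 3" using cF by linarith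
  have NV': "N \<subseteq> V - {v}" using NV vN by auto
  have "(\<Sum>x\<in>V - {v} - N. dg x P) \<le> 3 * card (V - {v} - N)"
    by (rule sum_dg_le) (use Z3 fin in auto)
  moreover have "card (V - {v} - N) = n - 1 - \<Delta>" using card_Diff_subset[OF finN NV'] cN Vv by simp
  moreover have "\<Delta> \<le> n - 1" using card_mono[OF _ NV'] fin cN Vv by simp
  moreover have "(\<Sum>x\<in>V - {v}. dg x P) = (\<Sum>x\<in>V - {v} - N. dg x P) + (\<Sum>x\<in>N. dg x P)"
    using sum.subset_diff[OF NV'] fin by simp
  moreover have "dg v P \<le> 4" using dg_le[of P v] ne bc P_def by simp
  moreover have "(\<Sum>x\<in>V. dg x P) \<ge> 2 * n + 4"
    unfolding P_def by (rule sum4) (use ac b d ne bc vV sym in auto)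
  \<comment> \<open>The total is at most \<open>4 + (\<Delta> + 3) + 3 * (n - 1 - \<Delta>)\<close>,
    hence at most \<open>2 * n + 2\<close>, because \<open>2 * \<Delta> \<ge> n + 2\<close>.\<close>
  ultimately show False using Vv(1)[of "\<lambda>x. dg x P"] Vv(3) sN big by linarith
qed

end

section \<open>Wheels as the extremal graphs without four-cliques\<close>

context prism_free
begin

text \<open>Parts may be empty, so a single vertex and a single edge are wheels and can start the
  induction.\<close>

definition wheel :: "'a set \<Rightarrow> 'a \<Rightarrow> 'a set \<Rightarrow> 'a set \<Rightarrow> bool" where
  "wheel V c P Q \<longleftrightarrow> V = insert c (P \<union> Q) \<and> c \<notin> P \<union> Q \<and> P \<inter> Q = {} \<and>
    (\<forall>x\<in>P \<union> Q. adj c x) \<and> indep P \<and> indep Q \<and> (\<forall>p\<in>P. \<forall>q\<in>Q. adj p q) \<and>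
    card P \<le> card Q + 1 \<and> card Q \<le> card P + 1"

lemma wheel_swap: "wheel V c P Q \<Longrightarrow> wheel V c Q P"
  unfolding wheel_def using sym by (auto simp: Un_commute)

text \<open>The edge \<open>u w\<close> enters both degrees: it is counted once too often for
  \<open>ne V\<close>, and twice compared with the sum over the other vertices.\<close>

lemma ne_edge:
  assumes fin: "finite V" and uw: "u \<in> V" "w \<in> V" "adj u w"
  shows "ne V + 1 = ne (V - {u, w}) + dg u V + dg w V"
    and "(\<Sum>x\<in>V - {u, w}. dg x {u, w}) + 2 = dg u V + dg w V"
proof -
  let ?W = "V - {u, w}"
  have V: "V = insert u (insert w ?W)" using uw by auto
  have neq: "u \<noteq> w" using uw adj_neq by blast
  have 1: "ne V = ne ?W + dg w ?W + dg u (insert w ?W)"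
    by (subst V) (use ne_insert[of ?W w] ne_insert[of "insert w ?W" u] fin neq in auto)
  have 2: "dg u V = dg u (insert w ?W)" "dg u (insert w ?W) = 1 + dg u ?W"
    using dg_insert[of "insert w ?W" u u] dg_insert[of ?W w u] fin neq irr uw V[symmetric] by auto
  have 3: "dg w V = 1 + dg w ?W"
    using dg_insert[of "insert w ?W" u w] dg_insert[of ?W w w] fin neq irr sym[OF uw(3)] V[symmetric] by auto
  show "ne V + 1 = ne ?W + dg u V + dg w V" using 1 2 3 by simp
  have "(\<Sum>x\<in>?W. dg x {u, w}) = (\<Sum>s\<in>{u, w}. dg s ?W)" by (rule sum_dg_swap) (use fin in auto)
  then show "(\<Sum>x\<in>?W. dg x {u, w}) + 2 = dg u V + dg w V" using 2 3 neq by simp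
qed

text \<open>A centre joined to a balanced complete bipartite graph on \<open>m = n - 1\<close>
  vertices gives \<open>m + m^2 div 4 = (m + 2)^2 div 4 - 1\<close> edges.\<close>

definition wheel_size :: "nat \<Rightarrow> nat" where
  "wheel_size n = (n + 1)\<^sup>2 div 4 - 1"

text \<open>The increment \<open>n\<close> is the most that deleting the ends of a light edge can
  cost: degree sum \<open>n + 1\<close>, with the edge itself counted once.\<close>

lemma wheel_size_step:
  assumes "n \<ge> 3"
  shows "wheel_size n = wheel_size (n - 2) + n"
proof -
  obtain m where m: "n = m + 3" using assms by (metis le_add_diff_inverse2)
  have "2\<^sup>2 \<le> (m + 2)\<^sup>2" by (intro power_mono) auto
  then have "(m + 2)\<^sup>2 div 4 \<ge> 1" by simp
  moreover have "(m + 4)\<^sup>2 = (m + 2)\<^sup>2 + 4 * (m + 3)" by (simp add: power2_eq_square algebra_simps)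
  then have "(m + 4)\<^sup>2 div 4 = (m + 2)\<^sup>2 div 4 + (m + 3)" by simp
  moreover have e: "n + 1 = m + 4" "n - 2 + 1 = m + 2" using m by simp_all
  ultimately show ?thesis unfolding wheel_size_def e using m by linarith
qed

lemma K4_free_bound:
  assumes "finite V" "K4_free V" "card V \<ge> 1"
  shows "ne V \<le> wheel_size (card V)"
  using assms
proof (induction "card V" arbitrary: V rule: less_induct)
  case less
  note fin = less.prems(1)
  show ?case
  proof (cases "\<exists>x\<in>V. \<exists>y\<in>V. adj x y")
    case False
    then have "indep V" by (auto simp: indep_def)
    then show ?thesis using ne_indep by simp
  next
    case True
    then obtain u w where uw: "u \<in> V" "w \<in> V" "adj u w" "dg u V + dg w V \<le> card V + 1"
      using light_edge[OF fin less.prems(2)] by blast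
    have "card {u, w} = 2" using adj_neq[OF uw(3)] by simp
    then have c: "card (V - {u, w}) = card V - 2" and ge2: "card V \<ge> 2"
      using uw fin card_Diff_subset[of "{u, w}" V] card_mono[of V "{u, w}"] by auto
    show ?thesis
    proof (cases "card V = 2")
      case True
      then show ?thesis using ne_le[OF fin] by (simp add: wheel_size_def)
    next
      case False
      then have "ne (V - {u, w}) \<le> wheel_size (card V - 2)"
        using less.hyps[of "V - {u, w}"] c ge2 fin K4_free_subset[OF less.prems(2)] by auto
      then show ?thesis
        using ne_edge(1)[OF fin uw(1-3)] uw(4) wheel_size_step[of "card V"] ge2 False by linarith
    qed
  qed
qed

lemma wheel_extend:
  assumes fin: "finite V" and uw: "u \<in> V" "w \<in> V" "adj u w"
    and wh: "wheel (V - {u, w}) c P Q"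
    and cu: "adj c u" "adj c w"
    and P: "\<And>p. p \<in> P \<Longrightarrow> adj u p \<and> \<not> adj w p" and Q: "\<And>q. q \<in> Q \<Longrightarrow> adj w q \<and> \<not> adj u q"
  shows "wheel V c (insert w P) (insert u Q)"
proof -
  have V: "V - {u, w} = insert c (P \<union> Q)" and w: "c \<notin> P \<union> Q" "P \<inter> Q = {}" "\<And>x. x \<in> P \<union> Q \<Longrightarrow> adj c x"
    "indep P" "indep Q" "\<And>p q. p \<in> P \<Longrightarrow> q \<in> Q \<Longrightarrow> adj p q" "card P \<le> card Q + 1" "card Q \<le> card P + 1"
    using wh by (auto simp: wheel_def)
  have V': "V = insert c (insert w P \<union> insert u Q)" using V uw by auto
  have nin: "u \<notin> insert c (P \<union> Q)" "w \<notin> insert c (P \<union> Q)" using V by auto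
  have finPQ: "finite P" "finite Q" using fin V' by (metis finite_Un finite_insert)+
  have card: "card (insert w P) = card P + 1" "card (insert u Q) = card Q + 1" using finPQ nin by auto
  have "indep (insert w P)"
    using w(4) P irr sym unfolding indep_def by blast
  moreover have "indep (insert u Q)"
    using w(5) Q irr sym unfolding indep_def by blast
  moreover have "adj p q" if "p \<in> insert w P" "q \<in> insert u Q" for p q
    using that w(6) P Q sym uw(3) by blast
  moreover have "adj c x" if "x \<in> insert w P \<union> insert u Q" for x using that w(3) cu by blast
  moreover have "c \<notin> insert w P \<union> insert u Q" "insert w P \<inter> insert u Q = {}"
    using w nin adj_neq[OF uw(3)] by auto
  ultimately show ?thesis using V' card w(7,8) unfolding wheel_def by auto
qed

text \<open>A vertex of \<open>P \<union> Q\<close> joined to both \<open>u\<close> and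
  \<open>w\<close> would form a K4 with them and \<open>c\<close>, so the tight sum gives each
  exactly one of the two. Likewise neither \<open>u\<close> nor \<open>w\<close> can see both parts.
  So one of them is joined to all of \<open>P\<close> and the other to all of
  \<open>Q\<close>.\<close>

lemma wheel_step_centre:
  assumes fin: "finite V" and K4: "K4_free V" and uw: "u \<in> V" "w \<in> V" "adj u w"
    and wh: "wheel (V - {u, w}) c P Q"
    and sum: "(\<Sum>x\<in>V - {u, w}. dg x {u, w}) + 1 = card V"
    and cu: "adj c u" "adj c w"
  shows "\<exists>c P Q. wheel V c P Q"
proof -
  have V: "V - {u, w} = insert c (P \<union> Q)" and w: "c \<notin> P \<union> Q" "P \<inter> Q = {}" "\<And>x. x \<in> P \<union> Q \<Longrightarrow> adj c x"
    "\<And>p q. p \<in> P \<Longrightarrow> q \<in> Q \<Longrightarrow> adj p q" "card P \<le> card Q + 1" "card Q \<le> card P + 1"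
    using wh by (auto simp: wheel_def)
  have PQ: "finite (P \<union> Q)" using fin V by (metis finite_Diff finite_insert)
  have sub: "P \<union> Q \<subseteq> V" "c \<in> V" using V by auto
  have neq: "u \<noteq> w" using uw adj_neq by blast
  have dg2: "dg x {u, w} = of_bool (adj x u) + of_bool (adj x w)" for x
    using neq by (simp add: dg_insert)
  have "card (V - {u, w}) = card V - 2" using uw neq fin by (simp add: card_Diff_subset)
  moreover have "card V \<ge> 2" using card_mono[OF fin, of "{u, w}"] uw neq by simp
  moreover have "card (V - {u, w}) = card (P \<union> Q) + 1" unfolding V using w PQ by simp
  moreover have "(\<Sum>x\<in>V - {u, w}. dg x {u, w}) = 2 + (\<Sum>x\<in>P \<union> Q. dg x {u, w})"
    unfolding V using w(1) PQ cu by (simp add: dg2)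
  ultimately have s: "(\<Sum>x\<in>P \<union> Q. dg x {u, w}) \<ge> 1 * card (P \<union> Q)" using sum by simp
  have le1: "dg x {u, w} \<le> 1" if "x \<in> P \<union> Q" for x
    using K4_freeD[OF K4, of c u w x] cu w(3)[OF that] uw sub that sym unfolding dg2
    by (auto simp: of_bool_def)
  have "dg x {u, w} = 1" if "x \<in> P \<union> Q" for x
    by (rule sum_eq_upper_bound[OF PQ _ s that]) (rule le1)
  then have one: "adj u x \<longleftrightarrow> \<not> adj w x" if "x \<in> P \<union> Q" for x
    using that adj_commute[of x] unfolding dg2 by (force simp: of_bool_def split: if_splits)
  have no: "\<not> (adj y p \<and> adj y q)" if "p \<in> P" "q \<in> Q" "y \<in> {u, w}" for p q y
  proof
    assume "adj y p \<and> adj y q"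
    then show False
      using K4_freeD[OF K4, of c y p q] cu w(3)[of p] w(3)[of q] w(4)[of p q] uw sub that by blast
  qed
  have ext: "\<exists>c P Q. wheel V c P Q" if "\<And>p. p \<in> P \<Longrightarrow> adj u p" "\<And>q. q \<in> Q \<Longrightarrow> adj w q"
    using wheel_extend[OF fin uw wh cu] that one by blast
  have ext': "\<exists>c P Q. wheel V c P Q" if "\<And>p. p \<in> P \<Longrightarrow> adj w p" "\<And>q. q \<in> Q \<Longrightarrow> adj u q"
    using wheel_extend[OF fin uw wheel_swap[OF wh] cu] that one by blast
  \<comment> \<open>If one part is empty, balance leaves at most one vertex in the other, and no
    comparison across the parts is possible or required.\<close>
  have one_elt: "x = y" if "card S \<le> 1" "x \<in> S" "y \<in> S" "finite S" for x y :: 'a and S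
    using that card_le_Suc0_iff_eq[of S] by simp
  consider (a) "\<exists>p\<in>P. adj u p" | (b) "\<forall>p\<in>P. \<not> adj u p" "P \<noteq> {}" | (c) "P = {}" by blast
  then show ?thesis
  proof cases
    case a
    then obtain p where p: "p \<in> P" "adj u p" by blast
    then have Qw: "adj w q" if "q \<in> Q" for q using no[of p q u] one[of q] that by blast
    show ?thesis
    proof (cases "Q = {}")
      case True
      then have "adj u p'" if "p' \<in> P" for p' using one_elt[of P p' p] w(5) that p PQ by auto
      then show ?thesis using ext True by blast
    next
      case False
      then have "adj u p'" if "p' \<in> P" for p' using no[of p' _ w] Qw one[of p'] that by blast
      then show ?thesis using ext Qw by blast
    qed
  next
    case b
    then have Pw: "adj w p" if "p \<in> P" for p using one[of p] that by blast
    then have "adj u q" if "q \<in> Q" for q using no[of _ q w] one[of q] b(2) that by blast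
    then show ?thesis using ext' Pw by blast
  next
    case c
    show ?thesis
    proof (cases "\<exists>q\<in>Q. adj u q")
      case True
      then obtain q where "q \<in> Q" "adj u q" by blast
      then have "adj u q'" if "q' \<in> Q" for q' using one_elt[of Q q' q] w(6) that c PQ by auto
      then show ?thesis using ext' c by blast
    next
      case False
      then show ?thesis using ext c one by blast
    qed
  qed
qed

text \<open>Here \<open>p\<close> is an apex over the edge \<open>u w\<close>, and the centre is
  not. The total number of edges to \<open>{u, w}\<close> is fixed by \<open>sum\<close>, and
  \<open>pq\<close> distributes them over the two parts; with at least two vertices in
  \<open>P\<close> every distribution contains a K4 or a prism.\<close>

lemma wheel_no_apex_outside_centre:
  assumes fin: "finite V" and K4: "K4_free V" and uw: "u \<in> V" "w \<in> V" "adj u w"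
    and wh: "wheel (V - {u, w}) c P Q"
    and sum: "(\<Sum>x\<in>V - {u, w}. dg x {u, w}) + 1 = card V"
    and c1: "\<not> (adj c u \<and> adj c w)"
    and pq: "\<And>p q. p \<in> P \<Longrightarrow> q \<in> Q \<Longrightarrow> dg p {u, w} + dg q {u, w} \<ge> 2"
    and p: "p \<in> P" "adj p u" "adj p w" and P2: "card P \<ge> 2"
  shows False
proof -
  have V: "V - {u, w} = insert c (P \<union> Q)" and w: "c \<notin> P \<union> Q" "P \<inter> Q = {}" "\<And>x. x \<in> P \<union> Q \<Longrightarrow> adj c x"
    "\<And>p q. p \<in> P \<Longrightarrow> q \<in> Q \<Longrightarrow> adj p q" "card P \<le> card Q + 1" "card Q \<le> card P + 1"
    using wh by (auto simp: wheel_def)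
  have finPQ: "finite (P \<union> Q)" "finite P" "finite Q"
    using fin V by (metis finite_Diff finite_insert finite_Un)+
  have sub: "P \<subseteq> V" "Q \<subseteq> V" "c \<in> V" and nin: "u \<notin> insert c (P \<union> Q)" "w \<notin> insert c (P \<union> Q)"
    using V by auto
  have neq: "u \<noteq> w" using uw adj_neq by blast
  have dg2: "dg x {u, w} = of_bool (adj x u) + of_bool (adj x w)" for x
    using neq by (simp add: dg_insert)
  have cV: "card V = card P + card Q + 3"
  proof -
    have "card (V - {u, w}) = card V - 2" using uw neq fin by (simp add: card_Diff_subset)
    moreover have "card V \<ge> 2" using card_mono[OF fin, of "{u, w}"] uw neq by simp
    moreover have "card (V - {u, w}) = card P + card Q + 1"
      unfolding V using w finPQ by (simp add: card_Un_disjoint)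
    ultimately show ?thesis by simp
  qed
  have s: "dg c {u, w} + (\<Sum>x\<in>P. dg x {u, w}) + (\<Sum>x\<in>Q. dg x {u, w}) = card P + card Q + 2"
    using sum w(1,2) finPQ unfolding V cV by (simp add: sum.union_disjoint)
  obtain p' where p': "p' \<in> P" "p' \<noteq> p"
  proof -
    have "\<not> P \<subseteq> {p}" using P2 card_mono[of "{p}" P] by auto
    then show ?thesis using that by blast
  qed
  have "Q \<noteq> {}" using P2 w(5) by auto
  have q1: "\<not> (adj q u \<and> adj q w)" if "q \<in> Q" for q
    using K4_freeD[OF K4, of p q u w] that p uw w(4)[OF p(1) that] sub by blast
  show False
  proof (cases "\<exists>q\<in>Q. adj q u \<or> adj q w")
    case True
    text \<open>The situation is symmetric in \<open>u\<close> and \<open>w\<close>.\<close>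
    have key: False if y: "{y, z} = {u, w}" "q \<in> Q" "adj q y" for y z q
    proof -
      have yz: "adj y z" "adj p y" "adj p z" "y \<noteq> z" "y \<in> V" "z \<in> V" "y \<notin> insert c (P \<union> Q)"
        "z \<notin> insert c (P \<union> Q)" "\<not> (adj q y \<and> adj q z)" "\<not> (adj c y \<and> adj c z)"
        using y uw p neq nin q1[OF y(2)] c1 sym[OF uw(3)] by (auto simp: doubleton_eq_iff)
      have dgyz: "dg x {u, w} = of_bool (adj x y) + of_bool (adj x z)" for x
        unfolding dg2 using y(1) by (auto simp: doubleton_eq_iff)
      have cy: "\<not> adj c y"
        using K4_freeD[OF K4, of p q y c] y(2,3) yz(2,5) p w(3)[of p] w(3)[of q] w(4)[OF p(1) y(2)] sub sym by blast
      have facts: "x \<noteq> q" "x \<noteq> c" "adj x q" "adj c x" "x \<noteq> y" "x \<noteq> z" if "x \<in> P" for x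
        using that y(2) w yz(7,8) by auto
      have qf: "q \<noteq> c" "adj c q" "q \<noteq> y" "q \<noteq> z" "c \<noteq> y" "c \<noteq> z" using y(2) w yz(7,8) by auto
      \<comment> \<open>If \<open>x\<close> saw \<open>z\<close>, the triangles \<open>y z p\<close>
        and \<open>q x c\<close> would be matched. As \<open>q\<close> sees only \<open>y\<close>,
        \<open>pq\<close> leaves \<open>x\<close> an edge to \<open>y\<close>.\<close>
      have other: "adj x y \<and> \<not> adj x z" if x: "x \<in> P" "x \<noteq> p" for x
      proof -
        have "\<not> adj x z"
        proof
          assume "adj x z"
          then show False
            by (intro free[of y z p q x c])
              (use facts[OF x(1)] facts[OF p(1)] qf yz y(3) x in \<open>auto simp: adj_commute\<close>)
        qed
        moreover have "adj x y \<or> adj x z"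
          using pq[OF x(1) y(2)] yz(9) unfolding dgyz by (auto simp: of_bool_def split: if_splits)
        ultimately show ?thesis by blast
      qed
      \<comment> \<open>A second vertex \<open>q'\<close> would give the triangles
        \<open>y q p'\<close> and \<open>p c q'\<close>.\<close>
      have "q' = q" if q': "q' \<in> Q" for q'
      proof (rule ccontr)
        assume "q' \<noteq> q"
        moreover have "adj p q'" "adj p' q'" "adj c q'" "q' \<noteq> y" "q' \<noteq> c" "q' \<noteq> p" "q' \<noteq> p'"
          using q' p' p w yz(7) by auto
        ultimately show False
          by (intro free[of y q p' p c q'])
            (use facts[OF p'(1)] facts[OF p(1)] qf yz y(3) p' other[OF p'] in \<open>auto simp: adj_commute\<close>)
      qed
      then have Q: "Q = {q}" using y(2) by blast
      have "P = {p, p'}"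
        using card_seteq[of P "{p, p'}"] finPQ p(1) p' w(5) Q by simp
      \<comment> \<open>The summands for \<open>p\<close>, \<open>p'\<close> and \<open>q\<close>
        are 2, 1 and 1, so \<open>c\<close> has exactly one edge, and it goes to
        \<open>z\<close>.\<close>
      then have "dg c {u, w} + (dg p {u, w} + dg p' {u, w}) + dg q {u, w} = 5"
        using s Q p'(2) by simp
      then have "adj c z"
        using other[OF p'] cy yz(9) unfolding dgyz by (auto simp: of_bool_def split: if_splits)
      then show False
        by (intro free[of y z p p' c q])
          (use facts[OF p'(1)] facts[OF p(1)] qf yz y(3) p' other[OF p'] in \<open>auto simp: adj_commute\<close>)
    qed
    then show False using True key[of u w] key[of w u] by blast
  next
    case False
    then have Q0: "dg q {u, w} = 0" if "q \<in> Q" for q using that by (simp add: dg2)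
    have P2': "dg x {u, w} = 2" if "x \<in> P" for x
    proof -
      obtain q where "q \<in> Q" using \<open>Q \<noteq> {}\<close> by blast
      then show ?thesis using pq[OF that] Q0[of q] dg2[of x] by (force simp: of_bool_def split: if_splits)
    qed
    \<comment> \<open>The balance \<open>card P \<le> card Q + 1\<close> leaves at least one edge
      for \<open>c\<close>.\<close>
    have "dg c {u, w} + 2 * card P = card P + card Q + 2" using s Q0 P2' by simp
    then have c: "adj c u \<or> adj c w" using w(5) dg2[of c] by (auto simp: of_bool_def split: if_splits)
    obtain q where q: "q \<in> Q" using \<open>Q \<noteq> {}\<close> by blast
    have p'2: "adj p' u" "adj p' w" using P2'[OF p'(1)] dg2[of p'] by (auto simp: of_bool_def split: if_splits)
    have e: "adj c p" "adj c p'" "adj c q" "adj p q" "adj p' q" using w p p' q by auto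
    have d: "u \<noteq> c" "u \<noteq> p" "u \<noteq> p'" "u \<noteq> q" "w \<noteq> c" "w \<noteq> p" "w \<noteq> p'" "w \<noteq> q" "c \<noteq> p" "c \<noteq> p'" "c \<noteq> q"
      "p \<noteq> q" "p' \<noteq> q" using nin w p p' q by auto
    from c show False
    proof
      assume "adj c u"
      then show False
        by (intro free[of u w p c p' q]) (use e d p p' p'2 uw neq in \<open>auto simp: adj_commute\<close>)
    next
      assume "adj c w"
      then show False
        by (intro free[of w u p c p' q]) (use e d p p' p'2 uw neq in \<open>auto simp: adj_commute\<close>)
    qed
  qed
qed

text \<open>If the old centre is no apex over \<open>u w\<close>, counting yields an apex in
  \<open>P\<close> or \<open>Q\<close>. Its part must be a single vertex, and then apex and centre
  can exchange roles.\<close>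

lemma wheel_step:
  assumes fin: "finite V" and K4: "K4_free V" and n: "card V \<ge> 3" and uw: "u \<in> V" "w \<in> V" "adj u w"
    and wh: "wheel (V - {u, w}) c P Q"
    and sum: "(\<Sum>x\<in>V - {u, w}. dg x {u, w}) + 1 = card V"
    and eq: "ne V = wheel_size (card V)"
  shows "\<exists>c P Q. wheel V c P Q"
proof (cases "adj c u \<and> adj c w")
  case True
  then show ?thesis using wheel_step_centre[OF fin K4 uw wh sum] by blast
next
  case c1: False
  have V: "V - {u, w} = insert c (P \<union> Q)" and w: "c \<notin> P \<union> Q" "P \<inter> Q = {}" "\<And>x. x \<in> P \<union> Q \<Longrightarrow> adj c x"
    "\<And>p q. p \<in> P \<Longrightarrow> q \<in> Q \<Longrightarrow> adj p q" "indep P" "indep Q" "card P \<le> card Q + 1" "card Q \<le> card P + 1"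
    using wh by (auto simp: wheel_def)
  have finPQ: "finite (P \<union> Q)" "finite P" "finite Q"
    using fin V by (metis finite_Diff finite_insert finite_Un)+
  have sub: "P \<subseteq> V" "Q \<subseteq> V" "c \<in> V" and nin: "u \<notin> insert c (P \<union> Q)" "w \<notin> insert c (P \<union> Q)"
    using V by auto
  have neq: "u \<noteq> w" using uw adj_neq by blast
  have dg2: "dg x {u, w} = of_bool (adj x u) + of_bool (adj x w)" for x
    using neq by (simp add: dg_insert)
  have cV: "card V = card P + card Q + 3"
  proof -
    have "card (V - {u, w}) = card V - 2" using uw neq fin by (simp add: card_Diff_subset)
    moreover have "card (V - {u, w}) = card P + card Q + 1"
      unfolding V using w finPQ by (simp add: card_Un_disjoint)
    ultimately show ?thesis using n by simp
  qed
  \<comment> \<open>The edge \<open>p q\<close> could be deleted instead of \<open>u w\<close>: by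
    \<open>K4_free_bound\<close> its degree sum is at least \<open>card V + 1\<close>, and only
    \<open>card V - 1\<close> of this lies inside the smaller wheel.\<close>
  have pq: "dg p {u, w} + dg q {u, w} \<ge> 2" if "p \<in> P" "q \<in> Q" for p q
  proof -
    have e: "p \<in> V" "q \<in> V" "adj p q" using that sub w by auto
    have dV: "dg x V = dg x {u, w} + dg x (V - {u, w})" for x
      using dg_Un[of "{u, w}" "V - {u, w}" x] fin uw by (auto simp: insert_absorb)
    have "{y \<in> V - {u, w}. adj p y} = insert c Q" "{y \<in> V - {u, w}. adj q y} = insert c P"
      unfolding V using that w sym by (auto simp: indep_def)
    then have "dg p (V - {u, w}) = card Q + 1" "dg q (V - {u, w}) = card P + 1"
      unfolding dg_def using w(1) finPQ by simp_all
    then have "dg p V + dg q V = dg p {u, w} + dg q {u, w} + (card V - 1)" using dV cV by simp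
    moreover have "card {p, q} = 2" using adj_neq[OF e(3)] by simp
    then have c2: "card (V - {p, q}) = card V - 2"
      using e fin card_Diff_subset[of "{p, q}" V] by auto
    then have "ne (V - {p, q}) \<le> wheel_size (card V - 2)"
      using K4_free_bound[of "V - {p, q}"] fin K4_free_subset[OF K4] n by auto
    moreover have "wheel_size (card V) = wheel_size (card V - 2) + card V"
      using wheel_size_step n by simp
    ultimately show ?thesis using ne_edge(1)[OF fin e] eq n by linarith
  qed
  have apex: "\<exists>c P Q. wheel V c P Q"
    if wh': "wheel (V - {u, w}) c P' Q'" and pq': "\<And>p q. p \<in> P' \<Longrightarrow> q \<in> Q' \<Longrightarrow> dg p {u, w} + dg q {u, w} \<ge> 2"
      and p: "p \<in> P'" "adj p u" "adj p w" for p P' Q'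
  proof (cases "card P' \<ge> 2")
    case True
    then show ?thesis using wheel_no_apex_outside_centre[OF fin K4 uw wh' sum c1 pq' p] by blast
  next
    case False
    have w': "V - {u, w} = insert c (P' \<union> Q')" "c \<notin> P' \<union> Q'" "P' \<inter> Q' = {}" "\<And>x. x \<in> P' \<union> Q' \<Longrightarrow> adj c x"
      "\<And>p q. p \<in> P' \<Longrightarrow> q \<in> Q' \<Longrightarrow> adj p q" "indep Q'" "card P' \<le> card Q' + 1" "card Q' \<le> card P' + 1"
      using wh' by (auto simp: wheel_def)
    have "finite P'" using fin w'(1) by (metis finite_Diff finite_insert finite_Un)
    then have P': "P' = {p}" using card_seteq[of P' "{p}"] False p(1) by simp
    \<comment> \<open>With a singleton part \<open>{p}\<close>, the vertices \<open>c\<close> and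
      \<open>p\<close> are both joined to each other and to all of \<open>Q'\<close>.\<close>
    have "wheel (V - {u, w}) p {c} Q'"
      unfolding wheel_def using w' P' sym[OF w'(4)[of p]] irr by (auto simp: indep_def)
    then show ?thesis using wheel_step_centre[OF fin K4 uw _ sum p(2,3)] by blast
  qed
  have "\<exists>x\<in>P \<union> Q. adj x u \<and> adj x w"
  proof (rule ccontr)
    assume "\<not> ?thesis"
    then have "(\<Sum>x\<in>P \<union> Q. dg x {u, w}) \<le> 1 * card (P \<union> Q)"
      by (intro sum_dg_le finPQ) (auto simp: dg2 of_bool_def)
    moreover have "dg c {u, w} \<le> 1" using c1 by (auto simp: dg2)
    moreover have "card (P \<union> Q) = card P + card Q" using w finPQ by (simp add: card_Un_disjoint)
    moreover have "(\<Sum>x\<in>V - {u, w}. dg x {u, w}) = dg c {u, w} + (\<Sum>x\<in>P \<union> Q. dg x {u, w})"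
      unfolding V using w(1) finPQ by simp
    ultimately show False using sum cV by simp
  qed
  then obtain p where p: "p \<in> P \<union> Q" "adj p u" "adj p w" by blast
  show ?thesis
  proof (cases "p \<in> P")
    case True
    then show ?thesis using apex[OF wh pq] p by blast
  next
    case False
    then have "p \<in> Q" using p by blast
    moreover have "dg q {u, w} + dg p {u, w} \<ge> 2" if "q \<in> Q" "p \<in> P" for p q using pq[OF that(2,1)] by simp
    ultimately show ?thesis using apex[OF wheel_swap[OF wh]] p by blast
  qed
qed

lemma K4_free_extremal:
  assumes "finite V" "K4_free V" "card V \<ge> 1" "ne V = wheel_size (card V)"
  shows "\<exists>c P Q. wheel V c P Q"
  using assms
proof (induction "card V" arbitrary: V rule: less_induct)
  case less
  note fin = less.prems(1)
  consider "card V = 1" | "card V = 2" | "card V \<ge> 3" using less.prems(3) by linarith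
  then show ?case
  proof cases
    case 1
    then obtain c where "V = {c}" by (meson card_1_singletonE)
    then have "wheel V c {} {}" by (auto simp: wheel_def indep_def)
    then show ?thesis by blast
  next
    case 2
    then have "clique V" using ne_full[OF fin] less.prems(4) by (simp add: wheel_size_def)
    moreover obtain c p where "V = {c, p}" "c \<noteq> p" using 2 by (meson card_2_iff)
    ultimately have "wheel V c {p} {}" using irr by (auto simp: wheel_def indep_def clique_def)
    then show ?thesis by blast
  next
    case 3
    have "\<exists>x\<in>V. \<exists>y\<in>V. adj x y"
    proof (rule ccontr)
      assume "\<not> ?thesis"
      then have "ne V = 0" by (intro ne_indep) (auto simp: indep_def)
      moreover have "wheel_size (card V) = wheel_size (card V - 2) + card V"
        using wheel_size_step 3 by simp
      ultimately show False using less.prems(4) 3 by simp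
    qed
    then obtain u w where uw: "u \<in> V" "w \<in> V" "adj u w" "dg u V + dg w V \<le> card V + 1"
      using light_edge[OF fin less.prems(2)] by blast
    have "card {u, w} = 2" using adj_neq[OF uw(3)] by simp
    then have c: "card (V - {u, w}) = card V - 2"
      using uw fin card_Diff_subset[of "{u, w}" V] by auto
    have K4': "K4_free (V - {u, w})" using K4_free_subset[OF less.prems(2)] by auto
    have "ne (V - {u, w}) \<le> wheel_size (card V - 2)"
      using K4_free_bound[OF _ K4'] fin c 3 by simp
    moreover have "wheel_size (card V) = wheel_size (card V - 2) + card V"
      using wheel_size_step 3 by simp
    ultimately have e: "ne (V - {u, w}) = wheel_size (card V - 2)" "dg u V + dg w V = card V + 1"
      using ne_edge(1)[OF fin uw(1-3)] uw(4) less.prems(4) by linarith+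
    then have "\<exists>c P Q. wheel (V - {u, w}) c P Q"
      using less.hyps[of "V - {u, w}"] c fin K4' 3 by auto
    then obtain c P Q where "wheel (V - {u, w}) c P Q" by blast
    moreover have "(\<Sum>x\<in>V - {u, w}. dg x {u, w}) + 1 = card V"
      using ne_edge(2)[OF fin uw(1-3)] e by linarith
    ultimately show ?thesis
      using wheel_step[OF fin less.prems(2) 3 uw(1-3)] less.prems(4) by blast
  qed
qed

end

section \<open>The extremal bound\<close>

context sgraph
begin

text \<open>The size of \<open>T\<close> is not fixed but amounts to \<open>card V - 3\<close>, so
  one notion covers \<open>G1\<close>, \<open>G2\<close> and \<open>G3\<close>.\<close>

definition two_cliques :: "'a set \<Rightarrow> 'a set \<Rightarrow> 'a set \<Rightarrow> bool" where
  "two_cliques V S T \<longleftrightarrow> V = S \<union> T \<and> card S = 5 \<and> card (S \<inter> T) = 2 \<and>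
    (\<forall>x\<in>V. \<forall>y\<in>V. adj x y \<longleftrightarrow> x \<noteq> y \<and> (x \<in> S \<and> y \<in> S \<or> x \<in> T \<and> y \<in> T))"

end

context prism_free
begin

lemma wheel_size_le_exn: "wheel_size n \<le> exn n"
  by (simp add: wheel_size_def exn_def)

lemma wheel_partition:
  assumes "wheel V c P Q"
  shows "\<exists>X \<subseteq> V. noP4 X \<and> indep (V - X)"
proof -
  have V: "V = insert c (P \<union> Q)" "c \<notin> P \<union> Q" "P \<inter> Q = {}" "indep P" "indep Q"
    using assms by (auto simp: wheel_def)
  have "noP4 (insert c P)"
    using V(4) irr unfolding noP4_def indep_def by blast
  moreover have "V - insert c P = Q" using V(1-3) by auto
  ultimately show ?thesis using V by (intro exI[of _ "insert c P"]) auto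
qed

text \<open>The order of the cases matters: the join of a triangle with three vertices is studied in
  the absence of K5, and K4 in the absence of both. In the last case equality with
  \<open>exn\<close> forces \<open>wheel_size\<close> to equal \<open>exn\<close>, and the centre
  with one part of the wheel is a star.\<close>

theorem prism_free_extremal:
  assumes "finite V" "card V \<ge> 6"
  shows "ne V \<le> exn (card V) \<and> (ne V = exn (card V) \<longrightarrow>
    card V \<le> 8 \<and> (\<exists>S T. two_cliques V S T) \<or> (\<exists>X \<subseteq> V. noP4 X \<and> indep (V - X)))"
  using assms
proof (induction "card V" arbitrary: V rule: less_induct)
  case less
  note fin = less.prems(1)
  have IH: "ne W \<le> exn (card W)" if "W \<subseteq> V" "card W < card V" "card W \<ge> 6" for W
    using less.hyps[of W] that fin finite_subset by blast
  show ?case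
  proof (cases "\<exists>Q\<subseteq>V. clique Q \<and> card Q = 5")
    case True
    then obtain Q where Q: "Q \<subseteq> V" "clique Q" "card Q = 5" by blast
    show ?thesis using K5_case[OF fin refl less.prems(2) Q IH] unfolding two_cliques_def by blast
  next
    case False
    then have K5: "\<And>Q. Q \<subseteq> V \<Longrightarrow> clique Q \<Longrightarrow> card Q \<noteq> 5" by blast
    show ?thesis
    proof (cases "\<exists>A\<subseteq>V. \<exists>B\<subseteq>V. clique A \<and> card A = 3 \<and> card B = 3 \<and> (\<forall>a\<in>A. \<forall>b\<in>B. adj a b)")
      case True
      then obtain A B where AB: "A \<subseteq> V" "clique A" "card A = 3" "B \<subseteq> V" "card B = 3"
        "\<And>a b. a \<in> A \<Longrightarrow> b \<in> B \<Longrightarrow> adj a b" by blast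
      show ?thesis using K3_join_case[OF fin AB K5 IH] by blast
    next
      case K3: False
      show ?thesis
      proof (cases "\<exists>K\<subseteq>V. clique K \<and> card K = 4")
        case True
        then obtain K where K: "K \<subseteq> V" "clique K" "card K = 4" by blast
        have K3': False if AB: "A \<subseteq> V" "B \<subseteq> V" "clique A" "card A = 3" "card B = 3"
          "\<And>a b. a \<in> A \<Longrightarrow> b \<in> B \<Longrightarrow> adj a b" for A B
        proof -
          have "\<forall>a\<in>A. \<forall>b\<in>B. adj a b" using AB(6) by blast
          then show False using K3 AB(1-5) by blast
        qed
        have "ne V < exn (card V)"
          by (rule K4_case[OF fin less.prems(2) K]) (fact K5 K3' IH)+
        then show ?thesis by simp
      next
        case False
        have K4: "K4_free V"
          unfolding K4_free_def
        proof (intro ballI impI notI)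
          fix a b c d assume *: "a \<in> V" "b \<in> V" "c \<in> V" "d \<in> V" "adj a b" "adj a c" "adj a d"
            "adj b c" "adj b d" "adj c d"
          then have "clique {a, b, c, d}" using sym by (simp add: clique_def)
          moreover have "card {a, b, c, d} = 4" using * adj_neq by (simp add: adj_neq)
          ultimately show False using False * by (metis empty_subsetI insert_subset)
        qed
        have n1: "card V \<ge> 1" using less.prems(2) by simp
        show ?thesis
        proof (intro conjI impI)
          show "ne V \<le> exn (card V)"
            using K4_free_bound[OF fin K4 n1] wheel_size_le_exn order_trans by blast
          assume "ne V = exn (card V)"
          then have "ne V = wheel_size (card V)"
            using K4_free_bound[OF fin K4 n1] wheel_size_le_exn[of "card V"] by simp
          then show "card V \<le> 8 \<and> (\<exists>S T. two_cliques V S T) \<or> (\<exists>X \<subseteq> V. noP4 X \<and> indep (V - X))"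
            using K4_free_extremal[OF fin K4 n1] wheel_partition by blast
        qed
      qed
    qed
  qed
qed

end

section \<open>Prism-freeness and size of the candidates\<close>

context sgraph
begin

text \<open>The prism vertices in \<open>Y\<close> are independent, so they lie in some pair
  \<open>u_i\<close>, \<open>w_j\<close> with distinct \<open>i\<close> and \<open>j\<close>. Each
  of the six pairs leaves one of the six paths listed, all of whose vertices would lie in
  \<open>X\<close>.\<close>

lemma noP4_indep_prism_free:
  assumes X: "noP4 X" and Y: "indep Y" and XY: "\<And>x y. adj x y \<Longrightarrow> x \<in> X \<union> Y"
  shows "prism_free adj"
proof unfold_locales
  fix u1 u2 u3 w1 w2 w3
  assume e: "adj u1 u2" "adj u1 u3" "adj u2 u3" "adj w1 w2" "adj w1 w3" "adj w2 w3"
    "adj u1 w1" "adj u2 w2" "adj u3 w3"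
    and d: "u1 \<noteq> w2" "u1 \<noteq> w3" "u2 \<noteq> w1" "u2 \<noteq> w3" "u3 \<noteq> w1" "u3 \<noteq> w2"
  have mem: "x \<in> X \<or> x \<in> Y" if "adj x y" for x y using XY[OF that] by blast
  have m: "u1 \<in> X \<or> u1 \<in> Y" "u2 \<in> X \<or> u2 \<in> Y" "u3 \<in> X \<or> u3 \<in> Y"
    "w1 \<in> X \<or> w1 \<in> Y" "w2 \<in> X \<or> w2 \<in> Y" "w3 \<in> X \<or> w3 \<in> Y"
    using mem e sym by blast+
  have y: "\<not> (x \<in> Y \<and> y \<in> Y)" if "adj x y" for x y using Y that unfolding indep_def by blast
  have p: "\<not> (a \<in> X \<and> b \<in> X \<and> c \<in> X \<and> d \<in> X)"
    if "adj a b" "adj b c" "adj c d" "a \<noteq> c" "a \<noteq> d" "b \<noteq> d" for a b c d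
    using noP4D[OF X] that by blast
  note s = e[THEN sym]
  have "\<not> (u1 \<in> X \<and> u2 \<in> X \<and> w2 \<in> X \<and> w3 \<in> X)" by (rule p) (use e d s in auto)
  moreover have "\<not> (u1 \<in> X \<and> u3 \<in> X \<and> w3 \<in> X \<and> w2 \<in> X)" by (rule p) (use e d s in auto)
  moreover have "\<not> (u2 \<in> X \<and> u1 \<in> X \<and> w1 \<in> X \<and> w3 \<in> X)" by (rule p) (use e d s in auto)
  moreover have "\<not> (u2 \<in> X \<and> u3 \<in> X \<and> w3 \<in> X \<and> w1 \<in> X)" by (rule p) (use e d s in auto)
  moreover have "\<not> (u3 \<in> X \<and> u1 \<in> X \<and> w1 \<in> X \<and> w2 \<in> X)" by (rule p) (use e d s in auto)
  moreover have "\<not> (u3 \<in> X \<and> u2 \<in> X \<and> w2 \<in> X \<and> w1 \<in> X)" by (rule p) (use e d s in auto)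
  ultimately show False using m e[THEN y] by argo
qed

text \<open>Each triangle lies in \<open>S\<close> or in \<open>T\<close>, and five vertices cannot
  hold both. So the triangles are separated, and each of the three disjoint matching edges needs an
  end in \<open>S \<inter> T\<close>.\<close>

lemma two_cliques_prism_free:
  assumes fin: "finite S" "finite T" and c: "card S \<le> 5" "card T \<le> 5" "card (S \<inter> T) \<le> 2"
    and adj: "\<And>x y. adj x y \<Longrightarrow> x \<in> S \<and> y \<in> S \<or> x \<in> T \<and> y \<in> T"
  shows "prism_free adj"
proof unfold_locales
  fix u1 u2 u3 w1 w2 w3
  assume e: "adj u1 u2" "adj u1 u3" "adj u2 u3" "adj w1 w2" "adj w1 w3" "adj w2 w3"
    "adj u1 w1" "adj u2 w2" "adj u3 w3"
    and d: "u1 \<noteq> w2" "u1 \<noteq> w3" "u2 \<noteq> w1" "u2 \<noteq> w3" "u3 \<noteq> w1" "u3 \<noteq> w2"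
  have six: "card {u1, u2, u3, w1, w2, w3} = 6" using e[THEN adj_neq] d by auto
  have u: "{u1, u2, u3} \<subseteq> S \<or> {u1, u2, u3} \<subseteq> T"
    using adj[OF e(1)] adj[OF e(2)] adj[OF e(3)] by blast
  have w: "{w1, w2, w3} \<subseteq> S \<or> {w1, w2, w3} \<subseteq> T"
    using adj[OF e(4)] adj[OF e(5)] adj[OF e(6)] by blast
  have no: False if "{u1, u2, u3, w1, w2, w3} \<subseteq> U" "finite U" "card U \<le> 5" for U
    using card_mono[OF that(2,1)] six that(3) by simp
  have "\<not> ({u1, u2, u3} \<subseteq> S \<and> {w1, w2, w3} \<subseteq> S)" using no[of S] fin(1) c(1) by auto
  moreover have "\<not> ({u1, u2, u3} \<subseteq> T \<and> {w1, w2, w3} \<subseteq> T)" using no[of T] fin(2) c(2) by auto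
  ultimately consider "{u1, u2, u3} \<subseteq> S" "{w1, w2, w3} \<subseteq> T" | "{u1, u2, u3} \<subseteq> T" "{w1, w2, w3} \<subseteq> S"
    using u w by argo
  then have i: "u1 \<in> S \<inter> T \<or> w1 \<in> S \<inter> T" "u2 \<in> S \<inter> T \<or> w2 \<in> S \<inter> T" "u3 \<in> S \<inter> T \<or> w3 \<in> S \<inter> T"
    using adj[OF e(7)] adj[OF e(8)] adj[OF e(9)] by (cases; simp; argo)+
  obtain z1 z2 z3 where z: "z1 \<in> {u1, w1} \<inter> (S \<inter> T)" "z2 \<in> {u2, w2} \<inter> (S \<inter> T)" "z3 \<in> {u3, w3} \<inter> (S \<inter> T)"
    using i by blast
  then have "z1 \<noteq> z2" "z1 \<noteq> z3" "z2 \<noteq> z3" using e[THEN adj_neq] d by auto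
  then have "card {z1, z2, z3} = 3" by simp
  moreover have "card {z1, z2, z3} \<le> card (S \<inter> T)" using z fin by (intro card_mono) auto
  ultimately show False using c by simp
qed

lemma ne_two_cliques:
  assumes fin: "finite S" "finite T"
    and adj: "\<And>x y. x \<in> S \<union> T \<Longrightarrow> y \<in> S \<union> T \<Longrightarrow> adj x y \<longleftrightarrow> x \<noteq> y \<and> (x \<in> S \<and> y \<in> S \<or> x \<in> T \<and> y \<in> T)"
  shows "2 * ne (S \<union> T) = card S * (card S - 1) + card (T - S) * (card (T - S) - 1) + 2 * card (S \<inter> T) * card (T - S)"
proof -
  have "ne (S \<union> T) = ne S + ne (T - S) + (\<Sum>t\<in>T - S. dg t S)"
    using ne_Un[of S "T - S"] fin by auto
  moreover have "2 * ne S = card S * (card S - 1)" "2 * ne (T - S) = card (T - S) * (card (T - S) - 1)"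
    by (intro ne_clique; use fin adj in \<open>auto simp: clique_def\<close>)+
  moreover have "dg t S = card (S \<inter> T)" if "t \<in> T - S" for t
  proof -
    have "{y \<in> S. adj t y} = S \<inter> T" using adj that by auto
    then show ?thesis by (simp add: dg_def)
  qed
  ultimately show ?thesis by simp
qed

end

section \<open>Sets inducing no path on four vertices\<close>

text \<open>Adjacency inside the part \<open>X\<close> of \<open>graph_F n i j\<close>; for \<open>j = 0\<close> there is no star, as in \<open>graph_H\<close>.\<close>

definition star_triangles :: "nat \<Rightarrow> nat \<Rightarrow> nat \<Rightarrow> bool" where
  "star_triangles j a b \<longleftrightarrow> a \<noteq> b \<and>
    (a < j \<and> b < j \<and> (a = 0 \<or> b = 0) \<or> j \<le> a \<and> j \<le> b \<and> (a - j) div 3 = (b - j) div 3)"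

text \<open>After complete blocks of three, the indices from \<open>n\<close> to
  \<open>n + 2\<close> form a fresh triangle isolated from all smaller indices.\<close>

lemma star_triangles_append:
  assumes "j \<le> n" "3 dvd (n - j)" "n \<le> b"
  shows "a < n \<Longrightarrow> \<not> star_triangles j a b" and "b < n + 3 \<Longrightarrow> n \<le> a \<Longrightarrow> a < n + 3 \<Longrightarrow> star_triangles j a b \<longleftrightarrow> a \<noteq> b"
proof -
  obtain q where q: "n = j + 3 * q" using assms(1,2) by (metis dvdE le_add_diff_inverse)
  show "\<not> star_triangles j a b" if "a < n"
  proof -
    have "(a - j) div 3 < q" if "j \<le> a" using that \<open>a < n\<close> q by (intro less_mult_imp_div_less) auto
    moreover have "q \<le> (b - j) div 3" using assms(3) q by auto
    ultimately show ?thesis using assms by (auto simp: star_triangles_def)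
  qed
  show "star_triangles j a b \<longleftrightarrow> a \<noteq> b" if ab: "b < n + 3" "n \<le> a" "a < n + 3"
  proof -
    have "(x - j) div 3 = q" if "n \<le> x" "x < n + 3" for x
      using that q by (intro div_nat_eqI) auto
    then show ?thesis using assms ab by (auto simp: star_triangles_def)
  qed
qed

lemma star_triangles_commute: "star_triangles j a b \<longleftrightarrow> star_triangles j b a"
  unfolding star_triangles_def by auto

context sgraph
begin

lemma bij_betw_extend:
  assumes "bij_betw h {0..<n} W" "x \<notin> W"
  shows "bij_betw (h(n := x)) {0..<Suc n} (insert x W)"
proof -
  have "bij_betw (h(n := x)) {0..<n} W" using assms(1) by (subst bij_betw_cong[where g = h]) auto
  then have "bij_betw (h(n := x)) ({0..<n} \<union> {n}) (W \<union> {x})"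
    using assms(2) by (intro bij_betw_combine) (auto simp: bij_betw_def)
  moreover have "{0..<n} \<union> {n} = {0..<Suc n}" by auto
  ultimately show ?thesis by simp
qed

text \<open>A triangle is a whole component and has as many edges as vertices; each star component
  has one edge fewer. Losing at most one edge thus means at most one star, which \<open>h\<close>
  enumerates first, followed by the triangles.\<close>

lemma noP4_structure:
  assumes "finite X" "noP4 X"
  shows "ne X \<le> card X"
    and "ne X + 1 \<ge> card X \<Longrightarrow> \<exists>j h. j \<le> card X \<and> 3 dvd (card X - j) \<and> (j = 0 \<longleftrightarrow> ne X = card X) \<and>
      bij_betw h {0..<card X} X \<and> (\<forall>a<card X. \<forall>b<card X. adj (h a) (h b) \<longleftrightarrow> star_triangles j a b)"
proof -
  have "ne X \<le> card X \<and> (ne X + 1 \<ge> card X \<longrightarrow>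
    (\<exists>j h. j \<le> card X \<and> 3 dvd (card X - j) \<and> (j = 0 \<longleftrightarrow> ne X = card X) \<and>
      bij_betw h {0..<card X} X \<and> (\<forall>a<card X. \<forall>b<card X. adj (h a) (h b) \<longleftrightarrow> star_triangles j a b)))"
    using assms
  proof (induction "card X" arbitrary: X rule: less_induct)
    case less
    note fin = less.prems(1) and P4 = less.prems(2)
    consider "X = {}" | (star) "X \<noteq> {}" "triangle_free X" | (tri) "\<not> triangle_free X" by blast
    then show ?case
    proof cases
      case 1
      then show ?thesis by (auto simp: bij_betw_def)
    next
      case star
      have *: "ne X + 1 \<le> card X"
        and **: "ne X + 1 = card X \<Longrightarrow> \<exists>c\<in>X. \<forall>x\<in>X. \<forall>y\<in>X. adj x y \<longleftrightarrow> x \<noteq> y \<and> (x = c \<or> y = c)"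
        using triangle_free_noP4_star[OF fin P4 star] by blast+
      show ?thesis
      proof (intro conjI impI)
        show "ne X \<le> card X" using * by simp
        assume "ne X + 1 \<ge> card X"
        then obtain c where c: "c \<in> X" "\<And>x y. x \<in> X \<Longrightarrow> y \<in> X \<Longrightarrow> adj x y \<longleftrightarrow> x \<noteq> y \<and> (x = c \<or> y = c)"
          using * ** by auto
        have k: "0 < card X" using c(1) fin card_gt_0_iff by blast
        have "card {1..<card X} = card (X - {c})" using c(1) by simp
        then obtain g where g: "bij_betw g {1..<card X} (X - {c})"
          using finite_same_card_bij[of "{1..<card X}" "X - {c}"] fin by auto
        \<comment> \<open>Index 0 is the star centre in \<open>star_triangles\<close>; the leaves
          may be listed in any order.\<close>
        define h where "h = g(0 := c)"
        have "bij_betw h {1..<card X} (X - {c})"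
          using g unfolding h_def by (subst bij_betw_cong[where g = g]) auto
        then have "bij_betw h ({0} \<union> {1..<card X}) ({c} \<union> (X - {c}))"
          by (intro bij_betw_combine) (auto simp: h_def bij_betw_def)
        moreover have "{0} \<union> {1..<card X} = {0..<card X}" "{c} \<union> (X - {c}) = X" using k c(1) by auto
        ultimately have h: "bij_betw h {0..<card X} X" by simp
        have "h 0 = c" by (simp add: h_def)
        have inj: "h a = h b \<longleftrightarrow> a = b" if "a < card X" "b < card X" for a b
          using h that by (auto simp: bij_betw_def inj_on_def)
        have hX: "h a \<in> X" if "a < card X" for a using h that by (auto simp: bij_betw_def)
        have "adj (h a) (h b) \<longleftrightarrow> star_triangles (card X) a b" if "a < card X" "b < card X" for a b
        proof -
          have "h a = c \<longleftrightarrow> a = 0" "h b = c \<longleftrightarrow> b = 0" using inj[of a 0] inj[of b 0] that k \<open>h 0 = c\<close> by auto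
          then show ?thesis using c(2)[OF hX hX] that inj[OF that] by (auto simp: star_triangles_def)
        qed
        then show "\<exists>j h. j \<le> card X \<and> 3 dvd (card X - j) \<and> (j = 0 \<longleftrightarrow> ne X = card X) \<and>
            bij_betw h {0..<card X} X \<and> (\<forall>a<card X. \<forall>b<card X. adj (h a) (h b) \<longleftrightarrow> star_triangles j a b)"
          using h * k by (intro exI[of _ "card X"] exI[of _ h]) auto
      qed
    next
      case tri
      then obtain a b c where abc: "a \<in> X" "b \<in> X" "c \<in> X" "adj a b" "adj b c" "adj a c"
        unfolding triangle_free_def by blast
      define W where "W = X - {a, b, c}"
      have d: "a \<noteq> b" "b \<noteq> c" "a \<noteq> c" using abc adj_neq by blast+
      have finW: "finite W" and WX: "W \<subseteq> X" and nW: "a \<notin> W" "b \<notin> W" "c \<notin> W" using fin W_def by auto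
      have X: "X = insert c (insert b (insert a W))" using abc W_def by auto
      have cX: "card X = card W + 3" unfolding X using finW nW d by simp
      \<comment> \<open>A further neighbour of a triangle vertex would start a path through the
        whole triangle.\<close>
      have no: "\<not> adj x t" "\<not> adj t x" if x: "x \<in> W" and t: "t \<in> {a, b, c}" for x t
      proof -
        have "\<not> adj x a" "\<not> adj x b" "\<not> adj x c"
          using noP4D[OF P4, of x a b c] noP4D[OF P4, of x b a c] noP4D[OF P4, of x c b a] x WX abc d nW sym
          by blast+
        then show "\<not> adj x t" "\<not> adj t x" using t sym by blast+
      qed
      have tri_adj: "adj p q \<longleftrightarrow> p \<noteq> q" if "p \<in> {a, b, c}" "q \<in> {a, b, c}" for p q
        using that abc(4-6) abc(4-6)[THEN sym] irr by auto
      have "dg a W = 0" "dg b W = 0" "dg c W = 0" using no by (auto intro!: dg_eq_0I)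
      then have neX: "ne X = ne W + 3"
        unfolding X using finW nW d abc sym by (simp add: ne_insert dg_insert)
      have IH: "ne W \<le> card W" "ne W + 1 \<ge> card W \<Longrightarrow>
          \<exists>j h. j \<le> card W \<and> 3 dvd (card W - j) \<and> (j = 0 \<longleftrightarrow> ne W = card W) \<and>
          bij_betw h {0..<card W} W \<and> (\<forall>a<card W. \<forall>b<card W. adj (h a) (h b) \<longleftrightarrow> star_triangles j a b)"
        using less.hyps[of W] cX finW noP4_subset[OF P4 WX] by auto
      show ?thesis
      proof (intro conjI impI)
        show "ne X \<le> card X" using IH neX cX by simp
        assume "ne X + 1 \<ge> card X"
        then have "ne W + 1 \<ge> card W" using neX cX by simp
        then obtain j h where j: "j \<le> card W" "3 dvd (card W - j)" "j = 0 \<longleftrightarrow> ne W = card W"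
          and h: "bij_betw h {0..<card W} W" "\<And>x y. x < card W \<Longrightarrow> y < card W \<Longrightarrow> adj (h x) (h y) \<longleftrightarrow> star_triangles j x y"
          using IH(2) by blast
        define n where "n = card W"
        define h' where "h' = h(n := a, Suc n := b, Suc (Suc n) := c)"
        have "bij_betw h' {0..<Suc (Suc (Suc n))} X"
          unfolding h'_def X using h(1) nW d by (intro bij_betw_extend) (auto simp: n_def)
        then have bij: "bij_betw h' {0..<card X} X" using cX by (simp add: n_def eval_nat_numeral)
        have low: "h' x = h x" "h' x \<in> W" if "x < n" for x
          using that h(1) by (auto simp: h'_def n_def bij_betw_def)
        have high: "h' x \<in> {a, b, c}" if "n \<le> x" "x < n + 3" for x
        proof -
          have "x = n \<or> x = Suc n \<or> x = Suc (Suc n)" using that by linarith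
          then show ?thesis by (auto simp: h'_def)
        qed
        have inj: "h' x = h' y \<longleftrightarrow> x = y" if "x < card X" "y < card X" for x y
          using bij that by (auto simp: bij_betw_def inj_on_def)
        have "adj (h' x) (h' y) \<longleftrightarrow> star_triangles j x y" if xy: "x < card X" "y < card X" for x y
        proof -
          have j': "j \<le> n" "3 dvd (n - j)" using j n_def by auto
          have xy': "x < n + 3" "y < n + 3" using xy cX n_def by auto
          consider "x < n" "y < n" | "x < n" "n \<le> y" | "n \<le> x" "y < n" | "n \<le> x" "n \<le> y" by linarith
          then show ?thesis
          proof cases
            case 1
            then show ?thesis using h(2) low n_def by simp
          next
            case 2
            show ?thesis
              using star_triangles_append(1)[OF j' 2(2,1)] no(1)[OF low(2)[OF 2(1)] high[OF 2(2) xy'(2)]] by simp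
          next
            case 3
            show ?thesis
              using star_triangles_append(1)[OF j' 3(1,2)] star_triangles_commute[of j x y]
                no(2)[OF low(2)[OF 3(2)] high[OF 3(1) xy'(1)]] by simp
          next
            case 4
            have "adj (h' x) (h' y) \<longleftrightarrow> h' x \<noteq> h' y"
              using tri_adj high[OF 4(1) xy'(1)] high[OF 4(2) xy'(2)] by blast
            then show ?thesis using star_triangles_append(2)[OF j' 4(2) xy'(2) 4(1) xy'(1)] inj[OF xy] by blast
          qed
        qed
        moreover have "j \<le> card X" "3 dvd (card X - j)" "j = 0 \<longleftrightarrow> ne X = card X"
          using j cX neX dvd_add[OF j(2) dvd_refl] by (simp_all add: Nat.add_diff_assoc2)
        ultimately show "\<exists>j h. j \<le> card X \<and> 3 dvd (card X - j) \<and> (j = 0 \<longleftrightarrow> ne X = card X) \<and>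
            bij_betw h {0..<card X} X \<and> (\<forall>a<card X. \<forall>b<card X. adj (h a) (h b) \<longleftrightarrow> star_triangles j a b)"
          using bij by blast
      qed
    qed
  qed
  then show "ne X \<le> card X"
    and "ne X + 1 \<ge> card X \<Longrightarrow> \<exists>j h. j \<le> card X \<and> 3 dvd (card X - j) \<and> (j = 0 \<longleftrightarrow> ne X = card X) \<and>
      bij_betw h {0..<card X} X \<and> (\<forall>a<card X. \<forall>b<card X. adj (h a) (h b) \<longleftrightarrow> star_triangles j a b)"
    by blast+
qed

end

section \<open>The optimal sizes of the dense part\<close>

text \<open>The number of edges of \<open>graph_H n i\<close> or \<open>graph_F n i j\<close>, according to whether three divides \<open>i\<close>.\<close>

definition part_size :: "nat \<Rightarrow> nat \<Rightarrow> nat" where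
  "part_size n i = i * (n - i) + i - (if 3 dvd i then 0 else 1)"

text \<open>The equation \<open>p + 4 * c = d^2 + 4 * e\<close> of \<open>part_size_exn\<close> in
  terms of the residues \<open>r = n mod 6\<close> and \<open>t = i mod 3\<close>, with
  \<open>z\<close> the difference of the quotients \<open>k\<close> and \<open>q\<close>; this
  leaves 54 cases.\<close>

lemma part_size_table:
  fixes z :: int and q k r t :: nat
  assumes "z = 1 \<and> k = q + 1 \<or> z = 0 \<and> k = q \<or> z = -1 \<and> q = k + 1"
    and "r = 0 \<or> r = 1 \<or> r = 2 \<or> r = 3 \<or> r = 4 \<or> r = 5" and "t = 0 \<or> t = 1 \<or> t = 2"
  shows "(if even r then 1 else 0) + 4 * (if r = 1 \<or> r = 2 \<or> r = 3 then 1 else 0) =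
      (6 * z + int r + 1 - 2 * int t)\<^sup>2 + 4 * (if t = 0 then 0 else 1) \<longleftrightarrow>
      r = 0 \<and> 3 * q + t = 3 * k + r div 2 \<or>
      r = 1 \<and> (3 * q + t = 3 * k + (r + 1) div 2 \<or> 3 * q + t = 3 * k + r div 2) \<or>
      r = 2 \<and> (3 * q + t = 3 * k + r div 2 \<or> 3 * q + t = 3 * k + r div 2 + 1) \<or>
      r = 3 \<and> (3 * q + t = 3 * k + (r + 1) div 2 \<or> 3 * q + t = 3 * k + (r + 1) div 2 + 1) \<or>
      r = 4 \<and> 3 * q + t = 3 * k + r div 2 + 1 \<or>
      r = 5 \<and> 3 * q + t = 3 * k + (r + 1) div 2"
  using assms by (elim disjE conjE) simp_all

text \<open>Completing the square gives \<open>4 * (i * (n - i) + i) = (n + 1)^2 - d^2\<close> for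
  \<open>d = n + 1 - 2 * i\<close>. After the parity term and the corrections modulo 3 and 6 are
  included, the size bound reads \<open>p + 4 * c \<le> d^2 + 4 * e\<close>, whose left side is at
  most 5.\<close>

lemma part_size_exn:
  assumes "i \<le> n"
  shows "part_size n i \<le> exn n"
    and "part_size n i = exn n \<longleftrightarrow>
      n mod 6 = 0 \<and> i = n div 2 \<or>
      n mod 6 = 1 \<and> (i = (n + 1) div 2 \<or> i = n div 2) \<or>
      n mod 6 = 2 \<and> (i = n div 2 \<or> i = n div 2 + 1) \<or>
      n mod 6 = 3 \<and> (i = (n + 1) div 2 \<or> i = (n + 1) div 2 + 1) \<or>
      n mod 6 = 4 \<and> i = n div 2 + 1 \<or>
      n mod 6 = 5 \<and> i = (n + 1) div 2"
proof -
  define d where "d = int n + 1 - 2 * int i"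
  define e :: int where "e = (if 3 dvd i then 0 else 1)"
  define p :: int where "p = (if even n then 1 else 0)"
  define c :: int where "c = (if n mod 6 \<in> {1, 2, 3} then 1 else 0)"
  obtain m where m: "n = i + m" using assms by (metis le_add_diff_inverse)
  have "int (part_size n i) = int i * (int m + 1) - e"
    unfolding part_size_def e_def m by (cases i) (auto simp: algebra_simps)
  moreover have "4 * (int i * (int m + 1)) = (int n + 1)\<^sup>2 - d\<^sup>2"
    unfolding d_def m by (simp add: power2_eq_square algebra_simps)
  ultimately have size: "4 * int (part_size n i) = (int n + 1)\<^sup>2 - d\<^sup>2 - 4 * e" by simp
  have sq: "4 * int ((n + 1)\<^sup>2 div 4) = (int n + 1)\<^sup>2 - p"
  proof (cases "even n")
    case True
    then obtain k where k: "n = 2 * k" by blast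
    then have "(n + 1)\<^sup>2 = 4 * (k * k + k) + 1" by (simp add: power2_eq_square algebra_simps)
    moreover have "(4 * x + 1) div 4 = x" for x :: nat by presburger
    ultimately have "(n + 1)\<^sup>2 div 4 = k * k + k" by presburger
    then show ?thesis using True k by (simp add: p_def power2_eq_square algebra_simps)
  next
    case False
    then obtain k where k: "n = 2 * k + 1" by (metis oddE)
    then have "(n + 1)\<^sup>2 = 4 * ((k + 1) * (k + 1))" by (simp add: power2_eq_square algebra_simps)
    then have "(n + 1)\<^sup>2 div 4 = (k + 1) * (k + 1)" by simp
    then show ?thesis using False k by (simp add: p_def power2_eq_square algebra_simps)
  qed
  have exn: "4 * int (exn n) = (int n + 1)\<^sup>2 - p - 4 * c"
  proof (cases "n mod 6 \<in> {1, 2, 3}")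
    case True
    then have "n \<ge> 1" by (cases n) auto
    then have "(n + 1)\<^sup>2 \<ge> 2\<^sup>2" by (intro power_mono) auto
    then have "(n + 1)\<^sup>2 div 4 \<ge> 1" by simp
    moreover have "exn n = (n + 1)\<^sup>2 div 4 - 1" "c = 1" using True by (auto simp: exn_def c_def)
    ultimately show ?thesis using sq by linarith
  next
    case False
    then have "exn n = (n + 1)\<^sup>2 div 4" "c = 0" by (simp_all add: exn_def c_def)
    then show ?thesis using sq by simp
  qed
  have big: "d\<^sup>2 \<ge> 9" if "d \<noteq> 0" "d \<noteq> 1" "d \<noteq> -1" "d \<noteq> 2" "d \<noteq> -2"
  proof -
    have "\<bar>d\<bar> \<ge> 3" using that by linarith
    then have "\<bar>d\<bar>\<^sup>2 \<ge> 3\<^sup>2" by (intro power_mono) auto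
    then show ?thesis by simp
  qed
  have ec: "0 \<le> e" "p + 4 * c \<le> 5" by (auto simp: e_def p_def c_def)
  have le: "part_size n i \<le> exn n \<longleftrightarrow> p + 4 * c \<le> d\<^sup>2 + 4 * e"
    and eq: "part_size n i = exn n \<longleftrightarrow> p + 4 * c = d\<^sup>2 + 4 * e"
    using size exn by linarith+
  define k r q t where "k = n div 6" and "r = n mod 6" and "q = i div 3" and "t = i mod 3"
  have n: "n = 6 * k + r" and i: "i = 3 * q + t" by (simp_all add: k_def r_def q_def t_def)
  have "r < 6" "t < 3" by (simp_all add: r_def t_def)
  then have r: "r = 0 \<or> r = 1 \<or> r = 2 \<or> r = 3 \<or> r = 4 \<or> r = 5" and t: "t = 0 \<or> t = 1 \<or> t = 2"
    by linarith+
  have e': "e = (if t = 0 then 0 else 1)" by (simp add: e_def t_def dvd_eq_mod_eq_0)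
  have c': "c = (if r = 1 \<or> r = 2 \<or> r = 3 then 1 else 0)" by (simp add: c_def r_def)
  have p': "p = (if even r then 1 else 0)" by (simp add: p_def n)
  have d': "d = 6 * (int k - int q) + int r + 1 - 2 * int t" by (simp add: d_def n i)
  define z where "z = int k - int q"
  have z: "z \<le> -2 \<or> z = -1 \<or> z = 0 \<or> z = 1 \<or> z \<ge> 2" by linarith
  \<comment> \<open>Since \<open>d = 6 * z + r + 1 - 2 * t\<close>, a value of \<open>z\<close>
    outside -1, 0, 1 makes the absolute value of \<open>d\<close> at least 6.\<close>
  have far: "d\<^sup>2 \<ge> 9" if "z \<le> -2 \<or> z \<ge> 2" using that r t by (intro big) (auto simp: d' z_def)
  show "part_size n i \<le> exn n"
    unfolding le
  proof (cases "z \<le> -2 \<or> z \<ge> 2")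
    case True
    then show "p + 4 * c \<le> d\<^sup>2 + 4 * e" using far ec by linarith
  next
    case False
    then show "p + 4 * c \<le> d\<^sup>2 + 4 * e"
      using z r t unfolding e' c' p' d' z_def[symmetric] by (elim disjE) simp_all
  qed
  have half: "n div 2 = 3 * k + r div 2" "(n + 1) div 2 = 3 * k + (r + 1) div 2" unfolding n by presburger+
  show "part_size n i = exn n \<longleftrightarrow>
      n mod 6 = 0 \<and> i = n div 2 \<or>
      n mod 6 = 1 \<and> (i = (n + 1) div 2 \<or> i = n div 2) \<or>
      n mod 6 = 2 \<and> (i = n div 2 \<or> i = n div 2 + 1) \<or>
      n mod 6 = 3 \<and> (i = (n + 1) div 2 \<or> i = (n + 1) div 2 + 1) \<or>
      n mod 6 = 4 \<and> i = n div 2 + 1 \<or>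
      n mod 6 = 5 \<and> i = (n + 1) div 2"
  proof (cases "z \<le> -2 \<or> z \<ge> 2")
    case True
    then have "p + 4 * c \<noteq> d\<^sup>2 + 4 * e" using far ec by linarith
    moreover have b: "i + 4 \<le> 3 * k \<or> 3 * k + 6 \<le> i" using True z_def i t by linarith
    have "r div 2 \<le> 2" "(r + 1) div 2 \<le> 3" using r by auto
    then have "i \<noteq> n div 2" "i \<noteq> n div 2 + 1" "i \<noteq> (n + 1) div 2" "i \<noteq> (n + 1) div 2 + 1"
      using half b by linarith+
    ultimately show ?thesis unfolding eq by blast
  next
    case False
    then have "z = 1 \<and> k = q + 1 \<or> z = 0 \<and> k = q \<or> z = -1 \<and> q = k + 1" using z_def by linarith
    from part_size_table[OF this r t] show ?thesis
      unfolding eq half r_def[symmetric] e' c' p' d' z_def[symmetric] i[symmetric] .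
  qed
qed

section \<open>Translation to the concrete graphs\<close>

definition gadj :: "'a ugraph \<Rightarrow> 'a \<Rightarrow> 'a \<Rightarrow> bool" where
  "gadj G x y \<longleftrightarrow> {x, y} \<in> edges G"

lemma gadj_sgraph: "simple_graph G \<Longrightarrow> sgraph (gadj G)"
  unfolding simple_graph_def gadj_def by unfold_locales (force simp: insert_commute)+

lemma gadj_verts: "simple_graph G \<Longrightarrow> gadj G x y \<Longrightarrow> x \<in> verts G \<and> y \<in> verts G"
  unfolding simple_graph_def gadj_def by blast

lemma edges_eq_gadj:
  assumes "simple_graph G"
  shows "edges G = {{x, y} | x y. x \<in> verts G \<and> y \<in> verts G \<and> gadj G x y}" (is "_ = ?E")
proof
  show "edges G \<subseteq> ?E"
  proof
    fix e assume e: "e \<in> edges G"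
    then have "card e = 2" "e \<subseteq> verts G" using assms by (auto simp: simple_graph_def)
    then obtain x y where "e = {x, y}" by (meson card_2_iff)
    then show "e \<in> ?E" using e \<open>e \<subseteq> verts G\<close> by (auto simp: gadj_def)
  qed
qed (auto simp: gadj_def)

lemma card_edges: "simple_graph G \<Longrightarrow> card (edges G) = sgraph.ne (gadj G) (verts G)"
  using arg_cong[OF edges_eq_gadj, of G card] by (simp only: sgraph.ne_def[OF gadj_sgraph])

lemma graph_iso_gadj:
  "G \<simeq> H \<longleftrightarrow> (\<exists>f. bij_betw f (verts G) (verts H) \<and>
    (\<forall>u\<in>verts G. \<forall>v\<in>verts G. gadj G u v \<longleftrightarrow> gadj H (f u) (f v)))"
  by (simp add: graph_iso_def gadj_def)

lemma graph_iso_sym: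
  assumes "G \<simeq> H"
  shows "H \<simeq> G"
proof -
  obtain f where f: "bij_betw f (verts G) (verts H)"
    "\<And>u v. u \<in> verts G \<Longrightarrow> v \<in> verts G \<Longrightarrow> gadj G u v \<longleftrightarrow> gadj H (f u) (f v)"
    using assms unfolding graph_iso_gadj by blast
  let ?g = "inv_into (verts G) f"
  have g: "bij_betw ?g (verts H) (verts G)" by (rule bij_betw_inv_into[OF f(1)])
  have "?g u \<in> verts G" "f (?g u) = u" if "u \<in> verts H" for u
    using that g bij_betw_inv_into_right[OF f(1)] by (auto simp: bij_betw_def)
  then have "gadj H u v \<longleftrightarrow> gadj G (?g u) (?g v)" if "u \<in> verts H" "v \<in> verts H" for u v
    using f(2)[of "?g u" "?g v"] that by simp
  then show ?thesis unfolding graph_iso_gadj using g by blast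
qed

text \<open>Moves a concrete graph into another vertex type: used to embed the prism in
  \<open>G\<close> and to build a competitor on the vertices of \<open>G\<close>.\<close>

lemma graph_iso_image:
  assumes inj: "inj_on f (verts H)" and H: "simple_graph H"
  shows "simple_graph (f ` verts H, image f ` edges H)" and "H \<simeq> (f ` verts H, image f ` edges H)"
proof -
  have sub: "e \<subseteq> verts H" "card e = 2" if "e \<in> edges H" for e using H that by (auto simp: simple_graph_def)
  have "card (f ` e) = 2" if "e \<in> edges H" for e
    using sub[OF that] card_image[of f e] inj_on_subset[OF inj] by simp
  then show "simple_graph (f ` verts H, image f ` edges H)"
    using H sub by (fastforce simp: simple_graph_def)
  have "{u, v} \<in> edges H \<longleftrightarrow> {f u, f v} \<in> image f ` edges H" if uv: "u \<in> verts H" "v \<in> verts H" for u v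
  proof
    assume "{u, v} \<in> edges H"
    then have "f ` {u, v} \<in> image f ` edges H" by (rule imageI)
    then show "{f u, f v} \<in> image f ` edges H" by simp
  next
    assume "{f u, f v} \<in> image f ` edges H"
    then obtain e where e: "e \<in> edges H" "f ` {u, v} = f ` e" by auto
    have "{u, v} \<subseteq> verts H" using uv by simp
    then have "{u, v} = e" using inj_on_image_eq_iff[OF inj _ sub(1)[OF e(1)]] e(2) by blast
    then show "{u, v} \<in> edges H" using e(1) by simp
  qed
  then show "H \<simeq> (f ` verts H, image f ` edges H)"
    unfolding graph_iso_def using inj by (intro exI[of _ f]) (auto simp: bij_betw_def)
qed

lemma graph_iso_card_edges:
  assumes G: "simple_graph G" and H: "simple_graph H" and iso: "G \<simeq> H"
  shows "card (edges G) = card (edges H)"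
proof -
  obtain f where f: "bij_betw f (verts G) (verts H)"
    "\<And>u v. u \<in> verts G \<Longrightarrow> v \<in> verts G \<Longrightarrow> gadj G u v \<longleftrightarrow> gadj H (f u) (f v)"
    using iso unfolding graph_iso_gadj by blast
  have "edges H = image f ` edges G"
  proof
    show "edges H \<subseteq> image f ` edges G"
    proof
      fix e assume "e \<in> edges H"
      then obtain x y where e: "e = {x, y}" "x \<in> verts H" "y \<in> verts H" "gadj H x y"
        using edges_eq_gadj[OF H] by auto
      then obtain u v where uv: "u \<in> verts G" "v \<in> verts G" "x = f u" "y = f v"
        using f(1) unfolding bij_betw_def by blast
      then have "{u, v} \<in> edges G" using f(2) e(4) by (simp add: gadj_def)
      then have "f ` {u, v} \<in> image f ` edges G" by (rule imageI)
      then show "e \<in> image f ` edges G" using e uv by simp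
    qed
    show "image f ` edges G \<subseteq> edges H"
    proof
      fix e assume "e \<in> image f ` edges G"
      then obtain x y where "e = f ` {x, y}" "x \<in> verts G" "y \<in> verts G" "gadj G x y"
        using edges_eq_gadj[OF G] by auto
      then show "e \<in> edges H" using f(2)[of x y] by (simp add: gadj_def)
    qed
  qed
  moreover have "inj_on (image f) (edges G)"
  proof (rule inj_on_subset)
    show "inj_on (image f) (Pow (verts G))" using f(1) by (intro inj_on_image_Pow) (simp add: bij_betw_def)
    show "edges G \<subseteq> Pow (verts G)" using G by (auto simp: simple_graph_def)
  qed
  ultimately show ?thesis by (simp add: card_image)
qed

lemma graph_iso_card_verts: "G \<simeq> H \<Longrightarrow> card (verts G) = card (verts H)"
  unfolding graph_iso_def by (auto dest: bij_betw_same_card)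

lemma doubleton_in_clique_edges: "{a, b} \<in> clique_edges S \<longleftrightarrow> a \<in> S \<and> b \<in> S \<and> a \<noteq> b"
  unfolding clique_edges_def by (auto simp: doubleton_eq_iff)

lemma prism_edges:
  "gadj prism a b \<longleftrightarrow> a \<noteq> b \<and> (a \<in> {1, 2, 3} \<and> b \<in> {1, 2, 3} \<or> a \<in> {4, 5, 6} \<and> b \<in> {4, 5, 6}) \<or>
    {a, b} = {1, 4} \<or> {a, b} = {2, 5} \<or> {a, b} = {3, 6}"
  unfolding gadj_def prism_def snd_conv Un_iff doubleton_in_clique_edges insert_iff empty_iff by argo

lemma simple_graph_prism: "simple_graph prism"
  unfolding simple_graph_def
proof (intro conjI ballI)
  fix e assume "e \<in> edges prism"
  then have "e \<in> clique_edges {1, 2, 3} \<or> e \<in> clique_edges {4, 5, 6} \<or> e \<in> {{1, 4}, {2, 5}, {3, 6}}"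
    by (auto simp: prism_def)
  then show "e \<subseteq> verts prism" "card e = 2"
    by (auto simp: prism_def clique_edges_def)
qed (simp add: prism_def)

lemma prism_free_imp_no_copy:
  assumes pf: "prism_free (gadj G)"
  shows "\<not> contains_copy G prism"
proof
  assume "contains_copy G prism"
  then obtain K where K: "subgraph K G" "K \<simeq> prism" by (auto simp: contains_copy_def)
  obtain f where f: "bij_betw f (verts prism) (verts K)"
    "\<And>u v. u \<in> verts prism \<Longrightarrow> v \<in> verts prism \<Longrightarrow> gadj prism u v \<longleftrightarrow> gadj K (f u) (f v)"
    using graph_iso_sym[OF K(2)] unfolding graph_iso_gadj by blast
  have v: "verts prism = {1..6}" by (simp add: prism_def)
  have e: "gadj G (f u) (f v)" if "gadj prism u v" "u \<in> {1..6}" "v \<in> {1..6}" for u v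
    using f(2)[of u v] that K(1) v by (auto simp: subgraph_def gadj_def)
  have n: "f u \<noteq> f v" if "u \<noteq> v" "u \<in> {1..6}" "v \<in> {1..6}" for u v
    using f(1) that v by (auto simp: bij_betw_def inj_on_def)
  show False
    by (rule prism_free.free[OF pf, of "f 1" "f 2" "f 3" "f 4" "f 5" "f 6"])
      (intro e n; simp add: prism_edges)+
qed

lemma no_copy_imp_prism_free:
  assumes G: "simple_graph G" and no: "\<not> contains_copy G prism"
  shows "prism_free (gadj G)"
proof -
  interpret sgraph "gadj G" by (rule gadj_sgraph[OF G])
  show ?thesis
  proof unfold_locales
    fix u1 u2 u3 w1 w2 w3
    assume e: "gadj G u1 u2" "gadj G u1 u3" "gadj G u2 u3" "gadj G w1 w2" "gadj G w1 w3" "gadj G w2 w3"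
      "gadj G u1 w1" "gadj G u2 w2" "gadj G u3 w3"
      and d: "u1 \<noteq> w2" "u1 \<noteq> w3" "u2 \<noteq> w1" "u2 \<noteq> w3" "u3 \<noteq> w1" "u3 \<noteq> w2"
    define f where "f = (\<lambda>k::nat. if k = 1 then u1 else if k = 2 then u2 else if k = 3 then u3
      else if k = 4 then w1 else if k = 5 then w2 else w3)"
    have v: "verts prism = {1, 2, 3, 4, 5, 6}" by (auto simp: prism_def)
    note ne = e[THEN adj_neq]
    have "inj_on f (verts prism)"
      unfolding v f_def inj_on_def using ne d by auto
    note iso = graph_iso_image[OF this simple_graph_prism]
    have "f ` verts prism \<subseteq> verts G" unfolding v f_def using e[THEN gadj_verts[OF G]] by auto
    moreover have "image f ` edges prism \<subseteq> edges G"
    proof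
      fix x assume "x \<in> image f ` edges prism"
      then obtain a b where ab: "x = f ` {a, b}" "gadj prism a b"
        using edges_eq_gadj[OF simple_graph_prism] by auto
      have "gadj G (f a) (f b)"
        using ab(2) e e[THEN sym] unfolding prism_edges doubleton_eq_iff
        by (elim disjE conjE) (auto simp: f_def)
      then show "x \<in> edges G" using ab by (simp add: gadj_def)
    qed
    ultimately have "subgraph (f ` verts prism, image f ` edges prism) G"
      using iso(1) by (simp add: subgraph_def)
    then show False using no graph_iso_sym[OF iso(2)] by (auto simp: contains_copy_def)
  qed
qed

lemma graph_iso_prism_free:
  assumes G: "simple_graph G" and iso: "G \<simeq> H" and pf: "prism_free (gadj H)"
  shows "prism_free (gadj G)"
proof -
  interpret sgraph "gadj G" by (rule gadj_sgraph[OF G])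
  obtain f where f: "bij_betw f (verts G) (verts H)"
    "\<And>u v. u \<in> verts G \<Longrightarrow> v \<in> verts G \<Longrightarrow> gadj G u v \<longleftrightarrow> gadj H (f u) (f v)"
    using iso unfolding graph_iso_gadj by blast
  have e: "gadj H (f u) (f v)" if "gadj G u v" for u v using f(2) gadj_verts[OF G that] that by blast
  have n: "f u \<noteq> f v" if "u \<noteq> v" "u \<in> verts G" "v \<in> verts G" for u v
    using f(1) that by (auto simp: bij_betw_def inj_on_def)
  show ?thesis
  proof unfold_locales
    fix u1 u2 u3 w1 w2 w3
    assume a: "gadj G u1 u2" "gadj G u1 u3" "gadj G u2 u3" "gadj G w1 w2" "gadj G w1 w3" "gadj G w2 w3"
      "gadj G u1 w1" "gadj G u2 w2" "gadj G u3 w3"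
      and d: "u1 \<noteq> w2" "u1 \<noteq> w3" "u2 \<noteq> w1" "u2 \<noteq> w3" "u3 \<noteq> w1" "u3 \<noteq> w2"
    have v: "u1 \<in> verts G" "u2 \<in> verts G" "u3 \<in> verts G" "w1 \<in> verts G" "w2 \<in> verts G" "w3 \<in> verts G"
      using a[THEN gadj_verts[OF G]] by auto
    show False
      by (rule prism_free.free[OF pf, of "f u1" "f u2" "f u3" "f w1" "f w2" "f w3"])
        (intro e n a d v)+
  qed
qed

section \<open>Adjacency and edge numbers of the families H and F\<close>

lemma doubleton_in_bipartite_edges:
  "{a, b} \<in> bipartite_edges X Y \<longleftrightarrow> a \<in> X \<and> b \<in> Y \<or> b \<in> X \<and> a \<in> Y"
  unfolding bipartite_edges_def by (auto simp: doubleton_eq_iff)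

lemma doubleton_in_star_edges:
  "{a, b} \<in> star_edges c S \<longleftrightarrow> a \<noteq> b \<and> (a = c \<and> b \<in> S \<or> b = c \<and> a \<in> S)"
  unfolding star_edges_def by (auto simp: doubleton_eq_iff)

lemma doubleton_in_triangle_edges:
  "{a, b} \<in> triangle_edges j m \<longleftrightarrow>
    a \<noteq> b \<and> j \<le> a \<and> j \<le> b \<and> a < j + 3 * m \<and> b < j + 3 * m \<and> (a - j) div 3 = (b - j) div 3"
proof -
  have block: "a \<in> {j + 3 * k, j + 3 * k + 1, j + 3 * k + 2} \<longleftrightarrow> j \<le> a \<and> (a - j) div 3 = k" for a k
  proof -
    have "a \<in> {j + 3 * k, j + 3 * k + 1, j + 3 * k + 2} \<longleftrightarrow> j + 3 * k \<le> a \<and> a < j + 3 * k + 3" by auto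
    also have "\<dots> \<longleftrightarrow> j \<le> a \<and> (a - j) div 3 = k" by (auto simp: div_nat_eqI)
    finally show ?thesis .
  qed
  have "{a, b} \<in> triangle_edges j m \<longleftrightarrow> (\<exists>k<m. a \<noteq> b \<and> j \<le> a \<and> j \<le> b \<and> (a - j) div 3 = k \<and> (b - j) div 3 = k)"
    unfolding triangle_edges_def UN_iff doubleton_in_clique_edges block by auto
  also have "\<dots> \<longleftrightarrow> a \<noteq> b \<and> j \<le> a \<and> j \<le> b \<and> (a - j) div 3 < m \<and> (a - j) div 3 = (b - j) div 3"
    by auto
  also have "\<dots> \<longleftrightarrow> a \<noteq> b \<and> j \<le> a \<and> j \<le> b \<and> a < j + 3 * m \<and> b < j + 3 * m \<and> (a - j) div 3 = (b - j) div 3"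
  proof -
    have "(x - j) div 3 < m \<longleftrightarrow> x < j + 3 * m" if "j \<le> x" for x
      using that by (auto simp: div_less_iff_less_mult)
    then show ?thesis by metis
  qed
  finally show ?thesis .
qed

lemma gadj_graph_F:
  assumes "j \<le> i" "i \<le> n" "3 dvd (i - j)"
  shows "gadj (graph_F n i j) a b \<longleftrightarrow> a < n \<and> b < n \<and>
    (a < i \<and> i \<le> b \<or> b < i \<and> i \<le> a \<or> a < i \<and> b < i \<and> star_triangles j a b)"
proof -
  have 3: "3 * ((i - j) div 3) = i - j" using assms(3) by simp
  show ?thesis
    unfolding gadj_def graph_F_def snd_conv Un_iff doubleton_in_bipartite_edges doubleton_in_star_edges
      doubleton_in_triangle_edges 3 star_triangles_def
    using assms(1,2) by auto
qed

lemma simple_graph_graph_F: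
  assumes "j \<le> i" "i \<le> n" "3 dvd (i - j)"
  shows "simple_graph (graph_F n i j)"
  unfolding simple_graph_def
proof (intro conjI ballI)
  fix e assume e: "e \<in> edges (graph_F n i j)"
  have "\<exists>a b. e = {a, b}"
    using e by (auto simp: graph_F_def bipartite_edges_def star_edges_def triangle_edges_def clique_edges_def)
  then obtain a b where ab: "e = {a, b}" by blast
  then have "gadj (graph_F n i j) a b" using e by (simp add: gadj_def)
  then have "a < n" "b < n" "a \<noteq> b" unfolding gadj_graph_F[OF assms] by (auto simp: star_triangles_def)
  then show "e \<subseteq> verts (graph_F n i j)" "card e = 2" using ab by (auto simp: graph_F_def)
qed (simp add: graph_F_def)

text \<open>With \<open>j = 0\<close> the star disappears, so both families can be handled through
  \<open>graph_F\<close>.\<close>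

lemma graph_F_0: "graph_F n i 0 = graph_H n i"
  by (simp add: graph_F_def graph_H_def star_edges_def)

lemma star_triangles_noP4:
  assumes e: "star_triangles j a b" "star_triangles j b c" "star_triangles j c d"
  shows "a = c \<or> a = d \<or> b = d"
proof (cases "a < j")
  case True
  then show ?thesis using e by (auto simp: star_triangles_def)
next
  case False
  then have le: "j \<le> a" "j \<le> b" "j \<le> c" "j \<le> d" "a \<noteq> b" "b \<noteq> c" "c \<noteq> d"
    and div: "(a - j) div 3 = (b - j) div 3" "(b - j) div 3 = (c - j) div 3" "(c - j) div 3 = (d - j) div 3"
    using e by (auto simp: star_triangles_def)
  \<comment> \<open>The first index of the block of \<open>a\<close>; all four indices lie among
    three consecutive numbers, so two of them coincide.\<close>
  define m where "m = j + 3 * ((a - j) div 3)"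
  have "x = m \<or> x = m + 1 \<or> x = m + 2" if "j \<le> x" "(x - j) div 3 = (a - j) div 3" for x
  proof -
    have "x - j = 3 * ((a - j) div 3) + (x - j) mod 3" using that(2) mult_div_mod_eq[of 3 "x - j"] by simp
    moreover have "(x - j) mod 3 < 3" by simp
    ultimately show ?thesis using that(1) m_def by linarith
  qed
  from this[of a] this[of b] this[of c] this[of d] show ?thesis using le div by auto
qed

context sgraph
begin

lemma ne_star_triangles:
  fixes h :: "nat \<Rightarrow> 'a"
  assumes inj: "inj_on h {0..<i}"
    and adj: "\<And>a b. a < i \<Longrightarrow> b < i \<Longrightarrow> adj (h a) (h b) \<longleftrightarrow> star_triangles j a b"
    and j: "j \<le> i" "3 dvd (i - j)"
  shows "ne (h ` {0..<i}) = (if j = 0 then i else i - 1)"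
proof -
  have hne: "h a \<noteq> h b" if "a \<noteq> b" "a < i" "b < i" for a b using inj that by (auto simp: inj_on_def)
  have "ne (h ` {0..<j + 3 * q}) = (if j = 0 then 0 else j - 1) + 3 * q" if "j + 3 * q \<le> i" for q
    using that
  proof (induction q)
    case 0
    show ?case
    proof (cases "j = 0")
      case False
      have "\<not> adj (h a) (h b)" if "a \<in> {1..<j}" "b \<in> {1..<j}" for a b
        using adj[of a b] that j by (auto simp: star_triangles_def)
      then have "indep (h ` {1..<j})" by (auto simp: indep_def)
      moreover have "h 0 \<noteq> h x" if "x \<in> {1..<j}" for x using hne[of 0 x] that j by simp
      then have "h 0 \<notin> h ` {1..<j}" by blast
      moreover have "dg (h 0) (h ` {1..<j}) = j - 1"
      proof -
        have "adj (h 0) (h x)" if "x \<in> {1..<j}" for x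
          using adj[of 0 x] that j by (simp add: star_triangles_def)
        then have "{y \<in> h ` {1..<j}. adj (h 0) y} = h ` {1..<j}" by blast
        moreover have "inj_on h {1..<j}" using inj j by (auto simp: inj_on_def)
        ultimately show ?thesis by (simp add: dg_def card_image)
      qed
      moreover have "{0..<j} = insert 0 {1..<j}" using False by auto
      ultimately show ?thesis using False ne_insert[of "h ` {1..<j}" "h 0"] ne_indep by simp
    qed simp
  next
    case (Suc q)
    define n where "n = j + 3 * q"
    have n: "j \<le> n" "3 dvd (n - j)" "n + 3 \<le> i" using Suc.prems n_def by auto
    let ?W = "h ` {0..<n}" and ?T = "h ` {n..<n + 3}"
    have nadj: "\<not> adj t w" if tw: "t \<in> ?T" "w \<in> ?W" for t w
    proof -
      obtain x y where xy: "t = h x" "w = h y" "n \<le> x" "x < n + 3" "y < n" using tw by auto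
      then have "\<not> star_triangles j y x" using star_triangles_append(1)[OF n(1,2)] by blast
      then show ?thesis using xy adj[of x y] n star_triangles_commute[of j x y] by simp
    qed
    have "(\<Sum>t\<in>?T. dg t ?W) = 0" using nadj by (auto intro!: dg_eq_0I)
    moreover have "clique ?T"
      unfolding clique_def
    proof (intro ballI impI)
      fix s t assume st: "s \<in> ?T" "t \<in> ?T" "s \<noteq> t"
      then obtain x y where xy: "s = h x" "t = h y" "n \<le> x" "x < n + 3" "n \<le> y" "y < n + 3" by auto
      then show "adj s t" using adj[of x y] star_triangles_append(2)[OF n(1,2), of y x] n st(3) by auto
    qed
    moreover have "card ?T = 3"
    proof -
      have "inj_on h {n..<n + 3}" using inj n by (auto simp: inj_on_def)
      then show ?thesis by (simp add: card_image)
    qed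
    moreover have "?W \<inter> ?T = {}"
    proof -
      have "h x \<noteq> h y" if "x < n" "n \<le> y" "y < n + 3" for x y using hne[of x y] that n by simp
      then show ?thesis by auto
    qed
    moreover have "{0..<j + 3 * Suc q} = {0..<n} \<union> {n..<n + 3}" using n_def by auto
    ultimately have "ne (h ` {0..<j + 3 * Suc q}) = ne ?W + 3"
      using ne_Un[of ?W ?T] ne_clique[of ?T] by (simp add: image_Un)
    then show ?case using Suc n_def by simp
  qed
  from this[of "(i - j) div 3"] show ?thesis using j by (auto simp: dvd_mult_div_cancel)
qed

text \<open>Only a disjoint union of triangles has as many inner edges as vertices, which explains
  the loss of one when 3 does not divide \<open>card X\<close>. Equality makes both the inner and
  the cross estimate sharp.\<close>

lemma ne_le_part_size:
  assumes fin: "finite V" and X: "X \<subseteq> V" "noP4 X" and Y: "indep (V - X)"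
  shows "ne V \<le> part_size (card V) (card X)"
    and "ne V = part_size (card V) (card X) \<Longrightarrow>
      (\<forall>x\<in>X. \<forall>y\<in>V - X. adj x y) \<and> ne X + (if 3 dvd card X then 0 else 1) = card X"
proof -
  have finX: "finite X" using fin X finite_subset by blast
  have cY: "card (V - X) = card V - card X" using card_Diff_subset[OF finX X(1)] .
  have cross: "(\<Sum>y\<in>V - X. dg y X) \<le> card X * card (V - X)"
    by (rule sum_dg_le) (use fin dg_le[OF finX] in auto)
  have "ne X \<noteq> card X" if "\<not> 3 dvd card X"
    using noP4_structure(2)[OF finX X(2)] that by auto
  then have neX: "ne X + (if 3 dvd card X then 0 else 1) \<le> card X"
    using noP4_structure(1)[OF finX X(2)] by auto
  have eV: "ne V = ne X + (\<Sum>y\<in>V - X. dg y X)" using ne_split[OF fin X(1)] ne_indep[OF Y] by simp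
  show "ne V \<le> part_size (card V) (card X)"
    using eV neX cross unfolding part_size_def cY by linarith
  assume eq: "ne V = part_size (card V) (card X)"
  then have full: "(\<Sum>y\<in>V - X. dg y X) \<ge> card X * card (V - X)"
    and neX': "ne X + (if 3 dvd card X then 0 else 1) = card X"
    using eV neX cross unfolding part_size_def cY by linarith+
  have "dg y X = card X" if "y \<in> V - X" for y
    by (rule sum_eq_upper_bound[OF _ _ full that]) (use fin dg_le[OF finX] in auto)
  then have "adj x y" if "x \<in> X" "y \<in> V - X" for x y using dg_full[OF finX, of y x] that sym by simp
  then show "(\<forall>x\<in>X. \<forall>y\<in>V - X. adj x y) \<and> ne X + (if 3 dvd card X then 0 else 1) = card X"
    using neX' by blast
qed

end

lemma graph_F_extremal:
  assumes "j \<le> i" "i \<le> n" "3 dvd (i - j)" "j = 0 \<longleftrightarrow> 3 dvd i"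
  shows "prism_free (gadj (graph_F n i j))" and "card (edges (graph_F n i j)) = part_size n i"
proof -
  let ?G = "graph_F n i j"
  note simple = simple_graph_graph_F[OF assms(1-3)] and adj = gadj_graph_F[OF assms(1-3)]
  interpret sgraph "gadj ?G" by (rule gadj_sgraph[OF simple])
  have P4: "noP4 {0..<i}"
    unfolding noP4_def
  proof (intro ballI impI)
    fix a b c d assume "a \<in> {0..<i}" "b \<in> {0..<i}" "c \<in> {0..<i}" "d \<in> {0..<i}"
      "gadj ?G a b" "gadj ?G b c" "gadj ?G c d"
    then show "a = c \<or> a = d \<or> b = d" by (intro star_triangles_noP4[of j]) (auto simp: adj)
  qed
  have ind: "indep {i..<n}" unfolding indep_def adj using assms(2) by auto
  show "prism_free (gadj ?G)"
    by (rule noP4_indep_prism_free[OF P4 ind]) (auto simp: adj)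
  have V: "verts ?G = {0..<i} \<union> {i..<n}" using assms(2) by (auto simp: graph_F_def)
  have "dg t {0..<i} = i" if "t \<in> {i..<n}" for t
  proof -
    have "{y \<in> {0..<i}. gadj ?G t y} = {0..<i}" using that assms(2) by (auto simp: adj)
    then show ?thesis by (simp add: dg_def)
  qed
  then have "ne (verts ?G) = ne {0..<i} + (n - i) * i"
    unfolding V using ne_Un[of "{0..<i}" "{i..<n}"] ne_indep[OF ind] by auto
  moreover have "ne {0..<i} = (if j = 0 then i else i - 1)"
    using ne_star_triangles[of "\<lambda>x. x" i j] assms by (simp add: adj)
  ultimately show "card (edges ?G) = part_size n i"
    using card_edges[OF simple] assms(1,4) by (auto simp: part_size_def algebra_simps)
qed

lemma iso_graph_F:
  assumes G: "simple_graph G" and X: "X \<subseteq> verts G"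
    and h: "bij_betw h {0..<card X} X"
      "\<And>a b. a < card X \<Longrightarrow> b < card X \<Longrightarrow> gadj G (h a) (h b) \<longleftrightarrow> star_triangles j a b"
    and full: "\<And>x y. x \<in> X \<Longrightarrow> y \<in> verts G - X \<Longrightarrow> gadj G x y"
    and ind: "\<And>x y. x \<in> verts G - X \<Longrightarrow> y \<in> verts G - X \<Longrightarrow> \<not> gadj G x y"
    and j: "j \<le> card X" "3 dvd (card X - j)"
  shows "G \<simeq> graph_F (card (verts G)) (card X) j"
proof (rule graph_iso_sym)
  define n i where "n = card (verts G)" and "i = card X"
  have fin: "finite (verts G)" using G by (simp add: simple_graph_def)
  have in': "i \<le> n" using card_mono[OF fin X] by (simp add: n_def i_def)
  have "card {i..<n} = card (verts G - X)"
    using card_Diff_subset[OF finite_subset[OF X fin] X] by (simp add: n_def i_def)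
  then obtain g where g: "bij_betw g {i..<n} (verts G - X)"
    using finite_same_card_bij[of "{i..<n}" "verts G - X"] fin by auto
  define f where "f = (\<lambda>k. if k < i then h k else g k)"
  have 1: "bij_betw f {0..<i} X"
    using h(1) unfolding i_def[symmetric] by (subst bij_betw_cong[where g = h]) (auto simp: f_def)
  have 2: "bij_betw f {i..<n} (verts G - X)"
    using g by (subst bij_betw_cong[where g = g]) (auto simp: f_def)
  have "bij_betw f ({0..<i} \<union> {i..<n}) (X \<union> (verts G - X))"
    using bij_betw_combine[OF 1 2] by blast
  moreover have "{0..<i} \<union> {i..<n} = {0..<n}" "X \<union> (verts G - X) = verts G" using in' X by auto
  ultimately have f: "bij_betw f {0..<n} (verts G)" by simp
  note adj_F = gadj_graph_F[OF j(1)[folded i_def] in' j(2)[folded i_def]]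
  have fX: "f a \<in> X" if "a < i" for a using 1 that by (auto simp: bij_betw_def)
  have fY: "f a \<in> verts G - X" if "i \<le> a" "a < n" for a using 2 that unfolding bij_betw_def by auto
  interpret sgraph "gadj G" by (rule gadj_sgraph[OF G])
  have "gadj (graph_F n i j) a b \<longleftrightarrow> gadj G (f a) (f b)" if ab: "a < n" "b < n" for a b
  proof -
    consider "a < i" "b < i" | "a < i" "i \<le> b" | "i \<le> a" "b < i" | "i \<le> a" "i \<le> b" by linarith
    then show ?thesis
    proof cases
      case 1
      then show ?thesis
        unfolding adj_F using h(2)[of a b] ab by (simp add: f_def i_def)
    next
      case 2
      then show ?thesis
        unfolding adj_F using full[OF fX fY] ab by simp
    next
      case 3
      then show ?thesis
        unfolding adj_F using sym[OF full[OF fX fY]] ab by simp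
    next
      case 4
      then show ?thesis
        unfolding adj_F using ind[OF fY fY] ab by simp
    qed
  qed
  moreover have "verts (graph_F n i j) = {0..<n}" by (simp add: graph_F_def)
  ultimately show "graph_F (card (verts G)) (card X) j \<simeq> G"
    unfolding graph_iso_gadj n_def[symmetric] i_def[symmetric] using f by (intro exI[of _ f]) auto
qed

section \<open>The exceptional graphs as two cliques sharing an edge\<close>

lemma bij_betw_finite_card_eq:
  assumes "finite A" "finite B" "card A = card B"
  obtains f where "bij_betw f A B"
  using finite_same_card_bij[OF assms] by blast

abbreviation two_clique_graph :: "'a ugraph \<Rightarrow> 'a set \<Rightarrow> 'a set \<Rightarrow> bool" where
  "two_clique_graph G \<equiv> sgraph.two_cliques (gadj G) (verts G)"

lemma two_clique_graphD:
  assumes G: "simple_graph G" and tc: "two_clique_graph G S T"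
  shows "verts G = S \<union> T" "finite S" "finite T" "card S = 5" "card (S \<inter> T) = 2" "card (S - T) = 3"
    "card (T - S) + 5 = card (verts G)"
    "\<And>x y. x \<in> S \<union> T \<Longrightarrow> y \<in> S \<union> T \<Longrightarrow> gadj G x y \<longleftrightarrow> x \<noteq> y \<and> (x \<in> S \<and> y \<in> S \<or> x \<in> T \<and> y \<in> T)"
proof -
  interpret sgraph "gadj G" by (rule gadj_sgraph[OF G])
  show *: "verts G = S \<union> T" "card S = 5" "card (S \<inter> T) = 2"
    "\<And>x y. x \<in> S \<union> T \<Longrightarrow> y \<in> S \<union> T \<Longrightarrow> gadj G x y \<longleftrightarrow> x \<noteq> y \<and> (x \<in> S \<and> y \<in> S \<or> x \<in> T \<and> y \<in> T)"
    using tc by (auto simp: two_cliques_def)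
  show fin: "finite S" "finite T" using G *(1) by (auto simp: simple_graph_def)
  show "card (S - T) = 3" using *(2,3) fin by (simp add: card_Diff_subset_Int)
  have "card (S \<union> (T - S)) = card S + card (T - S)" using fin by (intro card_Un_disjoint) auto
  then show "card (T - S) + 5 = card (verts G)" using * by simp
qed

text \<open>The three regions have sizes 2, 3 and \<open>card (verts G) - 5\<close>, and adjacency
  depends only on the regions, so any bijections between corresponding regions can be glued.\<close>

lemma two_clique_graph_iso:
  assumes G: "simple_graph G" "two_clique_graph G S T" and H: "simple_graph H" "two_clique_graph H S' T'"
    and card: "card (verts G) = card (verts H)"
  shows "G \<simeq> H"
proof -
  note g = two_clique_graphD[OF G] and h = two_clique_graphD[OF H]
  obtain f1 where f1: "bij_betw f1 (S \<inter> T) (S' \<inter> T')"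
    by (rule bij_betw_finite_card_eq[of "S \<inter> T" "S' \<inter> T'"]) (use g h in simp_all)
  obtain f2 where f2: "bij_betw f2 (S - T) (S' - T')"
    by (rule bij_betw_finite_card_eq[of "S - T" "S' - T'"]) (use g h in simp_all)
  have "card (T - S) = card (T' - S')" using g(7) h(7) card by simp
  then obtain f3 where f3: "bij_betw f3 (T - S) (T' - S')"
    using bij_betw_finite_card_eq[of "T - S" "T' - S'"] g h by blast
  define f where "f = (\<lambda>x. if x \<in> S \<inter> T then f1 x else if x \<in> S then f2 x else f3 x)"
  have 1: "bij_betw f (S \<inter> T) (S' \<inter> T')" using f1 by (subst bij_betw_cong[where g = f1]) (auto simp: f_def)
  have 2: "bij_betw f (S - T) (S' - T')" using f2 by (subst bij_betw_cong[where g = f2]) (auto simp: f_def)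
  have 3: "bij_betw f (T - S) (T' - S')" using f3 by (subst bij_betw_cong[where g = f3]) (auto simp: f_def)
  have "bij_betw f ((S \<inter> T) \<union> (S - T) \<union> (T - S)) ((S' \<inter> T') \<union> (S' - T') \<union> (T' - S'))"
    by (intro bij_betw_combine 1 2 3) auto
  moreover have "(S \<inter> T) \<union> (S - T) \<union> (T - S) = S \<union> T" "(S' \<inter> T') \<union> (S' - T') \<union> (T' - S') = S' \<union> T'"
    by blast+
  ultimately have f: "bij_betw f (S \<union> T) (S' \<union> T')" by (simp only:)
  have m: "f x \<in> S' \<union> T'" "f x \<in> S' \<longleftrightarrow> x \<in> S" "f x \<in> T' \<longleftrightarrow> x \<in> T" if x: "x \<in> S \<union> T" for x
  proof -
    have "x \<in> S \<inter> T \<Longrightarrow> f x \<in> S' \<inter> T'" "x \<in> S - T \<Longrightarrow> f x \<in> S' - T'" "x \<in> T - S \<Longrightarrow> f x \<in> T' - S'"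
      using 1 2 3 by (auto dest: bij_betwE)
    then show "f x \<in> S' \<union> T'" "f x \<in> S' \<longleftrightarrow> x \<in> S" "f x \<in> T' \<longleftrightarrow> x \<in> T" using x by blast+
  qed
  have "gadj G x y \<longleftrightarrow> gadj H (f x) (f y)" if xy: "x \<in> S \<union> T" "y \<in> S \<union> T" for x y
  proof -
    have "f x = f y \<longleftrightarrow> x = y" using f xy by (auto simp: bij_betw_def inj_on_def)
    then show ?thesis using g(8)[OF xy] h(8)[OF m(1)[OF xy(1)] m(1)[OF xy(2)]] m[OF xy(1)] m[OF xy(2)] by simp
  qed
  then show ?thesis unfolding graph_iso_gadj g(1) h(1) using f by blast
qed

lemma two_clique_graph_extremal:
  assumes G: "simple_graph G" "two_clique_graph G S T" and n: "card (verts G) \<in> {6, 7, 8}"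
  shows "prism_free (gadj G)" and "card (edges G) = exn (card (verts G))"
proof -
  note g = two_clique_graphD[OF G]
  interpret sgraph "gadj G" by (rule gadj_sgraph[OF G(1)])
  have "card T = card (S \<inter> T) + card (T - S)"
  proof -
    have "T = (S \<inter> T) \<union> (T - S)" "(S \<inter> T) \<inter> (T - S) = {}" by auto
    then show ?thesis using card_Un_disjoint[of "S \<inter> T" "T - S"] g(2,3) by simp
  qed
  then have cT: "card T \<le> 5" using g(5,7) n by auto
  show "prism_free (gadj G)"
  proof (rule two_cliques_prism_free[OF g(2,3)])
    show "x \<in> S \<and> y \<in> S \<or> x \<in> T \<and> y \<in> T" if "gadj G x y" for x y
      using g(8)[of x y] gadj_verts[OF G(1) that] that g(1) by blast
  qed (use g cT in simp_all)
  have "2 * ne (S \<union> T) = card S * (card S - 1) + card (T - S) * (card (T - S) - 1) + 2 * card (S \<inter> T) * card (T - S)"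
    by (rule ne_two_cliques[OF g(2,3)]) (rule g(8))
  moreover have "card (T - S) = card (verts G) - 5" using g(7) by simp
  ultimately have "2 * card (edges G) = 20 + (card (verts G) - 5) * (card (verts G) - 5 - 1) + 4 * (card (verts G) - 5)"
    using g(1,4,5) card_edges[OF G(1)] by simp
  then show "card (edges G) = exn (card (verts G))" using n by (auto simp: exn_values)
qed

lemma simple_graph_cliques:
  assumes "finite V" "S \<subseteq> V" "T \<subseteq> V"
  shows "simple_graph (V, clique_edges S \<union> clique_edges T)"
  using assms by (fastforce simp: simple_graph_def clique_edges_def)

lemma two_clique_graph_cliques:
  assumes "finite (S \<union> T)" "card S = 5" "card (S \<inter> T) = 2"
  shows "two_clique_graph (S \<union> T, clique_edges S \<union> clique_edges T) S T"
proof -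
  interpret sgraph "gadj (S \<union> T, clique_edges S \<union> clique_edges T)"
    by (rule gadj_sgraph[OF simple_graph_cliques]) (use assms in auto)
  show ?thesis
    using assms unfolding two_cliques_def by (auto simp: gadj_def doubleton_in_clique_edges)
qed

text \<open>The two edges at vertex 1 become a triangle, as its third edge \<open>{2, 3}\<close>
  already belongs to the K5.\<close>

lemma G1_cliques: "G1 = ({2, 3, 4, 5, 6} \<union> {1, 2, 3}, clique_edges {2, 3, 4, 5, 6} \<union> clique_edges {1, 2, 3})"
proof -
  have "clique_edges {1, 2, 3} \<subseteq> clique_edges {2, 3, 4, 5, 6} \<union> {{1, 2}, {1, 3 :: nat}}"
    by (auto simp: clique_edges_def insert_commute)
  moreover have "{{1, 2}, {1, 3 :: nat}} \<subseteq> clique_edges {1, 2, 3}"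
    by (simp add: doubleton_in_clique_edges)
  ultimately have "clique_edges {2, 3, 4, 5, 6} \<union> {{1, 2}, {1, 3 :: nat}} = clique_edges {2, 3, 4, 5, 6} \<union> clique_edges {1, 2, 3}"
    by blast
  moreover have "{1..6} = {2, 3, 4, 5, 6} \<union> {1, 2, 3 :: nat}" by auto
  ultimately show ?thesis unfolding G1_def by simp
qed

lemma G2_cliques: "G2 = ({0, 1, 2, 3, 4} \<union> {3, 4, 5, 6}, clique_edges {0, 1, 2, 3, 4} \<union> clique_edges {3, 4, 5, 6})"
proof -
  have "{0..6} = {0, 1, 2, 3, 4} \<union> {3, 4, 5, 6 :: nat}" by auto
  then show ?thesis unfolding G2_def by simp
qed

lemma G3_cliques: "G3 = ({7, 1, 2, 3, 4} \<union> {8, 3, 4, 5, 6}, clique_edges {7, 1, 2, 3, 4} \<union> clique_edges {8, 3, 4, 5, 6})"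
proof -
  have "{1..8} = {7, 1, 2, 3, 4} \<union> {8, 3, 4, 5, 6 :: nat}" by auto
  then show ?thesis unfolding G3_def by simp
qed

lemma exceptional_graphs_two_cliques:
  "simple_graph G1" "two_clique_graph G1 {2, 3, 4, 5, 6} {1, 2, 3}" "card (verts G1) = 6"
  "simple_graph G2" "two_clique_graph G2 {0, 1, 2, 3, 4} {3, 4, 5, 6}" "card (verts G2) = 7"
  "simple_graph G3" "two_clique_graph G3 {7, 1, 2, 3, 4} {8, 3, 4, 5, 6}" "card (verts G3) = 8"
proof -
  show "simple_graph G1" "simple_graph G2" "simple_graph G3"
    unfolding G1_cliques G2_cliques G3_cliques by (rule simple_graph_cliques; simp)+
  show "two_clique_graph G1 {2, 3, 4, 5, 6} {1, 2, 3}"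
    unfolding G1_cliques by (rule two_clique_graph_cliques) simp_all
  show "two_clique_graph G2 {0, 1, 2, 3, 4} {3, 4, 5, 6}"
    unfolding G2_cliques by (rule two_clique_graph_cliques) simp_all
  show "two_clique_graph G3 {7, 1, 2, 3, 4} {8, 3, 4, 5, 6}"
    unfolding G3_cliques by (rule two_clique_graph_cliques) simp_all
qed (simp_all add: G1_def G2_def G3_def)

section \<open>Assembling the characterisation\<close>

definition admissible :: "nat \<Rightarrow> nat \<Rightarrow> nat \<Rightarrow> bool" where
  "admissible n i j \<longleftrightarrow> i \<le> n \<and> part_size n i = exn n \<and> j \<le> i \<and> 3 dvd (i - j) \<and> (j = 0 \<longleftrightarrow> 3 dvd i)"

lemma admissible_graph_F:
  assumes "admissible n i j"
  shows "simple_graph (graph_F n i j)" "prism_free (gadj (graph_F n i j))" "card (edges (graph_F n i j)) = exn n"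
  using assms simple_graph_graph_F graph_F_extremal by (auto simp: admissible_def)

text \<open>Equality squeezes the chain from the edge number through \<open>part_size\<close> to
  \<open>exn\<close>: the size of \<open>X\<close> is optimal, all cross pairs are joined, and
  \<open>X\<close> consists of triangles and at most one star.\<close>

lemma extremal_partition_iso:
  assumes G: "simple_graph G" and eq: "card (edges G) = exn (card (verts G))"
    and X: "X \<subseteq> verts G" "sgraph.noP4 (gadj G) X" "sgraph.indep (gadj G) (verts G - X)"
  shows "\<exists>i j. admissible (card (verts G)) i j \<and> G \<simeq> graph_F (card (verts G)) i j"
proof -
  interpret sgraph "gadj G" by (rule gadj_sgraph[OF G])
  have fin: "finite (verts G)" "finite X" using G X(1) finite_subset by (auto simp: simple_graph_def)
  have le: "card X \<le> card (verts G)" using card_mono[OF fin(1) X(1)] .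
  have ne: "ne (verts G) = exn (card (verts G))" using eq card_edges[OF G] by simp
  have size: "part_size (card (verts G)) (card X) = exn (card (verts G))"
    using ne_le_part_size(1)[OF fin(1) X] part_size_exn(1)[OF le] ne by simp
  then have full: "\<forall>x\<in>X. \<forall>y\<in>verts G - X. gadj G x y"
    and neX: "ne X + (if 3 dvd card X then 0 else 1) = card X"
    using ne_le_part_size(2)[OF fin(1) X] ne by simp_all
  have "ne X + 1 \<ge> card X" using neX by (simp split: if_splits)
  then obtain j h where jh: "j \<le> card X" "3 dvd (card X - j)" "j = 0 \<longleftrightarrow> ne X = card X"
    "bij_betw h {0..<card X} X" "\<forall>a<card X. \<forall>b<card X. gadj G (h a) (h b) \<longleftrightarrow> star_triangles j a b"
    using noP4_structure(2)[OF fin(2) X(2)] by blast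
  have "ne X = card X \<longleftrightarrow> 3 dvd card X" using neX by (simp split: if_splits)
  then have "admissible (card (verts G)) (card X) j" using le size jh by (simp add: admissible_def)
  moreover have "G \<simeq> graph_F (card (verts G)) (card X) j"
    by (rule iso_graph_F[OF G X(1) jh(4)]) (use jh full X(3) in \<open>auto simp: indep_def\<close>)
  ultimately show ?thesis by blast
qed

lemma admissible_exists: "\<exists>i j. admissible n i j"
proof -
  define i where "i = (if n mod 6 = 0 \<or> n mod 6 = 2 then n div 2 else if n mod 6 = 4 then n div 2 + 1 else (n + 1) div 2)"
  have "i \<le> n" unfolding i_def by (simp; presburger)
  moreover have "n mod 6 < 6" by simp
  then have "n mod 6 = 0 \<or> n mod 6 = 1 \<or> n mod 6 = 2 \<or> n mod 6 = 3 \<or> n mod 6 = 4 \<or> n mod 6 = 5"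
    by linarith
  then have "part_size n i = exn n"
    unfolding part_size_exn(2)[OF \<open>i \<le> n\<close>] by (elim disjE) (simp_all add: i_def)
  \<comment> \<open>The residue \<open>i mod 3\<close> differs from \<open>i\<close> by a multiple
    of 3 and vanishes exactly when 3 divides \<open>i\<close>.\<close>
  ultimately have "admissible n i (i mod 3)" by (simp add: admissible_def dvd_eq_mod_eq_0 minus_mod_eq_mult_div)
  then show ?thesis by blast
qed

lemma extremal_graph_iff:
  fixes G :: "'a ugraph"
  assumes G: "simple_graph G" and n: "n \<ge> 6"
  shows "extremal_graph n prism G \<longleftrightarrow>
    n = 6 \<and> G \<simeq> G1 \<or> n = 7 \<and> G \<simeq> G2 \<or> n = 8 \<and> G \<simeq> G3 \<or> (\<exists>i j. admissible n i j \<and> G \<simeq> graph_F n i j)"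
    (is "_ \<longleftrightarrow> ?R")
proof
  have bound: "card (edges G') \<le> exn n" if "free_graph n prism G'" for G' :: "'a ugraph"
  proof -
    have G': "simple_graph G'" "card (verts G') = n" "\<not> contains_copy G' prism" using that by (auto simp: free_graph_def)
    interpret prism_free "gadj G'" by (rule no_copy_imp_prism_free[OF G'(1,3)])
    have "finite (verts G')" using G'(1) by (simp add: simple_graph_def)
    then show ?thesis
      using prism_free_extremal[of "verts G'", THEN conjunct1] G'(2) n card_edges[OF G'(1)] by simp
  qed
  show "extremal_graph n prism G" if R: ?R
  proof -
    have *: "extremal_graph n prism G" if H: "G \<simeq> H" "simple_graph H" "card (verts H) = n" "prism_free (gadj H)"
      "card (edges H) = exn n" for H :: "nat ugraph"
    proof -
      have "\<not> contains_copy G prism"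
        by (rule prism_free_imp_no_copy[OF graph_iso_prism_free[OF G H(1,4)]])
      then show ?thesis
        using G H graph_iso_card_edges[OF G H(2,1)] graph_iso_card_verts[OF H(1)] bound
        by (simp add: extremal_graph_def free_graph_def)
    qed
    note E = two_clique_graph_extremal
    from R consider "n = 6" "G \<simeq> G1" | "n = 7" "G \<simeq> G2" | "n = 8" "G \<simeq> G3"
      | i j where "admissible n i j" "G \<simeq> graph_F n i j" by blast
    then show ?thesis
    proof cases
      case 1
      then show ?thesis using *[of G1] E[OF exceptional_graphs_two_cliques(1,2)] exceptional_graphs_two_cliques by simp
    next
      case 2
      then show ?thesis using *[of G2] E[OF exceptional_graphs_two_cliques(4,5)] exceptional_graphs_two_cliques by simp
    next
      case 3
      then show ?thesis using *[of G3] E[OF exceptional_graphs_two_cliques(7,8)] exceptional_graphs_two_cliques by simp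
    next
      case 4
      then show ?thesis
        using *[of "graph_F n i j"] admissible_graph_F[OF 4(1)] by (simp add: graph_F_def)
    qed
  qed
  assume ext: "extremal_graph n prism G"
  then have free: "free_graph n prism G" and cV: "card (verts G) = n" "\<not> contains_copy G prism"
    by (auto simp: extremal_graph_def free_graph_def)
  have fin: "finite (verts G)" using G by (simp add: simple_graph_def)
  \<comment> \<open>Extremality compares graphs over the vertex type of \<open>G\<close>, so a
    candidate is copied onto the vertices of \<open>G\<close> along a bijection.\<close>
  have "card (edges G) \<ge> exn n"
  proof -
    obtain i j where ij: "admissible n i j" using admissible_exists by blast
    note F = admissible_graph_F[OF ij]
    have vF: "verts (graph_F n i j) = {0..<n}" by (simp add: graph_F_def)
    obtain f where f: "bij_betw f {0..<n} (verts G)"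
      using bij_betw_finite_card_eq[of "{0..<n}" "verts G"] fin cV by auto
    then have inj: "inj_on f (verts (graph_F n i j))" unfolding vF by (simp add: bij_betw_def)
    define G' where "G' = (f ` verts (graph_F n i j), image f ` edges (graph_F n i j))"
    have G': "simple_graph G'" "G' \<simeq> graph_F n i j"
      using graph_iso_image[OF inj F(1)] graph_iso_sym unfolding G'_def by blast+
    have "\<not> contains_copy G' prism"
      by (rule prism_free_imp_no_copy[OF graph_iso_prism_free[OF G' F(2)]])
    moreover have "card (verts G') = n" using graph_iso_card_verts[OF G'(2)] vF by simp
    ultimately have "free_graph n prism G'" using G' by (simp add: free_graph_def)
    then have "card (edges G') \<le> card (edges G)" using ext unfolding extremal_graph_def by blast
    then show ?thesis using graph_iso_card_edges[OF G'(1) F(1) G'(2)] F(3) by simp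
  qed
  then have eq: "card (edges G) = exn (card (verts G))" using bound[OF free] cV by simp
  interpret prism_free "gadj G" by (rule no_copy_imp_prism_free[OF G cV(2)])
  have "ne (verts G) = exn (card (verts G))" using eq card_edges[OF G] by simp
  then consider (cliques) S T where "card (verts G) \<le> 8" "two_cliques (verts G) S T"
    | (partition) X where "X \<subseteq> verts G" "noP4 X" "indep (verts G - X)"
    using prism_free_extremal[OF fin] n cV by blast
  then show ?R
  proof cases
    case cliques
    then have "n = 6 \<or> n = 7 \<or> n = 8" using n cV by linarith
    then show ?thesis
      using two_clique_graph_iso[OF G cliques(2)] exceptional_graphs_two_cliques cV by metis
  next
    case partition
    then show ?thesis using extremal_partition_iso[OF G eq] cV by simp
  qed
qed

text \<open>Separates the families again: \<open>j = 0\<close> is forced when 3 divides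
  \<open>i\<close> and excluded otherwise.\<close>

lemma admissible_iso_iff:
  "(\<exists>j. admissible n i j \<and> G \<simeq> graph_F n i j) \<longleftrightarrow>
    i \<le> n \<and> part_size n i = exn n \<and> (if 3 dvd i then G \<simeq> graph_H n i else iso_some_F n i G)"
proof (cases "3 dvd i")
  case True
  then show ?thesis unfolding admissible_def by (auto simp: graph_F_0)
next
  case False
  then have "1 \<le> j \<longleftrightarrow> j \<noteq> 0" for j :: nat by linarith
  then show ?thesis using False unfolding admissible_def iso_some_F_def by auto
qed

theorem theorem1p3:
  fixes n :: nat and G :: "'a ugraph"
  assumes "n \<ge> 6" and "simple_graph G"
  shows
    "(n = 6 \<longrightarrow> (extremal_graph n prism G \<longleftrightarrow> G \<simeq> G1 \<or> G \<simeq> graph_H 6 3)) \<and>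
     (n = 7 \<longrightarrow> (extremal_graph n prism G \<longleftrightarrow>
        G \<simeq> G2 \<or> G \<simeq> graph_F 7 4 1 \<or> G \<simeq> graph_F 7 4 4 \<or> G \<simeq> graph_H 7 3)) \<and>
     (n = 8 \<longrightarrow> (extremal_graph n prism G \<longleftrightarrow>
        G \<simeq> G3 \<or> G \<simeq> graph_F 8 4 1 \<or> G \<simeq> graph_F 8 4 4 \<or>
        G \<simeq> graph_F 8 5 2 \<or> G \<simeq> graph_F 8 5 5)) \<and>
     (n \<ge> 9 \<longrightarrow>
       (n mod 6 = 0 \<longrightarrow> (extremal_graph n prism G \<longleftrightarrow> G \<simeq> graph_H n (n div 2))) \<and>
       (n mod 6 = 1 \<longrightarrow> (extremal_graph n prism G \<longleftrightarrow>
          iso_some_F n ((n + 1) div 2) G \<or> G \<simeq> graph_H n (n div 2))) \<and>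
       (n mod 6 = 2 \<longrightarrow> (extremal_graph n prism G \<longleftrightarrow>
          iso_some_F n (n div 2) G \<or> iso_some_F n (n div 2 + 1) G)) \<and>
       (n mod 6 = 3 \<longrightarrow> (extremal_graph n prism G \<longleftrightarrow>
          iso_some_F n ((n + 1) div 2) G \<or> G \<simeq> graph_H n ((n + 1) div 2 + 1))) \<and>
       (n mod 6 = 4 \<longrightarrow> (extremal_graph n prism G \<longleftrightarrow> G \<simeq> graph_H n (n div 2 + 1))) \<and>
       (n mod 6 = 5 \<longrightarrow> (extremal_graph n prism G \<longleftrightarrow> G \<simeq> graph_H n ((n + 1) div 2))))"
proof -
  define good where "good = (\<lambda>i. if 3 dvd i then G \<simeq> graph_H n i else iso_some_F n i G)"
  have H: "good i \<longleftrightarrow> G \<simeq> graph_H n i" if "3 dvd i" for i using that by (simp add: good_def)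
  have F: "good i \<longleftrightarrow> iso_some_F n i G" if "\<not> 3 dvd i" for i using that by (simp add: good_def)
  have "(\<exists>i j. admissible n i j \<and> G \<simeq> graph_F n i j) \<longleftrightarrow>
      (\<exists>i. i \<le> n \<and> part_size n i = exn n \<and> good i)"
    unfolding admissible_iso_iff good_def ..
  also have "\<dots> \<longleftrightarrow>
      n mod 6 = 0 \<and> good (n div 2) \<or>
      n mod 6 = 1 \<and> (good ((n + 1) div 2) \<or> good (n div 2)) \<or>
      n mod 6 = 2 \<and> (good (n div 2) \<or> good (n div 2 + 1)) \<or>
      n mod 6 = 3 \<and> (good ((n + 1) div 2) \<or> good ((n + 1) div 2 + 1)) \<or>
      n mod 6 = 4 \<and> good (n div 2 + 1) \<or>
      n mod 6 = 5 \<and> good ((n + 1) div 2)"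
  proof -
    have le: "(n + 1) div 2 + 1 \<le> n" "n div 2 + 1 \<le> n" "(n + 1) div 2 \<le> n" "n div 2 \<le> n"
      using assms(1) by presburger+
    have "i \<le> n \<and> part_size n i = exn n \<longleftrightarrow>
      n mod 6 = 0 \<and> i = n div 2 \<or>
      n mod 6 = 1 \<and> (i = (n + 1) div 2 \<or> i = n div 2) \<or>
      n mod 6 = 2 \<and> (i = n div 2 \<or> i = n div 2 + 1) \<or>
      n mod 6 = 3 \<and> (i = (n + 1) div 2 \<or> i = (n + 1) div 2 + 1) \<or>
      n mod 6 = 4 \<and> i = n div 2 + 1 \<or>
      n mod 6 = 5 \<and> i = (n + 1) div 2" for i
      using part_size_exn(2)[of i n] le by (cases "i \<le> n") auto
    then show ?thesis unfolding conj_assoc[symmetric] by auto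
  qed
  finally have ext: "extremal_graph n prism G \<longleftrightarrow>
      n = 6 \<and> G \<simeq> G1 \<or> n = 7 \<and> G \<simeq> G2 \<or> n = 8 \<and> G \<simeq> G3 \<or>
      n mod 6 = 0 \<and> good (n div 2) \<or>
      n mod 6 = 1 \<and> (good ((n + 1) div 2) \<or> good (n div 2)) \<or>
      n mod 6 = 2 \<and> (good (n div 2) \<or> good (n div 2 + 1)) \<or>
      n mod 6 = 3 \<and> (good ((n + 1) div 2) \<or> good ((n + 1) div 2 + 1)) \<or>
      n mod 6 = 4 \<and> good (n div 2 + 1) \<or>
      n mod 6 = 5 \<and> good ((n + 1) div 2)"
    using extremal_graph_iff[OF assms(2,1)] by simp
  \<comment> \<open>For seven and eight vertices the part sizes prime to 3 are 4 and 5, and the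
    theorem lists their values of \<open>j\<close> explicitly.\<close>
  have F4: "iso_some_F m 4 G \<longleftrightarrow> G \<simeq> graph_F m 4 1 \<or> G \<simeq> graph_F m 4 4" for m
  proof -
    have "1 \<le> j \<and> j \<le> 4 \<and> 3 dvd (4 - j) \<longleftrightarrow> j = 1 \<or> j = 4" for j :: nat by presburger
    then show ?thesis unfolding iso_some_F_def by metis
  qed
  have F5: "iso_some_F m 5 G \<longleftrightarrow> G \<simeq> graph_F m 5 2 \<or> G \<simeq> graph_F m 5 5" for m
  proof -
    have "1 \<le> j \<and> j \<le> 5 \<and> 3 dvd (5 - j) \<longleftrightarrow> j = 2 \<or> j = 5" for j :: nat by presburger
    then show ?thesis unfolding iso_some_F_def by metis
  qed
  show ?thesis
  proof (intro conjI impI)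
    assume n: "n = 6"
    show "extremal_graph n prism G \<longleftrightarrow> G \<simeq> G1 \<or> G \<simeq> graph_H 6 3"
      using ext H[of 3] by (simp add: n)
  next
    assume n: "n = 7"
    show "extremal_graph n prism G \<longleftrightarrow>
        G \<simeq> G2 \<or> G \<simeq> graph_F 7 4 1 \<or> G \<simeq> graph_F 7 4 4 \<or> G \<simeq> graph_H 7 3"
      using ext F[of 4] H[of 3] by (simp add: n F4)
  next
    assume n: "n = 8"
    show "extremal_graph n prism G \<longleftrightarrow>
        G \<simeq> G3 \<or> G \<simeq> graph_F 8 4 1 \<or> G \<simeq> graph_F 8 4 4 \<or> G \<simeq> graph_F 8 5 2 \<or> G \<simeq> graph_F 8 5 5"
      using ext F[of 4] F[of 5] by (simp add: n F4 F5)
  next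
    assume n: "n \<ge> 9" "n mod 6 = 0"
    have "3 dvd n div 2" using n by presburger
    then show "extremal_graph n prism G \<longleftrightarrow> G \<simeq> graph_H n (n div 2)"
      using ext n H by simp
  next
    assume n: "n \<ge> 9" "n mod 6 = 1"
    have "\<not> 3 dvd (n + 1) div 2" "3 dvd n div 2" using n by presburger+
    then show "extremal_graph n prism G \<longleftrightarrow> iso_some_F n ((n + 1) div 2) G \<or> G \<simeq> graph_H n (n div 2)"
      using ext n H F by simp
  next
    assume n: "n \<ge> 9" "n mod 6 = 2"
    have "\<not> 3 dvd n div 2" "\<not> 3 dvd (n div 2 + 1)" using n by presburger+
    then show "extremal_graph n prism G \<longleftrightarrow> iso_some_F n (n div 2) G \<or> iso_some_F n (n div 2 + 1) G"
      using ext n F by simp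
  next
    assume n: "n \<ge> 9" "n mod 6 = 3"
    have "\<not> 3 dvd (n + 1) div 2" "3 dvd ((n + 1) div 2 + 1)" using n by presburger+
    then show "extremal_graph n prism G \<longleftrightarrow>
        iso_some_F n ((n + 1) div 2) G \<or> G \<simeq> graph_H n ((n + 1) div 2 + 1)"
      using ext n H F by simp
  next
    assume n: "n \<ge> 9" "n mod 6 = 4"
    have "3 dvd (n div 2 + 1)" using n by presburger
    then show "extremal_graph n prism G \<longleftrightarrow> G \<simeq> graph_H n (n div 2 + 1)"
      using ext n H by simp
  next
    assume n: "n \<ge> 9" "n mod 6 = 5"
    have "3 dvd (n + 1) div 2" using n by presburger
    then show "extremal_graph n prism G \<longleftrightarrow> G \<simeq> graph_H n ((n + 1) div 2)"
      using ext n H by simp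
  qed
qed

end
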